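(* Let $\mathcal F$ be a singular foliation of a manifold $M$. Let $M_{>0}$ be the (open) set of points of $M$ lying in leaves of positive dimension, and let $\mathcal F_{>0}$ be the set of leaves of $\mathcal F$ of positive dimension, a singular foliation of $M_{>0}$. Suppose that the pullback by the quotient map $\pi:M_{>0}\to M_{>0}/\mathcal F_{>0}$ is an isomorphism $\pi^*:\Omega^\bullet(M_{>0}/\mathcal F_{>0})\to\Omega_b^\bullet(M_{>0},\mathcal F_{>0})$. Then the pullback by the quotient map $\pi:M\to M/\mathcal F$ is an isomorphism $\pi^*:\Omega^\bullet(M/\mathcal F)\to\Omega_b^\bullet(M,\mathcal F)$.
   Context: Manifolds are smooth, Hausdorff and second-countable. Leaf spaces carry the quotient diffeology. Diffeology. A parametrization into a set $X$ is a map from an open subset of some $\mathbb R^n$ into $X$. A diffeology on $X$ is a set of parametrizations, called plots, such that: constant parametrizations are plots; a parametrization that locally (near each point of its domain) coincides with a plot is a plot; if $P:U\to X$ is a plot and $F:V\to U$ is smooth, with $V$ open in a Cartesian space, then $P\circ F$ is a plot. The manifold diffeology on $M$ consists of all smooth maps from open subsets of Cartesian spaces into $M$. A map $f:X\to Y$ of diffeological spaces is diffeologically smooth if $f\circ P$ is a plot of $Y$ for every plot $P$ of $X$. For an equivalence relation on $X$ with quotient map $\pi$ onto the set of classes, the quotient diffeology consists of the parametrizations $P$ into the quotient such that each point of the domain has an open neighbourhood $V$ and a plot $Q:V\to X$ with $P|_V=\pi\circ Q$. Diffeological forms. A diffeological $k$-form $\alpha$ on $X$ assigns to each plot $P:U\to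 X$ a differential form $\alpha(P)\in\Omega^k(U)$ such that $\alpha(P\circ F)=F^*(\alpha(P))$ for every smooth $F:V\to U$ with $V$ open in a Cartesian space. The set of these is $\Omega^k(X)$, and $\Omega^\bullet(X)=\bigoplus_k\Omega^k(X)$ with $(d\alpha)(P)=d(\alpha(P))$ and $(\alpha\wedge\beta)(P)=\alpha(P)\wedge\beta(P)$. The pullback by a smooth $f:X\to Y$ is $(f^*\alpha)(P)=\alpha(f\circ P)$. On a manifold, an ordinary form $\alpha$ is identified with the diffeological form $P\mapsto P^*\alpha$; this identifies the ordinary and diffeological de Rham complexes. Singular foliations. The subset diffeology on $S\subseteq M$ consists of the parametrizations into $S$ that are plots of $M$. The D-topology of a diffeological space is the finest topology for which all plots are continuous. $S$ is a diffeological submanifold of $M$ if, with its subset diffeology, for some fixed $n$ every point of $S$ has a D-open neighbourhood which is diffeologically diffeomorphic to an open subset of $\mathbb R^n$; it is weakly-embedded if moreover the inclusion $S\hookrightarrow M$ is an immersion. A smooth singular distribution $\Delta$ on $M$ assigns to each $x$ a linear subspace $\Delta_x\subseteq T_xM$ such that for every $x$ and $v\in\Delta_x$ there is a smooth locally defined vector field $X$ with $X_x=v$ and $X_y\in\Delta_y$ for all $y\in\operatorname{dom}X$; such locally defined vector fields with values in $\Delta$ are its sections, forming $\Gamma_{\mathrm{loc}}(\Delta)$. A singular foliation of $M$ is a partition $\mathcal F$ of $M$ into connected weakly-embedded submanifolds, called leaves, such that $(\Delta_{\mathcal F})_x:=T_xL$ ($L$ the leaf containing $x$) is a smooth singular distribution.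 $M/\mathcal F$ is the set of leaves and $\pi$ sends a point to its leaf. Basic forms. $\alpha\in\Omega^\bullet(M)$ is $\mathcal F$-basic if $\iota_X\alpha=0$ and $\mathcal L_X\alpha=0$ for every $X\in\Gamma_{\mathrm{loc}}(\Delta_{\mathcal F})$. The complex of these is $\Omega_b^\bullet(M,\mathcal F)$. *)

theory Defs
  imports "HOL-Analysis.Analysis"
begin

section \<open>Smooth maps between open subsets of Cartesian spaces\<close>

text \<open>
  Plots have domains in every \<open>\<real>\<^sup>n\<close>, so the dimension has to be a term. We use the library space
  \<^const>\<open>Euclidean_space\<close>: points of \<open>\<real>\<^sup>n\<close> are sequences \<open>x\<close> with \<open>x i = 0\<close> for all \<open>i \<ge> n\<close>.
\<close>

type_synonym rvec = "nat \<Rightarrow> real"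

abbreviation Rn :: "nat \<Rightarrow> rvec set" where
  "Rn n \<equiv> topspace (Euclidean_space n)"

definition pd :: "nat \<Rightarrow> (rvec \<Rightarrow> real) \<Rightarrow> rvec \<Rightarrow> real" where
  "pd i f x = deriv (\<lambda>t. f (x(i := t))) (x i)"

primrec iter_pd :: "nat list \<Rightarrow> (rvec \<Rightarrow> real) \<Rightarrow> rvec \<Rightarrow> real" where
  "iter_pd [] f = f"
| "iter_pd (i # is) f = pd i (iter_pd is f)"

text \<open>
  \<open>C\<^sup>\<infinity>\<close>: all iterated partial derivatives exist and are continuous. The set \<open>U\<close> is meant to be open;
  the values of \<open>f\<close> outside \<open>U\<close> are then irrelevant.
\<close>

definition smooth_fun :: "nat \<Rightarrow> rvec set \<Rightarrow> (rvec \<Rightarrow> real) \<Rightarrow> bool" where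
  "smooth_fun n U f \<longleftrightarrow>
     (\<forall>is. set is \<subseteq> {..<n} \<longrightarrow>
        continuous_map (subtopology (Euclidean_space n) U) euclideanreal (iter_pd is f) \<and>
        (\<forall>i<n. \<forall>x\<in>U. (\<lambda>t. iter_pd is f (x(i := t))) differentiable (at (x i))))"

definition smooth_map :: "nat \<Rightarrow> rvec set \<Rightarrow> nat \<Rightarrow> (rvec \<Rightarrow> rvec) \<Rightarrow> bool" where
  "smooth_map n U m f \<longleftrightarrow> f ` U \<subseteq> Rn m \<and> (\<forall>j<m. smooth_fun n U (\<lambda>x. f x j))"

definition dir_deriv :: "(rvec \<Rightarrow> real) \<Rightarrow> rvec \<Rightarrow> rvec \<Rightarrow> real" where
  "dir_deriv f x v = deriv (\<lambda>t. f (\<lambda>i. x i + t * v i)) 0"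

definition differential :: "(rvec \<Rightarrow> rvec) \<Rightarrow> rvec \<Rightarrow> rvec \<Rightarrow> rvec" where
  "differential f x v = (\<lambda>j. dir_deriv (\<lambda>y. f y j) x v)"


section \<open>Differential forms on open subsets of Cartesian spaces\<close>

text \<open>
  A \<open>k\<close>-form is a function of a base point and a list of \<open>k\<close> vectors. Forms are normalised to vanish
  on all other arguments, so that equality of forms is equality of functions.
\<close>

type_synonym form = "rvec \<Rightarrow> rvec list \<Rightarrow> real"

text \<open>\<open>lc u a w\<close> stands for the linear combination \<open>u + a w\<close> in the vector space with carrier \<open>V\<close>.\<close>

definition alternating_multilinear ::
    "('v \<Rightarrow> real \<Rightarrow> 'v \<Rightarrow> 'v) \<Rightarrow> 'v set \<Rightarrow> nat \<Rightarrow> ('v list \<Rightarrow> real) \<Rightarrow> bool" where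
  "alternating_multilinear lc V k g \<longleftrightarrow>
     (\<forall>vs. length vs = k \<and> set vs \<subseteq> V \<longrightarrow>
        (\<forall>i<k. \<forall>u\<in>V. \<forall>w\<in>V. \<forall>a. g (vs[i := lc u a w]) = g (vs[i := u]) + a * g (vs[i := w])) \<and>
        (\<forall>i j. i < j \<and> j < k \<and> vs ! i = vs ! j \<longrightarrow> g vs = 0))"

definition vec_lc :: "rvec \<Rightarrow> real \<Rightarrow> rvec \<Rightarrow> rvec" where
  "vec_lc u a w = (\<lambda>i. u i + a * w i)"

definition is_form :: "nat \<Rightarrow> rvec set \<Rightarrow> nat \<Rightarrow> form \<Rightarrow> bool" where
  "is_form n U k \<omega> \<longleftrightarrow>
     (\<forall>x vs. \<omega> x vs \<noteq> 0 \<longrightarrow> x \<in> U \<and> length vs = k \<and> set vs \<subseteq> Rn n) \<and>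
     (\<forall>x\<in>U. alternating_multilinear vec_lc (Rn n) k (\<omega> x)) \<and>
     (\<forall>vs. length vs = k \<and> set vs \<subseteq> Rn n \<longrightarrow> smooth_fun n U (\<lambda>x. \<omega> x vs))"

definition form_pullback :: "nat \<Rightarrow> rvec set \<Rightarrow> (rvec \<Rightarrow> rvec) \<Rightarrow> form \<Rightarrow> form" where
  "form_pullback n V F \<omega> =
     (\<lambda>x vs. if x \<in> V \<and> set vs \<subseteq> Rn n then \<omega> (F x) (map (differential F x) vs) else 0)"

definition form_d :: "nat \<Rightarrow> rvec set \<Rightarrow> form \<Rightarrow> form" where
  "form_d n U \<omega> =
     (\<lambda>x vs. if x \<in> U \<and> set vs \<subseteq> Rn n
        then \<Sum>i<length vs. (-1) ^ i * dir_deriv (\<lambda>y. \<omega> y (take i vs @ drop (Suc i) vs)) x (vs ! i)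
        else 0)"

definition form_wedge :: "nat \<Rightarrow> nat \<Rightarrow> form \<Rightarrow> form \<Rightarrow> form" where
  "form_wedge k l \<omega> \<eta> =
     (\<lambda>x vs. if length vs = k + l
        then (\<Sum>\<sigma> | \<sigma> permutes {..<k + l}.
                of_int (sign \<sigma>) * \<omega> x (map (\<lambda>i. vs ! \<sigma> i) [0..<k])
                                * \<eta> x (map (\<lambda>i. vs ! \<sigma> i) [k..<k + l]))
             / (fact k * fact l)
        else 0)"

text \<open>
  The Lie derivative in coordinates. This is
  \<open>(L\<^sub>X \<omega>)(Y\<^sub>1,\<dots>,Y\<^sub>k) = X(\<omega>(Y\<^sub>1,\<dots>,Y\<^sub>k)) - \<Sum>\<^sub>i \<omega>(Y\<^sub>1,\<dots>,[X,Y\<^sub>i],\<dots>,Y\<^sub>k)\<close>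
  for constant \<open>Y\<^sub>i\<close>, for which \<open>[X,Y\<^sub>i] = - DX(Y\<^sub>i)\<close>.
\<close>

definition form_lie :: "(rvec \<Rightarrow> rvec) \<Rightarrow> form \<Rightarrow> form" where
  "form_lie X \<omega> =
     (\<lambda>x vs. dir_deriv (\<lambda>y. \<omega> y vs) x (X x)
           + (\<Sum>i<length vs. \<omega> x (vs[i := differential X x (vs ! i)])))"


section \<open>Diffeological spaces\<close>

text \<open>
  A parametrization carries its dimension \<open>n\<close> and its domain; the map is normalised to be
  \<^const>\<open>undefined\<close> off the domain. A diffeology is given as its set of plots.
\<close>

datatype 'a param = Param (pdim: nat) (pdom: "rvec set") (pmap: "rvec \<Rightarrow> 'a")

definition is_param :: "'a set \<Rightarrow> 'a param \<Rightarrow> bool" where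
  "is_param X p \<longleftrightarrow> openin (Euclidean_space (pdim p)) (pdom p) \<and> pmap p \<in> pdom p \<rightarrow>\<^sub>E X"

definition param_compose :: "('a \<Rightarrow> 'b) \<Rightarrow> 'a param \<Rightarrow> 'b param" where
  "param_compose f p = Param (pdim p) (pdom p) (restrict (f \<circ> pmap p) (pdom p))"

definition euclidean_diffeology :: "nat \<Rightarrow> rvec set \<Rightarrow> rvec param set" where
  "euclidean_diffeology n U =
     {p. is_param U p \<and> smooth_map (pdim p) (pdom p) n (pmap p)}"

definition subset_diffeology :: "'a set \<Rightarrow> 'a param set \<Rightarrow> 'a param set" where
  "subset_diffeology S D = {p \<in> D. pmap p ` pdom p \<subseteq> S}"

definition class_of :: "'a set set \<Rightarrow> 'a \<Rightarrow> 'a set" where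
  "class_of \<F> x = (THE L. L \<in> \<F> \<and> x \<in> L)"

text \<open>The equivalence relation is given by the partition \<open>\<F>\<close> into its classes.\<close>

definition quotient_diffeology :: "'a set set \<Rightarrow> 'a param set \<Rightarrow> 'a set param set" where
  "quotient_diffeology \<F> D =
     {p. is_param \<F> p \<and>
         (\<forall>u\<in>pdom p. \<exists>q\<in>D. pdim q = pdim p \<and> u \<in> pdom q \<and> pdom q \<subseteq> pdom p \<and>
            (\<forall>v\<in>pdom q. pmap p v = class_of \<F> (pmap q v)))}"

definition D_open :: "'a set \<Rightarrow> 'a param set \<Rightarrow> 'a set \<Rightarrow> bool" where
  "D_open X D A \<longleftrightarrow>
     A \<subseteq> X \<and> (\<forall>p\<in>D. openin (Euclidean_space (pdim p)) {u \<in> pdom p. pmap p u \<in> A})"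

definition D_topology :: "'a set \<Rightarrow> 'a param set \<Rightarrow> 'a topology" where
  "D_topology X D = topology (D_open X D)"

lemma openin_D_topology: "openin (D_topology X D) = D_open X D"
proof -
  have "istopology (D_open X D)"
    unfolding istopology_def
  proof (intro conjI allI impI)
    fix S T assume S: "D_open X D S" and T: "D_open X D T"
    have "openin (Euclidean_space (pdim p)) {u \<in> pdom p. pmap p u \<in> S \<inter> T}" if "p \<in> D" for p
    proof -
      have "{u \<in> pdom p. pmap p u \<in> S \<inter> T} = {u \<in> pdom p. pmap p u \<in> S} \<inter> {u \<in> pdom p. pmap p u \<in> T}"
        by auto
      then show ?thesis using S T that by (simp add: D_open_def openin_Int)
    qed
    then show "D_open X D (S \<inter> T)" using S T by (auto simp: D_open_def)
  next
    fix \<K> assume K: "\<forall>K\<in>\<K>. D_open X D K"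
    have "openin (Euclidean_space (pdim p)) {u \<in> pdom p. pmap p u \<in> \<Union>\<K>}" if "p \<in> D" for p
    proof -
      have "{u \<in> pdom p. pmap p u \<in> \<Union>\<K>} = (\<Union>K\<in>\<K>. {u \<in> pdom p. pmap p u \<in> K})"
        by auto
      then show ?thesis using K that by (auto simp: D_open_def)
    qed
    then show "D_open X D (\<Union>\<K>)" using K by (auto simp: D_open_def)
  qed
  then show ?thesis by (simp add: D_topology_def)
qed

definition D_smooth ::
    "'a set \<Rightarrow> 'a param set \<Rightarrow> 'b set \<Rightarrow> 'b param set \<Rightarrow> ('a \<Rightarrow> 'b) \<Rightarrow> bool" where
  "D_smooth X D Y E f \<longleftrightarrow> f ` X \<subseteq> Y \<and> (\<forall>p\<in>D. param_compose f p \<in> E)"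

definition D_diffeo ::
    "'a set \<Rightarrow> 'a param set \<Rightarrow> 'b set \<Rightarrow> 'b param set \<Rightarrow> ('a \<Rightarrow> 'b) \<Rightarrow> bool" where
  "D_diffeo X D Y E f \<longleftrightarrow>
     bij_betw f X Y \<and> D_smooth X D Y E f \<and> D_smooth Y E X D (inv_into X f)"


section \<open>Diffeological forms\<close>

type_synonym 'a dform = "'a param \<Rightarrow> form"

text \<open>
  The elements of \<open>\<Omega>\<^sup>k\<close> of the diffeological space with plots \<open>D\<close>, normalised to vanish on
  parametrizations that are not plots. The graded object \<open>\<Omega>\<^sup>\<bullet>\<close> is the family \<open>k \<mapsto> \<Omega>\<^sup>k\<close>.
\<close>

definition dforms :: "'a param set \<Rightarrow> nat \<Rightarrow> 'a dform set" where
  "dforms D k =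
     {\<alpha>. (\<forall>p\<in>D. is_form (pdim p) (pdom p) k (\<alpha> p)) \<and>
         (\<forall>p\<in>D. \<forall>n V F. openin (Euclidean_space n) V \<and> smooth_map n V (pdim p) F \<and> F ` V \<subseteq> pdom p
            \<longrightarrow> \<alpha> (Param n V (restrict (pmap p \<circ> F) V)) = form_pullback n V F (\<alpha> p)) \<and>
         (\<forall>p. p \<notin> D \<longrightarrow> \<alpha> p = (\<lambda>x vs. 0))}"

definition dform_pullback :: "'a param set \<Rightarrow> ('a \<Rightarrow> 'b) \<Rightarrow> 'b dform \<Rightarrow> 'a dform" where
  "dform_pullback D f \<alpha> = (\<lambda>p. if p \<in> D then \<alpha> (param_compose f p) else (\<lambda>x vs. 0))"

definition dform_add :: "'a dform \<Rightarrow> 'a dform \<Rightarrow> 'a dform" where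
  "dform_add \<alpha> \<beta> = (\<lambda>p x vs. \<alpha> p x vs + \<beta> p x vs)"

definition dform_scale :: "real \<Rightarrow> 'a dform \<Rightarrow> 'a dform" where
  "dform_scale a \<alpha> = (\<lambda>p x vs. a * \<alpha> p x vs)"

definition dform_d :: "'a param set \<Rightarrow> 'a dform \<Rightarrow> 'a dform" where
  "dform_d D \<alpha> = (\<lambda>p. if p \<in> D then form_d (pdim p) (pdom p) (\<alpha> p) else (\<lambda>x vs. 0))"

definition dform_wedge :: "nat \<Rightarrow> nat \<Rightarrow> 'a dform \<Rightarrow> 'a dform \<Rightarrow> 'a dform" where
  "dform_wedge k l \<alpha> \<beta> = (\<lambda>p. form_wedge k l (\<alpha> p) (\<beta> p))"

text \<open>
  \<open>f\<close> is an isomorphism, of differential graded algebras, from \<open>A\<close> to \<open>B\<close>, where \<open>A\<close> and \<open>B\<close> are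
  graded families of diffeological forms for the diffeologies \<open>D\<close> and \<open>E\<close>.
\<close>

definition dga_isomorphism ::
    "'a param set \<Rightarrow> (nat \<Rightarrow> 'a dform set) \<Rightarrow> 'b param set \<Rightarrow> (nat \<Rightarrow> 'b dform set) \<Rightarrow>
     ('a dform \<Rightarrow> 'b dform) \<Rightarrow> bool" where
  "dga_isomorphism D A E B f \<longleftrightarrow>
     (\<forall>k. bij_betw f (A k) (B k)) \<and>
     (\<forall>k. \<forall>\<alpha>\<in>A k. \<forall>\<beta>\<in>A k. f (dform_add \<alpha> \<beta>) = dform_add (f \<alpha>) (f \<beta>)) \<and>
     (\<forall>k a. \<forall>\<alpha>\<in>A k. f (dform_scale a \<alpha>) = dform_scale a (f \<alpha>)) \<and>
     (\<forall>k. \<forall>\<alpha>\<in>A k. f (dform_d D \<alpha>) = dform_d E (f \<alpha>)) \<and>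
     (\<forall>k l. \<forall>\<alpha>\<in>A k. \<forall>\<beta>\<in>A l. f (dform_wedge k l \<alpha> \<beta>) = dform_wedge k l (f \<alpha>) (f \<beta>))"


section \<open>Manifolds\<close>

text \<open>A chart is a pair of its domain and its coordinate map; the atlas need not be maximal.\<close>

type_synonym 'a chart = "'a set \<times> ('a \<Rightarrow> rvec)"

datatype 'a manifold =
  Manifold (mtop: "'a topology") (mdim: nat) (atlas: "'a chart set")

abbreviation points :: "'a manifold \<Rightarrow> 'a set" where
  "points M \<equiv> topspace (mtop M)"

definition is_manifold :: "'a manifold \<Rightarrow> bool" where
  "is_manifold M \<longleftrightarrow>
     Hausdorff_space (mtop M) \<and> second_countable (mtop M) \<and>
     (\<Union>(U, \<phi>)\<in>atlas M. U) = points M \<and>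
     (\<forall>(U, \<phi>)\<in>atlas M.
        openin (mtop M) U \<and> openin (Euclidean_space (mdim M)) (\<phi> ` U) \<and>
        homeomorphic_map (subtopology (mtop M) U)
          (subtopology (Euclidean_space (mdim M)) (\<phi> ` U)) \<phi>) \<and>
     (\<forall>(U, \<phi>)\<in>atlas M. \<forall>(V, \<psi>)\<in>atlas M.
        smooth_map (mdim M) (\<phi> ` (U \<inter> V)) (mdim M) (\<psi> \<circ> inv_into U \<phi>))"

definition open_submanifold :: "'a manifold \<Rightarrow> 'a set \<Rightarrow> 'a manifold" where
  "open_submanifold M W =
     Manifold (subtopology (mtop M) W) (mdim M) ((\<lambda>(U, \<phi>). (U \<inter> W, \<phi>)) ` atlas M)"

definition manifold_diffeology :: "'a manifold \<Rightarrow> 'a param set" where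
  "manifold_diffeology M =
     {p. is_param (points M) p \<and>
         continuous_map (subtopology (Euclidean_space (pdim p)) (pdom p)) (mtop M) (pmap p) \<and>
         (\<forall>(U, \<phi>)\<in>atlas M.
            smooth_map (pdim p) {u \<in> pdom p. pmap p u \<in> U} (mdim M) (\<phi> \<circ> pmap p))}"

text \<open>
  A tangent vector at \<open>x\<close> is a family of coordinate vectors, one for each chart at \<open>x\<close>, that transforms
  by the differentials of the transition maps. It is normalised to be \<open>0\<close> at the other charts.
\<close>

type_synonym 'a tvec = "'a chart \<Rightarrow> rvec"

definition tangent_space :: "'a manifold \<Rightarrow> 'a \<Rightarrow> 'a tvec set" where
  "tangent_space M x =
     {v. (\<forall>c. \<not> (c \<in> atlas M \<and> x \<in> fst c) \<longrightarrow> v c = (\<lambda>i. 0)) \<and>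
         (\<forall>c\<in>atlas M. x \<in> fst c \<longrightarrow> v c \<in> Rn (mdim M)) \<and>
         (\<forall>(U, \<phi>)\<in>atlas M. \<forall>(V, \<psi>)\<in>atlas M. x \<in> U \<inter> V \<longrightarrow>
            v (V, \<psi>) = differential (\<psi> \<circ> inv_into U \<phi>) (\<phi> x) (v (U, \<phi>)))}"

definition tvec_lc :: "'a tvec \<Rightarrow> real \<Rightarrow> 'a tvec \<Rightarrow> 'a tvec" where
  "tvec_lc u a w = (\<lambda>c i. u c i + a * w c i)"

definition tangent_subspace :: "'a manifold \<Rightarrow> 'a \<Rightarrow> 'a tvec set \<Rightarrow> bool" where
  "tangent_subspace M x E \<longleftrightarrow>
     E \<subseteq> tangent_space M x \<and> (\<lambda>c i. 0) \<in> E \<and> (\<forall>u\<in>E. \<forall>w\<in>E. \<forall>a. tvec_lc u a w \<in> E)"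

text \<open>The differential at \<open>u\<close>, applied to \<open>v\<close>, of a smooth map \<open>p\<close> into \<open>M\<close>.\<close>

definition velocity :: "'a manifold \<Rightarrow> 'a param \<Rightarrow> rvec \<Rightarrow> rvec \<Rightarrow> 'a tvec" where
  "velocity M p u v =
     (\<lambda>c. if c \<in> atlas M \<and> pmap p u \<in> fst c then differential (snd c \<circ> pmap p) u v else (\<lambda>i. 0))"

text \<open>The inverse of a coordinate map, as a parametrization.\<close>

definition inverse_param :: "nat \<Rightarrow> 'a chart \<Rightarrow> 'a param" where
  "inverse_param n c =
     Param n (snd c ` fst c) (restrict (inv_into (fst c) (snd c)) (snd c ` fst c))"

definition local_vector_field :: "'a manifold \<Rightarrow> 'a set \<Rightarrow> ('a \<Rightarrow> 'a tvec) \<Rightarrow> bool" where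
  "local_vector_field M N X \<longleftrightarrow>
     openin (mtop M) N \<and> (\<forall>y\<in>N. X y \<in> tangent_space M y) \<and>
     (\<forall>(U, \<phi>)\<in>atlas M.
        smooth_map (mdim M) (\<phi> ` (U \<inter> N)) (mdim M) (\<lambda>u. X (inv_into U \<phi> u) (U, \<phi>)))"


section \<open>Differential forms on manifolds\<close>

type_synonym 'a mform = "'a \<Rightarrow> 'a tvec list \<Rightarrow> real"

definition mform_pullback :: "'a manifold \<Rightarrow> 'a param \<Rightarrow> 'a mform \<Rightarrow> form" where
  "mform_pullback M p \<alpha> =
     (\<lambda>u vs. if u \<in> pdom p \<and> set vs \<subseteq> Rn (pdim p)
        then \<alpha> (pmap p u) (map (velocity M p u) vs) else 0)"

definition mform_in_chart :: "'a manifold \<Rightarrow> 'a chart \<Rightarrow> 'a mform \<Rightarrow> form" where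
  "mform_in_chart M c \<alpha> = mform_pullback M (inverse_param (mdim M) c) \<alpha>"

definition mforms :: "'a manifold \<Rightarrow> nat \<Rightarrow> 'a mform set" where
  "mforms M k =
     {\<alpha>. (\<forall>x vs. \<alpha> x vs \<noteq> 0 \<longrightarrow> x \<in> points M \<and> length vs = k \<and> set vs \<subseteq> tangent_space M x) \<and>
         (\<forall>x\<in>points M. alternating_multilinear tvec_lc (tangent_space M x) k (\<alpha> x)) \<and>
         (\<forall>c\<in>atlas M. is_form (mdim M) (snd c ` fst c) k (mform_in_chart M c \<alpha>))}"

text \<open>The identification of an ordinary form \<open>\<alpha>\<close> with the diffeological form \<open>P \<mapsto> P\<^sup>*\<alpha>\<close>.\<close>

definition mform_to_dform :: "'a manifold \<Rightarrow> 'a mform \<Rightarrow> 'a dform" where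
  "mform_to_dform M \<alpha> =
     (\<lambda>p. if p \<in> manifold_diffeology M then mform_pullback M p \<alpha> else (\<lambda>x vs. 0))"

definition interior_product :: "('a \<Rightarrow> 'a tvec) \<Rightarrow> 'a mform \<Rightarrow> 'a mform" where
  "interior_product X \<alpha> = (\<lambda>x vs. \<alpha> x (X x # vs))"

text \<open>\<open>L\<^sub>X \<alpha> = 0\<close> on the domain \<open>N\<close> of \<open>X\<close>, expressed in every chart.\<close>

definition lie_derivative_vanishes ::
    "'a manifold \<Rightarrow> 'a set \<Rightarrow> ('a \<Rightarrow> 'a tvec) \<Rightarrow> 'a mform \<Rightarrow> bool" where
  "lie_derivative_vanishes M N X \<alpha> \<longleftrightarrow>
     (\<forall>(U, \<phi>)\<in>atlas M. \<forall>u\<in>\<phi> ` (U \<inter> N). \<forall>vs. set vs \<subseteq> Rn (mdim M) \<longrightarrow>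
        form_lie (\<lambda>w. X (inv_into U \<phi> w) (U, \<phi>)) (mform_in_chart M (U, \<phi>) \<alpha>) u vs = 0)"


section \<open>Singular foliations\<close>

text \<open>
  \<open>(W, f)\<close> is a chart of the diffeological subspace \<open>S\<close> of \<open>M\<close>: \<open>f\<close> is a diffeological diffeomorphism
  from the D-open subset \<open>W\<close> of \<open>S\<close> onto an open subset of \<open>\<real>\<^sup>n\<close>.
\<close>

definition submanifold_chart :: "'a manifold \<Rightarrow> 'a set \<Rightarrow> nat \<Rightarrow> 'a chart \<Rightarrow> bool" where
  "submanifold_chart M S n = (\<lambda>(W, f).
     let D = subset_diffeology S (manifold_diffeology M) in
       openin (D_topology S D) W \<and> openin (Euclidean_space n) (f ` W) \<and>
       D_diffeo W (subset_diffeology W D) (f ` W) (euclidean_diffeology n (f ` W)) f)"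

definition diffeological_submanifold :: "'a manifold \<Rightarrow> nat \<Rightarrow> 'a set \<Rightarrow> bool" where
  "diffeological_submanifold M n S \<longleftrightarrow>
     S \<subseteq> points M \<and> (\<forall>x\<in>S. \<exists>c. submanifold_chart M S n c \<and> x \<in> fst c)"

text \<open>
  In a chart \<open>c\<close> of \<open>S\<close>, the inclusion \<open>S \<rightarrow> M\<close> is \<open>inverse_param n c\<close>, and its differential at the
  point \<open>x\<close> is \<open>v \<mapsto> velocity M (inverse_param n c) (snd c x) v\<close>.
\<close>

definition weakly_embedded :: "'a manifold \<Rightarrow> nat \<Rightarrow> 'a set \<Rightarrow> bool" where
  "weakly_embedded M n S \<longleftrightarrow>
     diffeological_submanifold M n S \<and>
     (\<forall>c. submanifold_chart M S n c \<longrightarrow>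
        (\<forall>x\<in>fst c. inj_on (velocity M (inverse_param n c) (snd c x)) (Rn n)))"

text \<open>\<open>T\<^sub>xS\<close> as a subset of \<open>T\<^sub>xM\<close>, namely the image of the differential of the inclusion.\<close>

definition submanifold_tangent :: "'a manifold \<Rightarrow> 'a set \<Rightarrow> 'a \<Rightarrow> 'a tvec set" where
  "submanifold_tangent M S x =
     {velocity M (inverse_param n c) (snd c x) v | n c v.
        submanifold_chart M S n c \<and> x \<in> fst c \<and> v \<in> Rn n}"

definition connected_leaf :: "'a manifold \<Rightarrow> 'a set \<Rightarrow> bool" where
  "connected_leaf M S \<longleftrightarrow>
     connected_space (D_topology S (subset_diffeology S (manifold_diffeology M)))"

definition local_section ::
    "'a manifold \<Rightarrow> ('a \<Rightarrow> 'a tvec set) \<Rightarrow> 'a set \<Rightarrow> ('a \<Rightarrow> 'a tvec) \<Rightarrow> bool" where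
  "local_section M \<Delta> N X \<longleftrightarrow> local_vector_field M N X \<and> (\<forall>y\<in>N. X y \<in> \<Delta> y)"

definition smooth_singular_distribution :: "'a manifold \<Rightarrow> ('a \<Rightarrow> 'a tvec set) \<Rightarrow> bool" where
  "smooth_singular_distribution M \<Delta> \<longleftrightarrow>
     (\<forall>x\<in>points M. tangent_subspace M x (\<Delta> x)) \<and>
     (\<forall>x\<in>points M. \<forall>v\<in>\<Delta> x. \<exists>N X. local_section M \<Delta> N X \<and> x \<in> N \<and> X x = v)"

definition foliation_distribution :: "'a manifold \<Rightarrow> 'a set set \<Rightarrow> 'a \<Rightarrow> 'a tvec set" where
  "foliation_distribution M \<F> x = submanifold_tangent M (class_of \<F> x) x"

definition singular_foliation :: "'a manifold \<Rightarrow> 'a set set \<Rightarrow> bool" where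
  "singular_foliation M \<F> \<longleftrightarrow>
     partition_on (points M) \<F> \<and>
     (\<forall>L\<in>\<F>. connected_leaf M L \<and> (\<exists>n. weakly_embedded M n L)) \<and>
     smooth_singular_distribution M (foliation_distribution M \<F>)"

definition leaf_space :: "'a manifold \<Rightarrow> 'a set set \<Rightarrow> 'a set param set" where
  "leaf_space M \<F> = quotient_diffeology \<F> (manifold_diffeology M)"

definition basic_mforms :: "'a manifold \<Rightarrow> 'a set set \<Rightarrow> nat \<Rightarrow> 'a mform set" where
  "basic_mforms M \<F> k =
     {\<alpha> \<in> mforms M k. \<forall>N X. local_section M (foliation_distribution M \<F>) N X \<longrightarrow>
        (\<forall>x\<in>N. \<forall>vs. interior_product X \<alpha> x vs = 0) \<and> lie_derivative_vanishes M N X \<alpha>}"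

definition basic_forms :: "'a manifold \<Rightarrow> 'a set set \<Rightarrow> nat \<Rightarrow> 'a dform set" where
  "basic_forms M \<F> k = mform_to_dform M ` basic_mforms M \<F> k"

definition positive_leaves :: "'a manifold \<Rightarrow> 'a set set \<Rightarrow> 'a set set" where
  "positive_leaves M \<F> = {L \<in> \<F>. \<exists>n>0. weakly_embedded M n L}"

definition positive_part :: "'a manifold \<Rightarrow> 'a set set \<Rightarrow> 'a manifold" where
  "positive_part M \<F> = open_submanifold M (\<Union>(positive_leaves M \<F>))"

text \<open>The pullback by \<open>\<pi> : M \<rightarrow> M/\<F>\<close> is an isomorphism \<open>\<Omega>\<^sup>\<bullet>(M/\<F>) \<rightarrow> \<Omega>\<^sub>b\<^sup>\<bullet>(M, \<F>)\<close>.\<close>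

definition quotient_pullback_iso :: "'a manifold \<Rightarrow> 'a set set \<Rightarrow> bool" where
  "quotient_pullback_iso M \<F> \<longleftrightarrow>
     dga_isomorphism
       (leaf_space M \<F>) (dforms (leaf_space M \<F>))
       (manifold_diffeology M) (basic_forms M \<F>)
       (dform_pullback (manifold_diffeology M) (class_of \<F>))"

end

theory Submission
  imports Defs
begin

text \<open>
  Let \<open>W\<close> be the set of points in leaves of positive dimension. A leaf outside \<open>W\<close> is zero-dimensional and
  connected, hence a single point, and there every section of the distribution vanishes. The set \<open>W\<close> is
  open, because a section that is nonzero at a point is nonzero near it.

  The pullback by the projection \<open>\<pi>\<close> is injective for every quotient, as plots of the quotient lift
  locally, and it respects the algebraic operations, which are defined plot by plot. So its image has to be
  identified with the basic forms. Both inclusions rest on the same remark: if a continuous function on an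
  open set is zero over \<open>W\<close>, then the set where it is nonzero is an open set avoiding \<open>W\<close>, and on an open
  set avoiding \<open>W\<close> the foliation is trivial.

  \<^item> A form \<open>\<pi>\<^sup>*\<beta>\<close> is basic over \<open>W\<close> by hypothesis. Its interior product with a section \<open>X\<close> vanishes
    where \<open>X\<close> does. The remark applies to the coefficients of its Lie derivative along \<open>X\<close>: on an open set
    where \<open>X\<close> is identically zero, so is the Lie derivative (\<open>basic_if_basic_on_open_part\<close>).

  \<^item> A form \<open>\<alpha>\<close> on \<open>M\<close> comes from the quotient if \<open>P\<^sup>*\<alpha> = P'\<^sup>*\<alpha>\<close> for all plots with
    \<open>\<pi> \<circ> P = \<pi> \<circ> P'\<close> (\<open>dform_descends\<close>). If \<open>\<alpha>\<close> is basic, then this holds for plots into \<open>W\<close> by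
    hypothesis. The remark applies to the coefficients of \<open>P\<^sup>*\<alpha> - P'\<^sup>*\<alpha>\<close>: over an open set
    avoiding \<open>W\<close> the plots \<open>P\<close> and \<open>P'\<close> coincide (\<open>pullbacks_agree_if_agree_on_open_part\<close>).

  The rest is infrastructure: the chain rule and the stability of smooth functions under composition, the
  identification of ordinary with diffeological forms on a manifold, and the comparison of \<open>M\<close> with its
  open part. The comparison is made for diffeological forms, since the open part has a different atlas, so that
  its tangent vectors and ordinary forms are different objects, whereas its plots are plots of \<open>M\<close>.
\<close>


section \<open>Calculus on open subsets of Cartesian spaces\<close>

lemma Euclidean_space_eq: "Euclidean_space n = top_of_set {x. \<forall>i\<ge>n. x i = 0}"
  by (simp add: Euclidean_space_def euclidean_product_topology)

lemma Rn_iff: "x \<in> Rn n \<longleftrightarrow> (\<forall>i\<ge>n. x i = 0)"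
  by (simp add: topspace_Euclidean_space)

lemma openin_subset_Rn: "openin (Euclidean_space n) U \<Longrightarrow> U \<subseteq> Rn n"
  by (rule openin_subset)

lemma subtopology_Euclidean_space: "U \<subseteq> Rn n \<Longrightarrow> subtopology (Euclidean_space n) U = top_of_set U"
  by (simp add: Euclidean_space_eq subtopology_subtopology Int_absorb1)

lemma openin_Euclidean_trans:
  "openin (top_of_set U) V \<Longrightarrow> openin (Euclidean_space n) U \<Longrightarrow> openin (Euclidean_space n) V"
  unfolding Euclidean_space_eq by (rule openin_trans)

lemma zero_in_Rn [simp]: "(\<lambda>i. 0) \<in> Rn n"
  by (simp add: Rn_iff)

lemma upd_in_Rn: "x \<in> Rn n \<Longrightarrow> i < n \<Longrightarrow> x(i := t) \<in> Rn n"
  by (auto simp: Rn_iff)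

lemma vec_lc_in_Rn: "u \<in> Rn n \<Longrightarrow> w \<in> Rn n \<Longrightarrow> vec_lc u a w \<in> Rn n"
  by (auto simp: Rn_iff vec_lc_def)

lemma openin_Collect_neq_0:
  assumes "openin (Euclidean_space n) U" "continuous_on U f"
  shows "openin (Euclidean_space n) {x\<in>U. f x \<noteq> (0::real)}"
proof -
  have "openin (top_of_set U) (U \<inter> f -` (- {0}))"
    using assms(2) by (intro continuous_openin_preimage_gen) auto
  moreover have "U \<inter> f -` (- {0}) = {x\<in>U. f x \<noteq> 0}"
    by auto
  ultimately show ?thesis
    using openin_Euclidean_trans[OF _ assms(1)] by simp
qed

lemma openin_preimage:
  assumes "openin (Euclidean_space n) U" "continuous_on U F" "F ` U \<subseteq> Rn m"
    and "openin (Euclidean_space m) V"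
  shows "openin (Euclidean_space n) {x\<in>U. F x \<in> V}"
proof -
  have "openin (top_of_set U) (U \<inter> F -` V)"
    using assms(2-4) unfolding Euclidean_space_eq
    by (intro continuous_openin_preimage[of _ _ "{x. \<forall>i\<ge>m. x i = 0}"]) auto
  moreover have "U \<inter> F -` V = {x\<in>U. F x \<in> V}"
    by auto
  ultimately show ?thesis
    using openin_Euclidean_trans[OF _ assms(1)] by simp
qed

text \<open>Only finitely many coordinates matter in \<open>\<real>\<^sup>n\<close>, so the product topology has boxes as a basis.\<close>

lemma openin_Euclidean_box:
  assumes U: "openin (Euclidean_space n) U" and a: "a \<in> U"
  obtains e where "e > 0" "\<And>y. y \<in> Rn n \<Longrightarrow> (\<And>i. i < n \<Longrightarrow> \<bar>y i - a i\<bar> < e) \<Longrightarrow> y \<in> U"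
proof -
  from U obtain T where T: "open T" "U = Rn n \<inter> T"
    unfolding Euclidean_space_eq openin_open by auto
  have "openin (product_topology (\<lambda>i. euclideanreal) UNIV) T"
    using T(1) by (simp add: euclidean_product_topology)
  then obtain X where X: "a \<in> Pi\<^sub>E UNIV X" "\<And>i. openin euclideanreal (X i)"
      "finite {i. X i \<noteq> topspace euclideanreal}" "Pi\<^sub>E UNIV X \<subseteq> T"
    using product_topology_open_contains_basis[of "\<lambda>i. euclideanreal" UNIV T a] a T(2) by auto
  have "\<forall>i. \<exists>e>0. \<forall>y. \<bar>y - a i\<bar> < e \<longrightarrow> y \<in> X i"
  proof
    fix i
    have "open (X i)" "a i \<in> X i" using X by auto
    then show "\<exists>e>0. \<forall>y. \<bar>y - a i\<bar> < e \<longrightarrow> y \<in> X i"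
      by (metis open_dist dist_real_def)
  qed
  then obtain e where e: "\<And>i. e i > 0" "\<And>i y. \<bar>y - a i\<bar> < e i \<Longrightarrow> y \<in> X i"
    by metis
  define d where "d = Min (insert 1 (e ` {..<n}))"
  have d: "d > 0" "\<And>i. i < n \<Longrightarrow> d \<le> e i"
    unfolding d_def using e(1) by (auto intro: Min_le)
  have "y \<in> U" if y: "y \<in> Rn n" "\<And>i. i < n \<Longrightarrow> \<bar>y i - a i\<bar> < d" for y
  proof -
    have "y i \<in> X i" for i
    proof (cases "i < n")
      case True
      then show ?thesis using e(2) y(2)[OF True] d(2)[OF True] by auto
    next
      case False
      then have "y i = a i" using y(1) a T(2) by (simp add: Rn_iff)
      then show ?thesis using X(1) by auto
    qed
    then show ?thesis using X(4) T(2) y(1) by auto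
  qed
  then show thesis using that d(1) by blast
qed

lemma continuous_on_Euclidean_box:
  assumes U: "openin (Euclidean_space n) U" and f: "continuous_on U (f :: rvec \<Rightarrow> real)"
    and a: "a \<in> U" and e: "e > 0"
  obtains d where "d > 0"
    "\<And>y. y \<in> Rn n \<Longrightarrow> (\<And>i. i < n \<Longrightarrow> \<bar>y i - a i\<bar> < d) \<Longrightarrow> y \<in> U \<and> \<bar>f y - f a\<bar> < e"
proof -
  have "openin (top_of_set U) (U \<inter> f -` ball (f a) e)"
    using f by (intro continuous_openin_preimage_gen) auto
  then have o: "openin (Euclidean_space n) (U \<inter> f -` ball (f a) e)"
    using openin_Euclidean_trans U by blast
  have "a \<in> U \<inter> f -` ball (f a) e" using a e by auto
  from openin_Euclidean_box[OF o this] obtain d where "d > 0"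
    "\<And>y. y \<in> Rn n \<Longrightarrow> (\<And>i. i < n \<Longrightarrow> \<bar>y i - a i\<bar> < d) \<Longrightarrow> y \<in> U \<inter> f -` ball (f a) e"
    by metis
  then show thesis using that[of d] by (auto simp: dist_real_def abs_minus_commute)
qed

lemma eventually_curve_in:
  assumes U: "openin (Euclidean_space n) U" and t0: "\<gamma> t0 \<in> U"
    and \<gamma>: "\<forall>\<^sub>F t in nhds t0. \<gamma> t \<in> Rn n"
    and c: "\<And>i. i < n \<Longrightarrow> isCont (\<lambda>t. \<gamma> t i) (t0::real)"
  shows "\<forall>\<^sub>F t in nhds t0. \<gamma> t \<in> U"
proof -
  obtain e where e: "e > 0" "\<And>y. y \<in> Rn n \<Longrightarrow> (\<And>i. i < n \<Longrightarrow> \<bar>y i - \<gamma> t0 i\<bar> < e) \<Longrightarrow> y \<in> U"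
    using openin_Euclidean_box[OF U t0] by metis
  have "\<forall>\<^sub>F t in nhds t0. \<forall>i\<in>{..<n}. \<bar>\<gamma> t i - \<gamma> t0 i\<bar> < e"
  proof (intro eventually_ball_finite ballI)
    fix i assume "i \<in> {..<n}"
    then have "((\<lambda>t. \<gamma> t i) \<longlongrightarrow> \<gamma> t0 i) (nhds t0)"
      using c tendsto_at_iff_tendsto_nhds[of "\<lambda>t. \<gamma> t i" t0] by (simp add: isCont_def)
    then show "\<forall>\<^sub>F t in nhds t0. \<bar>\<gamma> t i - \<gamma> t0 i\<bar> < e"
      using e(1) by (auto simp: tendsto_iff dist_real_def)
  qed simp
  with \<gamma> show ?thesis
    by eventually_elim (use e in auto)
qed

lemma eventually_line_in:
  assumes "openin (Euclidean_space n) U" "x \<in> U" "v \<in> Rn n"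
  shows "\<forall>\<^sub>F t in nhds 0. (\<lambda>i. x i + t * v i) \<in> U"
proof (rule eventually_curve_in[OF assms(1)])
  show "\<forall>\<^sub>F t in nhds 0. (\<lambda>i. x i + t * v i) \<in> Rn n"
    using assms openin_subset_Rn by (intro always_eventually) (fastforce simp: Rn_iff)
qed (use assms in auto)

lemma eventually_upd_in:
  assumes U: "openin (Euclidean_space n) U" and "x \<in> U" "i < n"
  shows "\<forall>\<^sub>F t in nhds (x i). x(i := t) \<in> U"
proof (rule eventually_curve_in[OF U])
  show "\<forall>\<^sub>F t in nhds (x i). x(i := t) \<in> Rn n"
    using openin_subset_Rn[OF U] assms(2,3) upd_in_Rn by (intro always_eventually) blast
  show "isCont (\<lambda>t. (x(i := t)) j) (x i)" for j
    by (cases "j = i") auto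
qed (use assms in auto)


subsection \<open>Functions of finite order of differentiability\<close>

text \<open>
  The closure properties of smooth functions are inductions on the order of differentiability, in
  which the innermost partial derivative is taken first.
\<close>

primrec Ck :: "nat \<Rightarrow> rvec set \<Rightarrow> nat \<Rightarrow> (rvec \<Rightarrow> real) \<Rightarrow> bool" where
  "Ck n U 0 f = continuous_on U f"
| "Ck n U (Suc k) f = (continuous_on U f \<and>
     (\<forall>i<n. (\<forall>x\<in>U. (\<lambda>t. f (x(i := t))) differentiable (at (x i))) \<and> Ck n U k (pd i f)))"

lemma iter_pd_append: "iter_pd (is @ js) f = iter_pd is (iter_pd js f)"
  by (induction "is") auto

lemma smooth_fun_unfold:
  assumes "U \<subseteq> Rn n"
  shows "smooth_fun n U f \<longleftrightarrow> continuous_on U f \<and>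
     (\<forall>i<n. (\<forall>x\<in>U. (\<lambda>t. f (x(i := t))) differentiable (at (x i))) \<and> smooth_fun n U (pd i f))"
    (is "?l \<longleftrightarrow> ?r")
proof
  assume l: ?l
  have c: "continuous_on U f"
    using l[unfolded smooth_fun_def, rule_format, of "[]"] assms
    by (simp add: subtopology_Euclidean_space)
  have d: "(\<lambda>t. f (x(i := t))) differentiable (at (x i))" if "i < n" "x \<in> U" for i x
    using l[unfolded smooth_fun_def, rule_format, of "[]"] that by auto
  have "smooth_fun n U (pd i f)" if "i < n" for i
    unfolding smooth_fun_def
  proof (intro allI impI)
    fix "is" assume "set is \<subseteq> {..<n}"
    then have "set (is @ [i]) \<subseteq> {..<n}" using that by simp
    from l[unfolded smooth_fun_def, rule_format, OF this]
    show "continuous_map (subtopology (Euclidean_space n) U) euclideanreal (iter_pd is (pd i f)) \<and>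
        (\<forall>ia<n. \<forall>x\<in>U. (\<lambda>t. iter_pd is (pd i f) (x(ia := t))) differentiable (at (x ia)))"
      by (simp add: iter_pd_append)
  qed
  with c d show ?r by blast
next
  assume r: ?r
  show ?l
    unfolding smooth_fun_def
  proof (intro allI impI)
    fix "is" assume s: "set is \<subseteq> {..<n}"
    show "continuous_map (subtopology (Euclidean_space n) U) euclideanreal (iter_pd is f) \<and>
        (\<forall>i<n. \<forall>x\<in>U. (\<lambda>t. iter_pd is f (x(i := t))) differentiable (at (x i)))"
    proof (cases "is" rule: rev_cases)
      case Nil
      then show ?thesis using r assms by (simp add: subtopology_Euclidean_space)
    next
      case (snoc js i)
      then have "smooth_fun n U (pd i f)" "set js \<subseteq> {..<n}" using s r by auto
      then show ?thesis
        unfolding smooth_fun_def snoc by (simp add: iter_pd_append)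
    qed
  qed
qed

lemma smooth_fun_iff_Ck:
  assumes "U \<subseteq> Rn n"
  shows "smooth_fun n U f \<longleftrightarrow> (\<forall>k. Ck n U k f)"
proof (intro iffI allI)
  fix k assume "smooth_fun n U f"
  then show "Ck n U k f"
  proof (induction k arbitrary: f)
    case 0
    then show ?case using smooth_fun_unfold[OF assms, of f] by auto
  next
    case (Suc k)
    then show ?case using smooth_fun_unfold[OF assms, of f] by auto
  qed
next
  assume C: "\<forall>k. Ck n U k f"
  show "smooth_fun n U f"
    unfolding smooth_fun_def
  proof (intro allI impI)
    fix "is" assume "set is \<subseteq> {..<n}"
    then show "continuous_map (subtopology (Euclidean_space n) U) euclideanreal (iter_pd is f) \<and>
        (\<forall>i<n. \<forall>x\<in>U. (\<lambda>t. iter_pd is f (x(i := t))) differentiable (at (x i)))"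
      using C
    proof (induction "is" arbitrary: f rule: rev_induct)
      case Nil
      then have "Ck n U (Suc 0) f" by blast
      then show ?case
        using assms by (simp add: subtopology_Euclidean_space del: fun_upd_apply)
    next
      case (snoc i js)
      have "Ck n U k (pd i f)" for k
        using snoc.prems(2)[rule_format, of "Suc k"] snoc.prems(1) by simp
      then show ?case
        using snoc.IH[of "pd i f"] snoc.prems(1) by (simp add: iter_pd_append)
    qed
  qed
qed

lemma Ck_continuous: "Ck n U k f \<Longrightarrow> continuous_on U f"
  by (cases k) auto

lemma Ck_Suc_imp: "Ck n U (Suc k) f \<Longrightarrow> Ck n U k f"
  by (induction k arbitrary: f) auto

lemma Ck_subset: "Ck n U k f \<Longrightarrow> V \<subseteq> U \<Longrightarrow> Ck n V k f"
  by (induction k arbitrary: f) (auto intro: continuous_on_subset)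

lemma pd_cong:
  assumes "openin (Euclidean_space n) U" "\<And>x. x \<in> U \<Longrightarrow> f x = g x" "x \<in> U" "i < n"
  shows "pd i f x = pd i g x"
  unfolding pd_def
  by (rule deriv_cong_ev, rule eventually_mono[OF eventually_upd_in[OF assms(1,3,4)]])
     (auto simp: assms(2))

lemma partial_differentiable_cong:
  fixes f g :: "rvec \<Rightarrow> real"
  assumes "openin (Euclidean_space n) U" "\<And>x. x \<in> U \<Longrightarrow> f x = g x" "x \<in> U" "i < n"
    and "(\<lambda>t. f (x(i := t))) differentiable (at (x i))"
  shows "(\<lambda>t. g (x(i := t))) differentiable (at (x i))"
proof -
  obtain D where D: "((\<lambda>t. f (x(i := t))) has_real_derivative D) (at (x i))"
    using assms(5) real_differentiable_def by blast
  have "((\<lambda>t. g (x(i := t))) has_real_derivative D) (at (x i))"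
    by (rule iffD1[OF DERIV_cong_ev D], rule refl,
        rule eventually_mono[OF eventually_upd_in[OF assms(1,3,4)]]) (auto simp: assms(2))
  then show ?thesis using real_differentiable_def by blast
qed

lemma Ck_cong:
  assumes U: "openin (Euclidean_space n) U"
  shows "(\<And>x. x \<in> U \<Longrightarrow> f x = g x) \<Longrightarrow> Ck n U k f \<Longrightarrow> Ck n U k g"
proof (induction k arbitrary: f g)
  case 0
  then show ?case by (auto simp: continuous_on_cong[of U U f g])
next
  case (Suc k)
  have "continuous_on U g"
    using Suc.prems Ck_continuous continuous_on_cong[of U U f g] by blast
  moreover have "(\<lambda>t. g (x(i := t))) differentiable (at (x i))" if "i < n" "x \<in> U" for i x
    using partial_differentiable_cong[OF U, of f g x i] Suc.prems that by auto
  moreover have "Ck n U k (pd i g)" if "i < n" for i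
    by (rule Suc.IH[of "pd i f"]) (use pd_cong[OF U, of f g] Suc.prems that in auto)
  ultimately show ?case by simp
qed

lemma Ck_local:
  assumes "\<And>x. x \<in> U \<Longrightarrow> \<exists>V. openin (Euclidean_space n) V \<and> x \<in> V \<and> V \<subseteq> U \<and> Ck n V k f"
    and U: "openin (Euclidean_space n) U"
  shows "Ck n U k f"
  using assms(1)
proof (induction k arbitrary: f)
  case 0
  define S where "S = {V. openin (Euclidean_space n) V \<and> V \<subseteq> U \<and> continuous_on V f}"
  have S: "\<Union>S = U"
    using 0 by (auto simp: S_def)
  have "openin (top_of_set U) V" if "V \<in> S" for V
    using that openin_subset_Rn[OF U] unfolding S_def Euclidean_space_eq
    by (auto intro: openin_subset_trans)
  then have "continuous_map (top_of_set U) euclidean f"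
  proof (rule pasting_lemma[of S _ id _ "\<lambda>_. f"])
    fix V assume "V \<in> S"
    then show "continuous_map (subtopology (top_of_set U) (id V)) euclidean f"
      by (simp add: S_def subtopology_subtopology Int_absorb1)
  qed (use S in auto)
  then show ?case by simp
next
  case (Suc k)
  have "\<exists>V. openin (Euclidean_space n) V \<and> x \<in> V \<and> V \<subseteq> U \<and> Ck n V k f" if "x \<in> U" for x
    using Suc.prems[OF that] Ck_Suc_imp by blast
  then have "Ck n U k f" by (rule Suc.IH)
  then have "continuous_on U f" by (rule Ck_continuous)
  moreover have "(\<lambda>t. f (x(i := t))) differentiable (at (x i))" if "i < n" "x \<in> U" for i x
    using Suc.prems[OF that(2)] that(1) by auto
  moreover have "Ck n U k (pd i f)" if "i < n" for i
    by (rule Suc.IH) (use Suc.prems that in fastforce)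
  ultimately show ?case by simp
qed

lemma partial_has_derivative:
  assumes "(\<lambda>t. f (x(i := t))) differentiable (at (x i))"
  shows "((\<lambda>t. f (x(i := t))) has_real_derivative pd i f x) (at (x i))"
  using assms DERIV_deriv_iff_real_differentiable pd_def by metis

lemma pd_add_mult:
  assumes "(\<lambda>t. f (x(i := t))) differentiable (at (x i))"
    and "(\<lambda>t. g (x(i := t))) differentiable (at (x i))"
  shows "pd i (\<lambda>x. f x + g x) x = pd i f x + pd i g x"
    and "pd i (\<lambda>x. f x * g x) x = pd i f x * g x + f x * pd i g x"
    and "(\<lambda>t. f (x(i := t)) + g (x(i := t))) differentiable (at (x i))"
    and "(\<lambda>t. f (x(i := t)) * g (x(i := t))) differentiable (at (x i))"
proof -
  note D = assms[THEN partial_has_derivative]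
  have *: "((\<lambda>t. f (x(i := t)) + g (x(i := t))) has_real_derivative pd i f x + pd i g x) (at (x i))"
    by (rule DERIV_add[OF D])
  show "pd i (\<lambda>x. f x + g x) x = pd i f x + pd i g x"
    unfolding pd_def[of i "\<lambda>x. f x + g x"] by (rule DERIV_imp_deriv[OF *])
  show "(\<lambda>t. f (x(i := t)) + g (x(i := t))) differentiable (at (x i))"
    using * real_differentiable_def by blast
  have *: "((\<lambda>t. f (x(i := t)) * g (x(i := t))) has_real_derivative
      pd i f x * g x + f x * pd i g x) (at (x i))"
    by (rule DERIV_cong[OF DERIV_mult[OF D]]) simp
  show "pd i (\<lambda>x. f x * g x) x = pd i f x * g x + f x * pd i g x"
    unfolding pd_def[of i "\<lambda>x. f x * g x"] by (rule DERIV_imp_deriv[OF *])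
  show "(\<lambda>t. f (x(i := t)) * g (x(i := t))) differentiable (at (x i))"
    using * real_differentiable_def by blast
qed

lemma Ck_const: "Ck n U k (\<lambda>x. c)"
proof (induction k arbitrary: c)
  case (Suc k)
  have "pd i (\<lambda>x. c) = (\<lambda>x. 0)" for i
    by (auto simp: pd_def)
  then show ?case using Suc by simp
qed simp

lemma Ck_coordinate:
  assumes "U \<subseteq> Rn n"
  shows "Ck n U k (\<lambda>x. x j)"
proof (cases k)
  case 0
  then show ?thesis by (simp add: continuous_on_subset[OF continuous_on_product_coordinates])
next
  case (Suc l)
  have "pd i (\<lambda>x. x j) = (\<lambda>x. if i = j then 1 else 0)" for i
    by (auto simp: pd_def)
  moreover have "(\<lambda>t. (x(i := t)) j) differentiable (at (x i))" for x :: rvec and i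
    by (cases "i = j") auto
  moreover have "continuous_on U (\<lambda>x. x j)"
    by (rule continuous_on_subset[OF continuous_on_product_coordinates]) simp
  ultimately show ?thesis
    using Ck_const Suc by auto
qed

lemma Ck_add:
  assumes U: "openin (Euclidean_space n) U"
  shows "Ck n U k f \<Longrightarrow> Ck n U k g \<Longrightarrow> Ck n U k (\<lambda>x. f x + g x)"
proof (induction k arbitrary: f g)
  case 0
  then show ?case by (auto intro: continuous_intros)
next
  case (Suc k)
  have "Ck n U k (pd i (\<lambda>x. f x + g x))" if "i < n" for i
    by (rule Ck_cong[OF U _ Suc.IH[of "pd i f" "pd i g"]])
       (use Suc.prems that pd_add_mult(1) in auto)
  then show ?case
    using Suc.prems pd_add_mult(3) by (auto intro: continuous_intros)
qed

lemma Ck_mult: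
  assumes U: "openin (Euclidean_space n) U"
  shows "Ck n U k f \<Longrightarrow> Ck n U k g \<Longrightarrow> Ck n U k (\<lambda>x. f x * g x)"
proof (induction k arbitrary: f g)
  case 0
  then show ?case by (auto intro: continuous_intros)
next
  case (Suc k)
  have "Ck n U k (pd i (\<lambda>x. f x * g x))" if "i < n" for i
  proof (rule Ck_cong[OF U])
    have "Ck n U k f" "Ck n U k g"
      using Suc.prems Ck_Suc_imp by blast+
    moreover have "Ck n U k (pd i f)" "Ck n U k (pd i g)"
      using Suc.prems that by auto
    ultimately show "Ck n U k (\<lambda>x. pd i f x * g x + f x * pd i g x)"
      by (intro Ck_add[OF U] Suc.IH)
  qed (use Suc.prems that pd_add_mult(2) in auto)
  then show ?case
    using Suc.prems pd_add_mult(4) by (auto intro: continuous_intros)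
qed

lemma Ck_sum:
  assumes U: "openin (Euclidean_space n) U"
  shows "(\<And>i. i \<in> I \<Longrightarrow> Ck n U k (f i)) \<Longrightarrow> Ck n U k (\<lambda>x. \<Sum>i\<in>I. f i x)"
  by (induction I rule: infinite_finite_induct) (auto intro: Ck_const Ck_add[OF U])


subsection \<open>The chain rule\<close>

text \<open>
  Changing the coordinates of \<open>a\<close> into those of \<open>y\<close> one at a time telescopes \<open>f y - f a\<close> into a
  sum over the coordinates of \<open>q i y * (y i - a i)\<close>, where \<open>q i\<close> is a difference quotient in one
  variable. By the mean value theorem \<open>q i y\<close> is a value of \<^term>\<open>pd i f\<close> close to \<open>a\<close>.
\<close>

lemma Hadamard_quotients:
  assumes U: "openin (Euclidean_space n) U" and f: "Ck n U (Suc 0) f" and a: "a \<in> U"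
  obtains q where
    "\<And>y. y \<in> Rn n \<Longrightarrow> f y - f a = (\<Sum>i<n. q i y * (y i - a i))"
    "\<And>e. e > 0 \<Longrightarrow> \<exists>d>0. \<forall>y\<in>Rn n. (\<forall>i<n. \<bar>y i - a i\<bar> < d) \<longrightarrow> (\<forall>i<n. \<bar>q i y - pd i f a\<bar> < e)"
proof -
  define h where "h = (\<lambda>y (k::nat) i. if i < k then y i else a i)"
  \<comment> \<open>The value of \<open>q\<close> at coordinates equal to those of \<open>a\<close> cancels from the sum; it is chosen such that
    \<open>q\<close> still tends to the partial derivative at \<open>a\<close>.\<close>
  define q where "q = (\<lambda>i y. if y i = a i then pd i f a
     else (f (h y (Suc i)) - f (h y i)) / (y i - a i))"
  have aR: "a \<in> Rn n" using a openin_subset_Rn[OF U] by auto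
  have step: "h y (Suc i) = (h y i)(i := y i)" and at: "h y i i = a i" for y i
    by (auto simp: h_def fun_eq_iff less_Suc_eq)
  have q: "q i y * (y i - a i) = f (h y (Suc i)) - f (h y i)" for i y
  proof (cases "y i = a i")
    case True
    then have "h y (Suc i) = h y i" by (auto simp: h_def fun_eq_iff less_Suc_eq)
    then show ?thesis using True by simp
  qed (simp add: q_def)
  have "f y - f a = (\<Sum>i<n. q i y * (y i - a i))" if "y \<in> Rn n" for y
  proof -
    have "h y n = y" "h y 0 = a"
      using that aR by (auto simp: h_def fun_eq_iff Rn_iff)
    then show ?thesis
      unfolding q using sum_lessThan_telescope[of "\<lambda>i. f (h y i)" n] by simp
  qed
  moreover have "\<exists>d>0. \<forall>y\<in>Rn n. (\<forall>i<n. \<bar>y i - a i\<bar> < d) \<longrightarrow> (\<forall>i<n. \<bar>q i y - pd i f a\<bar> < e)"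
    if e: "e > 0" for e
  proof -
    have "\<exists>d>0. \<forall>y\<in>Rn n. (\<forall>j<n. \<bar>y j - a j\<bar> < d) \<longrightarrow> y \<in> U \<and> \<bar>pd i f y - pd i f a\<bar> < e"
      if "i < n" for i
    proof -
      have "continuous_on U (pd i f)" using f that by simp
      from continuous_on_Euclidean_box[OF U this a e] show ?thesis by metis
    qed
    then obtain d where d: "\<And>i. i < n \<Longrightarrow> d i > 0" "\<And>i y. i < n \<Longrightarrow> y \<in> Rn n \<Longrightarrow>
        (\<And>j. j < n \<Longrightarrow> \<bar>y j - a j\<bar> < d i) \<Longrightarrow> y \<in> U \<and> \<bar>pd i f y - pd i f a\<bar> < e"
      by metis
    define D where "D = Min (insert 1 (d ` {..<n}))"
    have D: "D > 0" "\<And>i. i < n \<Longrightarrow> D \<le> d i"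
      unfolding D_def using d(1) by (auto intro: Min_le)
    have "\<bar>q i y - pd i f a\<bar> < e"
      if y: "y \<in> Rn n" "\<forall>i<n. \<bar>y i - a i\<bar> < D" and i: "i < n" for y i
    proof (cases "y i = a i")
      case True
      then show ?thesis using e by (simp add: q_def)
    next
      case False
      define x where "x = (\<lambda>s. (h y i)(i := s))"
      have x: "x s \<in> U \<and> \<bar>pd i f (x s) - pd i f a\<bar> < e" if "\<bar>s - a i\<bar> \<le> \<bar>y i - a i\<bar>" for s
      proof (rule d(2)[OF i])
        show "x s \<in> Rn n" using y(1) aR i by (auto simp: x_def h_def Rn_iff)
        fix j assume j: "j < n"
        have "\<bar>x s j - a j\<bar> \<le> \<bar>y j - a j\<bar>"
          using that by (auto simp: x_def h_def)
        then show "\<bar>x s j - a j\<bar> < d i"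
          using y(2) j D(2)[OF i] by fastforce
      qed
      have der: "((\<lambda>s. f (x s)) has_real_derivative pd i f (x s)) (at s)"
        if "\<bar>s - a i\<bar> \<le> \<bar>y i - a i\<bar>" for s
      proof -
        have "(\<lambda>t. f ((x s)(i := t))) differentiable (at (x s i))"
          using f i x[OF that] by auto
        from partial_has_derivative[of f "x s" i, OF this] show ?thesis by (simp add: x_def)
      qed
      have "\<exists>s. \<bar>s - a i\<bar> \<le> \<bar>y i - a i\<bar> \<and> f (x (y i)) - f (x (a i)) = (y i - a i) * pd i f (x s)"
      proof (cases "a i < y i")
        case True
        have "\<exists>s>a i. s < y i \<and> f (x (y i)) - f (x (a i)) = (y i - a i) * pd i f (x s)"
          by (rule MVT2[OF True], rule der) auto
        then obtain s where "a i < s" "s < y i"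
            "f (x (y i)) - f (x (a i)) = (y i - a i) * pd i f (x s)"
          by blast
        then show ?thesis by (intro exI[of _ s]) auto
      next
        case F: False
        then have "y i < a i" using False by simp
        then have "\<exists>s>y i. s < a i \<and> f (x (a i)) - f (x (y i)) = (a i - y i) * pd i f (x s)"
          by (rule MVT2, intro der) auto
        then obtain s where "y i < s" "s < a i"
            "f (x (a i)) - f (x (y i)) = (a i - y i) * pd i f (x s)"
          by blast
        then show ?thesis by (intro exI[of _ s]) (auto simp: algebra_simps)
      qed
      then obtain s where s: "\<bar>s - a i\<bar> \<le> \<bar>y i - a i\<bar>"
          "f (x (y i)) - f (x (a i)) = (y i - a i) * pd i f (x s)"
        by blast
      have "x (y i) = h y (Suc i)" "x (a i) = h y i"
        by (auto simp: x_def step h_def fun_eq_iff)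
      then have "q i y = pd i f (x s)"
        using s(2) False by (simp add: q_def)
      then show ?thesis using x[OF s(1)] by simp
    qed
    then show ?thesis using D(1) by blast
  qed
  ultimately show thesis by (rule that)
qed

text \<open>
  The chain rule is needed along curves only: coordinate lines and their images give the partial derivatives
  of composite functions, and straight lines give directional derivatives.
\<close>

lemma DERIV_along_curve:
  assumes U: "openin (Euclidean_space n) U" and f: "Ck n U (Suc 0) f" and t0: "\<gamma> t0 \<in> U"
    and \<gamma>: "\<forall>\<^sub>F t in nhds t0. \<gamma> t \<in> Rn n"
    and d: "\<And>i. i < n \<Longrightarrow> ((\<lambda>t. \<gamma> t i) has_real_derivative \<gamma>' i) (at t0)"
  shows "((\<lambda>t. f (\<gamma> t)) has_real_derivative (\<Sum>i<n. pd i f (\<gamma> t0) * \<gamma>' i)) (at t0)"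
proof -
  obtain q where q: "\<And>y. y \<in> Rn n \<Longrightarrow> f y - f (\<gamma> t0) = (\<Sum>i<n. q i y * (y i - \<gamma> t0 i))"
    "\<And>e. e > 0 \<Longrightarrow> \<exists>d>0. \<forall>y\<in>Rn n. (\<forall>i<n. \<bar>y i - \<gamma> t0 i\<bar> < d) \<longrightarrow>
        (\<forall>i<n. \<bar>q i y - pd i f (\<gamma> t0)\<bar> < e)"
    by (rule Hadamard_quotients[OF U f t0]) (rule that)
  have \<gamma>_at: "\<forall>\<^sub>F t in at t0. \<gamma> t \<in> Rn n"
    using \<gamma> eventually_nhds_conv_at by blast
  have "((\<lambda>t. q i (\<gamma> t)) \<longlongrightarrow> pd i f (\<gamma> t0)) (at t0)" if i: "i < n" for i
  proof (rule tendstoI)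
    fix e :: real assume "e > 0"
    then obtain b where b: "b > 0" "\<forall>y\<in>Rn n. (\<forall>i<n. \<bar>y i - \<gamma> t0 i\<bar> < b) \<longrightarrow>
        (\<forall>i<n. \<bar>q i y - pd i f (\<gamma> t0)\<bar> < e)"
      using q(2) by blast
    have "\<forall>\<^sub>F t in at t0. \<forall>i\<in>{..<n}. \<bar>\<gamma> t i - \<gamma> t0 i\<bar> < b"
    proof (intro eventually_ball_finite ballI)
      fix i assume "i \<in> {..<n}"
      then have "((\<lambda>t. \<gamma> t i) \<longlongrightarrow> \<gamma> t0 i) (at t0)"
        using d DERIV_isCont isCont_def by blast
      then show "\<forall>\<^sub>F t in at t0. \<bar>\<gamma> t i - \<gamma> t0 i\<bar> < b"
        using b(1) by (auto simp: tendsto_iff dist_real_def)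
    qed simp
    with \<gamma>_at show "\<forall>\<^sub>F t in at t0. dist (q i (\<gamma> t)) (pd i f (\<gamma> t0)) < e"
    proof eventually_elim
      case (elim t)
      then have "\<forall>i<n. \<bar>q i (\<gamma> t) - pd i f (\<gamma> t0)\<bar> < e"
        using b(2) by blast
      then show ?case
        using i by (simp add: dist_real_def)
    qed
  qed
  then have "((\<lambda>t. \<Sum>i<n. q i (\<gamma> t) * ((\<gamma> t i - \<gamma> t0 i) / (t - t0))) \<longlongrightarrow>
      (\<Sum>i<n. pd i f (\<gamma> t0) * \<gamma>' i)) (at t0)"
    using d by (intro tendsto_sum tendsto_mult) (auto simp: has_field_derivative_iff)
  moreover have "\<forall>\<^sub>F t in at t0. (\<Sum>i<n. q i (\<gamma> t) * ((\<gamma> t i - \<gamma> t0 i) / (t - t0))) =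
      (f (\<gamma> t) - f (\<gamma> t0)) / (t - t0)"
    using \<gamma>_at by eventually_elim (simp add: q(1) sum_divide_distrib)
  ultimately show ?thesis
    unfolding has_field_derivative_iff using tendsto_cong by fast
qed

lemma pd_compose:
  assumes U: "openin (Euclidean_space n) U" and V: "openin (Euclidean_space m) V"
    and F: "F ` U \<subseteq> V" "\<And>j. j < m \<Longrightarrow> Ck n U (Suc 0) (\<lambda>x. F x j)"
    and g: "Ck m V (Suc 0) g" and x: "x \<in> U" and i: "i < n"
  shows "pd i (\<lambda>x. g (F x)) x = (\<Sum>j<m. pd j g (F x) * pd i (\<lambda>x. F x j) x)"
    and "(\<lambda>t. g (F (x(i := t)))) differentiable (at (x i))"
proof -
  have "((\<lambda>t. g (F (x(i := t)))) has_real_derivative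
      (\<Sum>j<m. pd j g (F (x(i := x i))) * pd i (\<lambda>x. F x j) x)) (at (x i))"
  proof (rule DERIV_along_curve[OF V g])
    show "\<forall>\<^sub>F t in nhds (x i). F (x(i := t)) \<in> Rn m"
      by (rule eventually_mono[OF eventually_upd_in[OF U x i]]) (use F(1) openin_subset_Rn[OF V] in auto)
    show "((\<lambda>t. F (x(i := t)) j) has_real_derivative pd i (\<lambda>x. F x j) x) (at (x i))" if "j < m" for j
      using F(2)[OF that] x i by (intro partial_has_derivative) auto
  qed (use F(1) x in auto)
  then have *: "((\<lambda>t. g (F (x(i := t)))) has_real_derivative
      (\<Sum>j<m. pd j g (F x) * pd i (\<lambda>x. F x j) x)) (at (x i))"
    by simp
  then show "pd i (\<lambda>x. g (F x)) x = (\<Sum>j<m. pd j g (F x) * pd i (\<lambda>x. F x j) x)"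
    unfolding pd_def[of i "\<lambda>x. g (F x)"] by (rule DERIV_imp_deriv)
  from * show "(\<lambda>t. g (F (x(i := t)))) differentiable (at (x i))"
    using real_differentiable_def by blast
qed

lemma continuous_on_Rn_coordinates:
  assumes "F ` U \<subseteq> Rn m" "\<And>j. j < m \<Longrightarrow> continuous_on U (\<lambda>x. F x j)"
  shows "continuous_on U (F :: rvec \<Rightarrow> rvec)"
proof (rule continuous_on_coordinatewise_then_product)
  fix j
  show "continuous_on U (\<lambda>x. F x j)"
  proof (cases "j < m")
    case False
    then have "continuous_on U (\<lambda>x. F x j) = continuous_on U (\<lambda>x. 0::real)"
      using assms(1) by (intro continuous_on_cong) (auto simp: Rn_iff)
    then show ?thesis by simp
  qed (use assms(2) in auto)
qed

lemma Ck_compose: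
  assumes U: "openin (Euclidean_space n) U" and V: "openin (Euclidean_space m) V"
    and F: "F ` U \<subseteq> V"
  shows "(\<And>j. j < m \<Longrightarrow> Ck n U k (\<lambda>x. F x j)) \<Longrightarrow> Ck m V k g \<Longrightarrow> Ck n U k (\<lambda>x. g (F x))"
proof (induction k arbitrary: g)
  case 0
  have "continuous_on U F"
    using 0 F openin_subset_Rn[OF V] by (intro continuous_on_Rn_coordinates[of _ _ m]) auto
  then show ?case
    using 0(2) F continuous_on_compose2[of V g U F] by simp
next
  case (Suc k)
  have F1: "Ck n U (Suc 0) (\<lambda>x. F x j)" if "j < m" for j
    using Suc.prems(1)[OF that] Ck_continuous by auto
  have g1: "Ck m V (Suc 0) g"
    using Suc.prems(2) Ck_continuous by auto
  have Fk: "Ck n U k (\<lambda>x. F x j)" if "j < m" for j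
    using Suc.prems(1)[OF that] by (rule Ck_Suc_imp)
  have "Ck n U k (\<lambda>x. g (F x))"
    using Suc.IH[of g] Fk Suc.prems(2) Ck_Suc_imp by blast
  then have "continuous_on U (\<lambda>x. g (F x))" by (rule Ck_continuous)
  moreover have "Ck n U k (pd i (\<lambda>x. g (F x)))" if i: "i < n" for i
  proof (rule Ck_cong[OF U])
    show "Ck n U k (\<lambda>x. \<Sum>j<m. pd j g (F x) * pd i (\<lambda>x. F x j) x)"
    proof (rule Ck_sum[OF U], rule Ck_mult[OF U])
      fix j assume "j \<in> {..<m}"
      then have j: "j < m" by simp
      have "Ck m V k (pd j g)" using Suc.prems(2) j by simp
      with Fk show "Ck n U k (\<lambda>x. pd j g (F x))" by (rule Suc.IH)
      show "Ck n U k (\<lambda>x. pd i (\<lambda>x. F x j) x)" using Suc.prems(1)[OF j] i by simp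
    qed
    show "(\<Sum>j<m. pd j g (F x) * pd i (\<lambda>x. F x j) x) = pd i (\<lambda>x. g (F x)) x" if "x \<in> U" for x
      using pd_compose(1)[OF U V F F1 g1 that i] by simp
  qed
  ultimately show ?case
    using pd_compose(2)[OF U V F F1 g1] by simp
qed


subsection \<open>Smooth functions and maps\<close>

lemma smooth_fun_imp_Ck: "openin (Euclidean_space n) U \<Longrightarrow> smooth_fun n U f \<Longrightarrow> Ck n U k f"
  using smooth_fun_iff_Ck openin_subset_Rn by blast

lemma smooth_funI: "openin (Euclidean_space n) U \<Longrightarrow> (\<And>k. Ck n U k f) \<Longrightarrow> smooth_fun n U f"
  using smooth_fun_iff_Ck openin_subset_Rn by blast

lemma smooth_fun_continuous: "openin (Euclidean_space n) U \<Longrightarrow> smooth_fun n U f \<Longrightarrow> continuous_on U f"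
  using smooth_fun_imp_Ck[of n U f 0] by simp

lemma smooth_fun_pd:
  "openin (Euclidean_space n) U \<Longrightarrow> smooth_fun n U f \<Longrightarrow> i < n \<Longrightarrow> smooth_fun n U (pd i f)"
  using smooth_fun_unfold openin_subset_Rn by blast

lemma smooth_fun_cong:
  assumes "openin (Euclidean_space n) U" "\<And>x. x \<in> U \<Longrightarrow> f x = g x" "smooth_fun n U f"
  shows "smooth_fun n U g"
  using assms Ck_cong[OF assms(1,2)] by (meson smooth_funI smooth_fun_imp_Ck)

lemma smooth_fun_subset:
  assumes "openin (Euclidean_space n) U" "openin (Euclidean_space n) V" "V \<subseteq> U" "smooth_fun n U f"
  shows "smooth_fun n V f"
  using assms Ck_subset by (meson smooth_funI smooth_fun_imp_Ck)

lemma smooth_fun_local: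
  assumes "openin (Euclidean_space n) U"
    and "\<And>x. x \<in> U \<Longrightarrow> \<exists>V. openin (Euclidean_space n) V \<and> x \<in> V \<and> V \<subseteq> U \<and> smooth_fun n V f"
  shows "smooth_fun n U f"
  by (intro smooth_funI[OF assms(1)] Ck_local[OF _ assms(1)]) (meson assms(2) smooth_fun_imp_Ck)

lemma smooth_fun_const: "openin (Euclidean_space n) U \<Longrightarrow> smooth_fun n U (\<lambda>x. c)"
  by (intro smooth_funI Ck_const)

lemma smooth_fun_coordinate: "openin (Euclidean_space n) U \<Longrightarrow> smooth_fun n U (\<lambda>x. x j)"
  by (intro smooth_funI Ck_coordinate) (auto dest: openin_subset_Rn)

lemma smooth_fun_add:
  assumes U: "openin (Euclidean_space n) U" and "smooth_fun n U f" "smooth_fun n U g"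
  shows "smooth_fun n U (\<lambda>x. f x + g x)"
  using assms(2,3)[THEN smooth_fun_imp_Ck[OF U]] by (intro smooth_funI[OF U] Ck_add[OF U])

lemma smooth_fun_mult:
  "openin (Euclidean_space n) U \<Longrightarrow> smooth_fun n U f \<Longrightarrow> smooth_fun n U g
    \<Longrightarrow> smooth_fun n U (\<lambda>x. f x * g x)"
  by (intro smooth_funI Ck_mult) (auto intro: smooth_fun_imp_Ck)

lemma smooth_fun_sum:
  "openin (Euclidean_space n) U \<Longrightarrow> (\<And>i. i \<in> I \<Longrightarrow> smooth_fun n U (f i))
    \<Longrightarrow> smooth_fun n U (\<lambda>x. \<Sum>i\<in>I. f i x)"
  by (intro smooth_funI Ck_sum) (auto intro: smooth_fun_imp_Ck)

lemma smooth_fun_compose: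
  assumes U: "openin (Euclidean_space n) U" and V: "openin (Euclidean_space m) V"
    and "smooth_map n U m F" "F ` U \<subseteq> V" "smooth_fun m V g"
  shows "smooth_fun n U (\<lambda>x. g (F x))"
proof (rule smooth_funI[OF U])
  fix k
  show "Ck n U k (\<lambda>x. g (F x))"
  proof (rule Ck_compose[OF U V assms(4)])
    show "Ck n U k (\<lambda>x. F x j)" if "j < m" for j
      using assms(3) that smooth_fun_imp_Ck[OF U, of "\<lambda>x. F x j" k] by (simp add: smooth_map_def)
    show "Ck m V k g"
      using smooth_fun_imp_Ck[OF V assms(5)] .
  qed
qed

lemma smooth_map_image: "smooth_map n U m F \<Longrightarrow> F ` U \<subseteq> Rn m"
  by (simp add: smooth_map_def)

text \<open>
  Coordinates beyond the dimension of the target vanish identically.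
\<close>

lemma smooth_map_component:
  assumes U: "openin (Euclidean_space n) U" and F: "smooth_map n U m F"
  shows "smooth_fun n U (\<lambda>x. F x j)"
proof (cases "j < m")
  case False
  show ?thesis
    by (rule smooth_fun_cong[OF U _ smooth_fun_const[OF U, of 0]])
       (use F False in \<open>auto simp: smooth_map_def Rn_iff\<close>)
qed (use F in \<open>auto simp: smooth_map_def\<close>)

lemma smooth_map_continuous:
  assumes U: "openin (Euclidean_space n) U" and F: "smooth_map n U m F"
  shows "continuous_on U F"
  using smooth_map_component[OF assms, THEN smooth_fun_continuous[OF U]]
  by (rule continuous_on_coordinatewise_then_product)

lemma smooth_map_cong:
  assumes "openin (Euclidean_space n) U" "\<And>x. x \<in> U \<Longrightarrow> F x = G x" "smooth_map n U m F"
  shows "smooth_map n U m G"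
  unfolding smooth_map_def
proof (intro conjI allI impI)
  show "G ` U \<subseteq> Rn m" using assms(2,3) by (auto simp: smooth_map_def)
  show "smooth_fun n U (\<lambda>x. G x j)" if "j < m" for j
    by (rule smooth_fun_cong[OF assms(1), of "\<lambda>x. F x j"])
       (use assms(2,3) that in \<open>simp_all add: smooth_map_def\<close>)
qed

lemma smooth_map_subset:
  assumes "openin (Euclidean_space n) U" "openin (Euclidean_space n) V" "V \<subseteq> U" "smooth_map n U m F"
  shows "smooth_map n V m F"
  using smooth_fun_subset[OF assms(1-3)] assms(3,4) unfolding smooth_map_def by blast

lemma smooth_map_id: "openin (Euclidean_space n) U \<Longrightarrow> smooth_map n U n (\<lambda>x. x)"
  by (auto simp: smooth_map_def smooth_fun_coordinate dest: openin_subset_Rn)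

lemma smooth_map_compose:
  assumes U: "openin (Euclidean_space n) U" and V: "openin (Euclidean_space m) V"
    and "smooth_map n U m F" "F ` U \<subseteq> V" "smooth_map m V l G"
  shows "smooth_map n U l (\<lambda>x. G (F x))"
  unfolding smooth_map_def
proof (intro conjI allI impI)
  show "(\<lambda>x. G (F x)) ` U \<subseteq> Rn l" using assms(4,5) unfolding smooth_map_def by blast
  show "smooth_fun n U (\<lambda>x. G (F x) j)" if "j < l" for j
    using smooth_fun_compose[OF assms(1-4), of "\<lambda>y. G y j"] assms(5) that
    by (simp add: smooth_map_def)
qed


subsection \<open>Directional derivatives and differentials\<close>

lemma dir_deriv_cong:
  assumes U: "openin (Euclidean_space n) U" and fg: "\<And>y. y \<in> U \<Longrightarrow> f y = g y"
    and "x \<in> U" "v \<in> Rn n"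
  shows "dir_deriv f x v = dir_deriv g x v"
  unfolding dir_deriv_def
  by (rule deriv_cong_ev, rule eventually_mono[OF eventually_line_in[OF U assms(3,4)]])
     (auto simp: fg)

lemma differential_cong:
  assumes "openin (Euclidean_space n) U" "\<And>y. y \<in> U \<Longrightarrow> F y = G y" "x \<in> U" "v \<in> Rn n"
  shows "differential F x v = differential G x v"
  unfolding differential_def
  by (rule ext, rule dir_deriv_cong[OF assms(1) _ assms(3,4)]) (simp add: assms(2))

lemma dir_deriv_zero [simp]: "dir_deriv f x (\<lambda>i. 0) = 0"
  by (simp add: dir_deriv_def)

lemma differential_zero [simp]: "differential F x (\<lambda>i. 0) = (\<lambda>j. 0)"
  by (simp add: differential_def)

lemma differential_id [simp]: "differential (\<lambda>x. x) x v = v"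
proof
  fix j
  have "((\<lambda>t. x j + t * v j) has_real_derivative v j) (at 0)"
    by (auto intro!: derivative_eq_intros)
  then show "differential (\<lambda>x. x) x v j = v j"
    by (simp add: differential_def dir_deriv_def DERIV_imp_deriv)
qed

lemma dir_deriv_eq_sum:
  assumes U: "openin (Euclidean_space n) U" and f: "smooth_fun n U f" and x: "x \<in> U" and v: "v \<in> Rn n"
  shows "dir_deriv f x v = (\<Sum>i<n. pd i f x * v i)"
proof -
  have "((\<lambda>t. f (\<lambda>i. x i + t * v i)) has_real_derivative (\<Sum>i<n. pd i f (\<lambda>i. x i + 0 * v i) * v i)) (at 0)"
  proof (rule DERIV_along_curve[OF U smooth_fun_imp_Ck[OF U f]])
    show "\<forall>\<^sub>F t in nhds 0. (\<lambda>i. x i + t * v i) \<in> Rn n"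
      using eventually_line_in[OF U x v] openin_subset_Rn[OF U] by (auto elim: eventually_mono)
    show "((\<lambda>t. x i + t * v i) has_real_derivative v i) (at 0)" for i
      by (auto intro!: derivative_eq_intros)
  qed (use x in simp)
  then show ?thesis by (simp add: dir_deriv_def DERIV_imp_deriv)
qed

lemma differential_in_Rn:
  assumes U: "openin (Euclidean_space n) U" and F: "F ` U \<subseteq> Rn m" and "x \<in> U" "v \<in> Rn n"
  shows "differential F x v \<in> Rn m"
  unfolding Rn_iff differential_def
proof (intro allI impI)
  fix j assume "j \<ge> m"
  then have "dir_deriv (\<lambda>y. F y j) x v = dir_deriv (\<lambda>y. 0) x v"
    using F by (intro dir_deriv_cong[OF U _ assms(3,4)]) (auto simp: Rn_iff)
  then show "dir_deriv (\<lambda>y. F y j) x v = 0" by (simp add: dir_deriv_def)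
qed

lemma differential_linear:
  assumes U: "openin (Euclidean_space n) U" and F: "smooth_map n U m F"
    and "x \<in> U" "v \<in> Rn n" "w \<in> Rn n"
  shows "differential F x (vec_lc v a w) = vec_lc (differential F x v) a (differential F x w)"
proof
  fix j
  note D = dir_deriv_eq_sum[OF U smooth_map_component[OF U F] assms(3)]
  show "differential F x (vec_lc v a w) j = vec_lc (differential F x v) a (differential F x w) j"
    unfolding differential_def vec_lc_def[of "\<lambda>j. dir_deriv _ _ _"]
      D[OF vec_lc_in_Rn[OF assms(4,5)]] D[OF assms(4)] D[OF assms(5)]
    by (simp add: vec_lc_def algebra_simps sum.distrib sum_distrib_left)
qed

lemma dir_deriv_compose:
  assumes U: "openin (Euclidean_space n) U" and V: "openin (Euclidean_space m) V"
    and F: "smooth_map n U m F" "F ` U \<subseteq> V" and g: "smooth_fun m V g"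
    and x: "x \<in> U" and v: "v \<in> Rn n"
  shows "dir_deriv (\<lambda>x. g (F x)) x v = dir_deriv g (F x) (differential F x v)"
proof -
  have "dir_deriv g (F x) (differential F x v) = (\<Sum>j<m. pd j g (F x) * differential F x v j)"
    using F x by (intro dir_deriv_eq_sum[OF V g] differential_in_Rn[OF U smooth_map_image[OF F(1)] x v]) auto
  also have "\<dots> = (\<Sum>j<m. pd j g (F x) * (\<Sum>i<n. pd i (\<lambda>y. F y j) x * v i))"
    using smooth_map_component[OF U F(1)] by (simp add: differential_def dir_deriv_eq_sum[OF U _ x v])
  also have "\<dots> = (\<Sum>i<n. (\<Sum>j<m. pd j g (F x) * pd i (\<lambda>y. F y j) x) * v i)"
    unfolding sum_distrib_left sum_distrib_right by (subst sum.swap) (simp add: mult.assoc)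
  also have "\<dots> = (\<Sum>i<n. pd i (\<lambda>x. g (F x)) x * v i)"
  proof (intro sum.cong refl)
    fix i assume "i \<in> {..<n}"
    then have i: "i < n" by simp
    have "pd i (\<lambda>x. g (F x)) x = (\<Sum>j<m. pd j g (F x) * pd i (\<lambda>x. F x j) x)"
      by (rule pd_compose(1)[OF U V F(2) smooth_fun_imp_Ck[OF U smooth_map_component[OF U F(1)]]
            smooth_fun_imp_Ck[OF V g] x i])
    then show "(\<Sum>j<m. pd j g (F x) * pd i (\<lambda>y. F y j) x) * v i = pd i (\<lambda>x. g (F x)) x * v i"
      by simp
  qed
  also have "\<dots> = dir_deriv (\<lambda>x. g (F x)) x v"
    using dir_deriv_eq_sum[OF U smooth_fun_compose[OF U V F g] x v] by simp
  finally show ?thesis by simp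
qed

lemma differential_compose:
  assumes U: "openin (Euclidean_space n) U" and V: "openin (Euclidean_space m) V"
    and F: "smooth_map n U m F" "F ` U \<subseteq> V" and G: "smooth_map m V l G"
    and x: "x \<in> U" and v: "v \<in> Rn n"
  shows "differential (\<lambda>x. G (F x)) x v = differential G (F x) (differential F x v)"
  unfolding differential_def[of "\<lambda>x. G (F x)"] differential_def[of G]
  by (rule ext) (rule dir_deriv_compose[OF U V F smooth_map_component[OF V G] x v])

lemma smooth_map_differential:
  assumes U: "openin (Euclidean_space n) U" and F: "smooth_map n U m F" and v: "v \<in> Rn n"
  shows "smooth_map n U m (\<lambda>x. differential F x v)"
  unfolding smooth_map_def
proof (intro conjI allI impI)
  show "(\<lambda>x. differential F x v) ` U \<subseteq> Rn m"
    using differential_in_Rn[OF U smooth_map_image[OF F] _ v] by auto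
  show "smooth_fun n U (\<lambda>x. differential F x v j)" for j
  proof (rule smooth_fun_cong[OF U])
    show "smooth_fun n U (\<lambda>x. \<Sum>i<n. pd i (\<lambda>y. F y j) x * v i)"
    proof (rule smooth_fun_sum[OF U], rule smooth_fun_mult[OF U])
      show "smooth_fun n U (\<lambda>x. pd i (\<lambda>y. F y j) x)" if "i \<in> {..<n}" for i
        using smooth_fun_pd[OF U smooth_map_component[OF U F]] that by simp
    qed (rule smooth_fun_const[OF U])
    show "(\<Sum>i<n. pd i (\<lambda>y. F y j) x * v i) = differential F x v j" if "x \<in> U" for x
      using dir_deriv_eq_sum[OF U smooth_map_component[OF U F] that v] by (simp add: differential_def)
  qed
qed


section \<open>Forms on open subsets of Cartesian spaces\<close>

definition unit_vec :: "nat \<Rightarrow> rvec" where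
  "unit_vec j = (\<lambda>i. if i = j then 1 else 0)"

lemma unit_vec_in_Rn: "j < n \<Longrightarrow> unit_vec j \<in> Rn n"
  by (auto simp: unit_vec_def Rn_iff)

lemma alternating_multilinear_slot:
  assumes "alternating_multilinear lc V k g" "set as \<subseteq> V" "set bs \<subseteq> V"
    "length as + Suc (length bs) = k" "u \<in> V" "w \<in> V"
  shows "g (as @ lc u a w # bs) = g (as @ u # bs) + a * g (as @ w # bs)"
proof -
  have "length (as @ u # bs) = k \<and> set (as @ u # bs) \<subseteq> V" "length as < k"
    using assms by auto
  then have "g ((as @ u # bs)[length as := lc u a w]) =
      g ((as @ u # bs)[length as := u]) + a * g ((as @ u # bs)[length as := w])"
    using assms(1,5,6) unfolding alternating_multilinear_def by blast
  then show ?thesis by (simp add: list_update_append)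
qed

lemma alternating_multilinear_zero:
  assumes "alternating_multilinear vec_lc (Rn n) k g" "set as \<subseteq> Rn n" "set bs \<subseteq> Rn n"
    "length as + Suc (length bs) = k"
  shows "g (as @ (\<lambda>i. 0) # bs) = 0"
proof -
  have "vec_lc (\<lambda>i. 0) 1 (\<lambda>i. 0) = (\<lambda>i. 0)" by (simp add: vec_lc_def)
  with alternating_multilinear_slot[OF assms zero_in_Rn zero_in_Rn, of 1] show ?thesis by simp
qed

lemma alternating_multilinear_expand:
  assumes g: "alternating_multilinear vec_lc (Rn n) k g" "set as \<subseteq> Rn n" "set bs \<subseteq> Rn n"
    "length as + Suc (length bs) = k" and w: "w \<in> Rn n"
  shows "g (as @ w # bs) = (\<Sum>j<n. w j * g (as @ unit_vec j # bs))"
proof -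
  \<comment> \<open>The truncations of \<open>w\<close>; each arises from the preceding one by adding a multiple of a basis vector.\<close>
  define c where "c = (\<lambda>l i. if i < (l::nat) then w i else 0)"
  have "g (as @ c l # bs) = (\<Sum>j<l. w j * g (as @ unit_vec j # bs))" if "l \<le> n" for l
    using that
  proof (induction l)
    case 0
    then show ?case using alternating_multilinear_zero[OF g] by (simp add: c_def)
  next
    case (Suc l)
    have "c (Suc l) = vec_lc (c l) (w l) (unit_vec l)"
      by (auto simp: c_def vec_lc_def unit_vec_def fun_eq_iff less_Suc_eq)
    moreover have "c l \<in> Rn n" using Suc.prems by (auto simp: c_def Rn_iff)
    ultimately show ?case
      using alternating_multilinear_slot[OF g _ unit_vec_in_Rn, of "c l" l "w l"] Suc by simp
  qed
  moreover have "c n = w" using w by (auto simp: c_def Rn_iff fun_eq_iff)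
  ultimately show ?thesis by force
qed

lemma is_form_eq_0:
  assumes "is_form n U k \<omega>" "\<not> (x \<in> U \<and> length vs = k \<and> set vs \<subseteq> Rn n)"
  shows "\<omega> x vs = 0"
  using assms unfolding is_form_def by blast

lemma is_form_multilinear: "is_form n U k \<omega> \<Longrightarrow> x \<in> U \<Longrightarrow> alternating_multilinear vec_lc (Rn n) k (\<omega> x)"
  unfolding is_form_def by blast

lemma is_form_smooth:
  assumes "openin (Euclidean_space n) U" "is_form n U k \<omega>"
  shows "smooth_fun n U (\<lambda>x. \<omega> x vs)"
proof (cases "length vs = k \<and> set vs \<subseteq> Rn n")
  case False
  then have "\<omega> x vs = 0" for x using is_form_eq_0[OF assms(2)] by blast
  then show ?thesis using smooth_fun_const[OF assms(1)] by simp
qed (use assms in \<open>auto simp: is_form_def\<close>)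

lemma is_form_local:
  assumes U: "openin (Euclidean_space n) U" and 0: "\<And>x vs. x \<notin> U \<Longrightarrow> \<omega> x vs = 0"
    and loc: "\<And>x. x \<in> U \<Longrightarrow> \<exists>V \<eta>. openin (Euclidean_space n) V \<and> x \<in> V \<and> V \<subseteq> U \<and> is_form n V k \<eta> \<and>
      (\<forall>y\<in>V. \<omega> y = \<eta> y)"
  shows "is_form n U k \<omega>"
  unfolding is_form_def
proof (intro conjI allI impI ballI)
  fix x vs assume nz: "\<omega> x vs \<noteq> 0"
  then show x: "x \<in> U" using 0 by blast
  from loc[OF x] nz show "length vs = k" "set vs \<subseteq> Rn n"
    using is_form_eq_0 by metis+
next
  fix x assume "x \<in> U"
  from loc[OF this] show "alternating_multilinear vec_lc (Rn n) k (\<omega> x)"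
    using is_form_multilinear by metis
next
  fix vs :: "rvec list"
  show "smooth_fun n U (\<lambda>x. \<omega> x vs)"
  proof (rule smooth_fun_local[OF U])
    fix x assume "x \<in> U"
    from loc[OF this] obtain V \<eta> where V: "openin (Euclidean_space n) V" "x \<in> V" "V \<subseteq> U"
      and \<eta>: "is_form n V k \<eta>" "\<forall>y\<in>V. \<omega> y = \<eta> y"
      by blast
    have "smooth_fun n V (\<lambda>x. \<omega> x vs)"
      by (rule smooth_fun_cong[OF V(1) _ is_form_smooth[OF V(1) \<eta>(1)]]) (simp add: \<eta>(2))
    with V show "\<exists>V. openin (Euclidean_space n) V \<and> x \<in> V \<and> V \<subseteq> U \<and> smooth_fun n V (\<lambda>x. \<omega> x vs)"
      by blast
  qed
qed

text \<open>
  Varying vectors are expanded in the standard basis, one slot at a time, which leaves the values of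
  the form on constant vectors.
\<close>

lemma smooth_fun_form_eval:
  assumes U: "openin (Euclidean_space n) U" and V: "openin (Euclidean_space m) V"
    and \<omega>: "is_form m V k \<omega>" and F: "smooth_map n U m F" "F ` U \<subseteq> V"
  shows "(\<And>w. w \<in> set ws \<Longrightarrow> smooth_map n U m w) \<Longrightarrow> set cs \<subseteq> Rn m \<Longrightarrow> length ws + length cs = k
    \<Longrightarrow> smooth_fun n U (\<lambda>x. \<omega> (F x) (map (\<lambda>w. w x) ws @ cs))"
proof (induction ws arbitrary: cs rule: rev_induct)
  case Nil
  then show ?case using smooth_fun_compose[OF U V F is_form_smooth[OF V \<omega>]] by simp
next
  case (snoc w ws)
  have w: "smooth_map n U m w" and ws: "\<And>w. w \<in> set ws \<Longrightarrow> smooth_map n U m w"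
    using snoc.prems(1) by auto
  have "(\<Sum>j<m. w x j * \<omega> (F x) (map (\<lambda>w. w x) ws @ unit_vec j # cs)) =
      \<omega> (F x) (map (\<lambda>w. w x) (ws @ [w]) @ cs)" if x: "x \<in> U" for x
  proof -
    have "F x \<in> V" using F(2) x by blast
    from is_form_multilinear[OF \<omega> this]
    have "\<omega> (F x) (map (\<lambda>w. w x) ws @ w x # cs) =
        (\<Sum>j<m. w x j * \<omega> (F x) (map (\<lambda>w. w x) ws @ unit_vec j # cs))"
    proof (rule alternating_multilinear_expand)
      show "set (map (\<lambda>w. w x) ws) \<subseteq> Rn m"
        using ws smooth_map_image x by fastforce
      show "w x \<in> Rn m" using smooth_map_image[OF w] x by blast
    qed (use snoc.prems in auto)
    then show ?thesis by simp
  qed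
  moreover have "smooth_fun n U (\<lambda>x. \<Sum>j<m. w x j * \<omega> (F x) (map (\<lambda>w. w x) ws @ unit_vec j # cs))"
  proof (rule smooth_fun_sum[OF U], rule smooth_fun_mult[OF U smooth_map_component[OF U w]])
    fix j assume "j \<in> {..<m}"
    then show "smooth_fun n U (\<lambda>x. \<omega> (F x) (map (\<lambda>w. w x) ws @ unit_vec j # cs))"
      using snoc.prems unit_vec_in_Rn[of j m] by (intro snoc.IH ws) auto
  qed
  ultimately show ?case by (rule smooth_fun_cong[OF U])
qed

lemma form_pullback_apply:
  "x \<in> V \<Longrightarrow> set vs \<subseteq> Rn n \<Longrightarrow> form_pullback n V F \<omega> x vs = \<omega> (F x) (map (differential F x) vs)"
  by (simp add: form_pullback_def)

text \<open>
  The linear maps to which this is applied are the differential of a smooth map and the passage from a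
  tangent vector to its coordinates in a chart.
\<close>

lemma alternating_multilinear_map:
  assumes g: "alternating_multilinear lc' V' k g"
    and f: "\<And>v. v \<in> V \<Longrightarrow> f v \<in> V'"
      "\<And>u a w. u \<in> V \<Longrightarrow> w \<in> V \<Longrightarrow> lc u a w \<in> V \<and> f (lc u a w) = lc' (f u) a (f w)"
    and h: "\<And>vs. set vs \<subseteq> V \<Longrightarrow> length vs = k \<Longrightarrow> h vs = g (map f vs)"
  shows "alternating_multilinear lc V k h"
  unfolding alternating_multilinear_def
proof (intro allI impI conjI ballI)
  fix vs i u w a
  assume vs: "length vs = k \<and> set vs \<subseteq> V" and i: "i < k" and u: "u \<in> V" and w: "w \<in> V"
  have V': "length (map f vs) = k \<and> set (map f vs) \<subseteq> V'" using vs f(1) by auto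
  have s: "set (vs[i := y]) \<subseteq> V" if "y \<in> V" for y
    using vs that by (simp add: set_update_subsetI)
  show "h (vs[i := lc u a w]) = h (vs[i := u]) + a * h (vs[i := w])"
    using g[unfolded alternating_multilinear_def, rule_format, OF V', THEN conjunct1, rule_format,
        OF i f(1)[OF u] f(1)[OF w], of a] f(2)[OF u w, of a] vs
    by (simp add: h[OF s] u w map_update)
next
  fix vs and i j :: nat
  assume vs: "length vs = k \<and> set vs \<subseteq> V" and ij: "i < j \<and> j < k \<and> vs ! i = vs ! j"
  have V': "length (map f vs) = k \<and> set (map f vs) \<subseteq> V'" using vs f(1) by auto
  have "i < j \<and> j < k \<and> map f vs ! i = map f vs ! j" using ij vs by auto
  then have "g (map f vs) = 0"
    using g[unfolded alternating_multilinear_def, rule_format, OF V', THEN conjunct2] by blast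
  then show "h vs = 0" using h vs by simp
qed

lemma is_form_pullback:
  assumes U: "openin (Euclidean_space n) U" and V: "openin (Euclidean_space m) V"
    and \<omega>: "is_form m V k \<omega>" and F: "smooth_map n U m F" "F ` U \<subseteq> V"
  shows "is_form n U k (form_pullback n U F \<omega>)"
  unfolding is_form_def
proof (intro conjI allI impI ballI)
  fix x vs assume "form_pullback n U F \<omega> x vs \<noteq> 0"
  then have "x \<in> U" "set vs \<subseteq> Rn n" "\<omega> (F x) (map (differential F x) vs) \<noteq> 0"
    by (auto simp: form_pullback_def split: if_splits)
  then show "x \<in> U" "length vs = k" "set vs \<subseteq> Rn n"
    using is_form_eq_0[OF \<omega>, of "F x" "map (differential F x) vs"] by auto
next
  fix x assume x: "x \<in> U"
  then have "F x \<in> V" using F(2) by blast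
  from is_form_multilinear[OF \<omega> this] show "alternating_multilinear vec_lc (Rn n) k (form_pullback n U F \<omega> x)"
  proof (rule alternating_multilinear_map)
    show "differential F x v \<in> Rn m" if "v \<in> Rn n" for v
      by (rule differential_in_Rn[OF U smooth_map_image[OF F(1)] x that])
    show "vec_lc u a w \<in> Rn n \<and> differential F x (vec_lc u a w) =
        vec_lc (differential F x u) a (differential F x w)" if "u \<in> Rn n" "w \<in> Rn n" for u a w
      using vec_lc_in_Rn[OF that] differential_linear[OF U F(1) x that] by blast
  qed (simp add: form_pullback_apply x)
next
  fix vs assume vs: "length vs = k \<and> set vs \<subseteq> Rn n"
  have "smooth_fun n U (\<lambda>x. \<omega> (F x) (map (\<lambda>w. w x) (map (\<lambda>v x. differential F x v) vs) @ []))"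
    using vs by (intro smooth_fun_form_eval[OF U V \<omega> F]) (auto intro: smooth_map_differential[OF U F(1)])
  then show "smooth_fun n U (\<lambda>x. form_pullback n U F \<omega> x vs)"
    by (rule smooth_fun_cong[OF U, rotated]) (use vs in \<open>simp add: form_pullback_apply o_def\<close>)
qed

section \<open>Diffeologies and quotients\<close>

definition reparam :: "'a param \<Rightarrow> nat \<Rightarrow> rvec set \<Rightarrow> (rvec \<Rightarrow> rvec) \<Rightarrow> 'a param" where
  "reparam p n V F = Param n V (restrict (pmap p \<circ> F) V)"

lemma reparam_sel [simp]: "pdim (reparam p n V F) = n" "pdom (reparam p n V F) = V"
  and pmap_reparam: "x \<in> V \<Longrightarrow> pmap (reparam p n V F) x = pmap p (F x)"
  by (simp_all add: reparam_def)

lemma param_compose_sel [simp]: "pdim (param_compose f p) = pdim p" "pdom (param_compose f p) = pdom p"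
  and pmap_param_compose: "x \<in> pdom p \<Longrightarrow> pmap (param_compose f p) x = f (pmap p x)"
  by (simp_all add: param_compose_def)

abbreviation subparam :: "'a param \<Rightarrow> rvec set \<Rightarrow> 'a param" where
  "subparam p V \<equiv> reparam p (pdim p) V (\<lambda>x. x)"

lemma param_compose_cong:
  assumes "\<And>x. x \<in> pdom p \<Longrightarrow> f (pmap p x) = g (pmap p x)"
  shows "param_compose f p = param_compose g p"
  using assms by (auto simp: param_compose_def restrict_def fun_eq_iff)

lemma param_compose_reparam:
  assumes "F ` V \<subseteq> pdom p"
  shows "param_compose f (reparam p n V F) = reparam (param_compose f p) n V F"
  using assms by (auto simp: param_compose_def reparam_def restrict_def fun_eq_iff)

locale diffeology =
  fixes X :: "'a set" and D :: "'a param set"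
  assumes plots_param: "p \<in> D \<Longrightarrow> is_param X p"
    and plots_reparam: "p \<in> D \<Longrightarrow> openin (Euclidean_space n) V \<Longrightarrow> smooth_map n V (pdim p) F
      \<Longrightarrow> F ` V \<subseteq> pdom p \<Longrightarrow> reparam p n V F \<in> D"
begin

lemma plots_openin: "p \<in> D \<Longrightarrow> openin (Euclidean_space (pdim p)) (pdom p)"
  using plots_param by (auto simp: is_param_def)

lemma subparam_plot:
  assumes "p \<in> D" "openin (Euclidean_space (pdim p)) V" "V \<subseteq> pdom p"
  shows "subparam p V \<in> D"
  using assms by (intro plots_reparam smooth_map_id) auto

end

lemma dforms_is_form: "\<alpha> \<in> dforms D k \<Longrightarrow> p \<in> D \<Longrightarrow> is_form (pdim p) (pdom p) k (\<alpha> p)"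
  by (simp add: dforms_def)

lemma dforms_reparam:
  "\<alpha> \<in> dforms D k \<Longrightarrow> p \<in> D \<Longrightarrow> openin (Euclidean_space n) V \<Longrightarrow> smooth_map n V (pdim p) F
    \<Longrightarrow> F ` V \<subseteq> pdom p \<Longrightarrow> \<alpha> (reparam p n V F) = form_pullback n V F (\<alpha> p)"
  by (simp add: dforms_def reparam_def)

lemma dforms_outside: "\<alpha> \<in> dforms D k \<Longrightarrow> p \<notin> D \<Longrightarrow> \<alpha> p = (\<lambda>x vs. 0)"
  by (simp add: dforms_def)

lemma dformsI:
  assumes "\<And>p. p \<in> D \<Longrightarrow> is_form (pdim p) (pdom p) k (\<alpha> p)"
    and "\<And>p n V F. p \<in> D \<Longrightarrow> openin (Euclidean_space n) V \<Longrightarrow> smooth_map n V (pdim p) F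
      \<Longrightarrow> F ` V \<subseteq> pdom p \<Longrightarrow> \<alpha> (reparam p n V F) = form_pullback n V F (\<alpha> p)"
    and "\<And>p. p \<notin> D \<Longrightarrow> \<alpha> p = (\<lambda>x vs. 0)"
  shows "\<alpha> \<in> dforms D k"
  using assms by (auto simp: dforms_def reparam_def)

lemma dforms_subparam:
  assumes \<alpha>: "\<alpha> \<in> dforms D k" "p \<in> D" and V: "openin (Euclidean_space (pdim p)) V" "V \<subseteq> pdom p" "x \<in> V"
  shows "\<alpha> (subparam p V) x vs = \<alpha> p x vs"
proof (cases "set vs \<subseteq> Rn (pdim p)")
  case True
  have "map (differential (\<lambda>x. x) x) vs = vs" by (simp add: map_idI)
  then show ?thesis
    using dforms_reparam[OF \<alpha> V(1) smooth_map_id[OF V(1)]] V True by (simp add: form_pullback_apply)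
next
  case False
  then have "\<alpha> p x vs = 0" using is_form_eq_0[OF dforms_is_form[OF \<alpha>]] by blast
  moreover have "\<alpha> (subparam p V) = form_pullback (pdim p) V (\<lambda>x. x) (\<alpha> p)"
    using dforms_reparam[OF \<alpha> V(1) smooth_map_id[OF V(1)]] V by simp
  ultimately show ?thesis using False by (simp add: form_pullback_def)
qed

definition restrict_dform :: "'a param set \<Rightarrow> 'a dform \<Rightarrow> 'a dform" where
  "restrict_dform E \<alpha> = (\<lambda>p. if p \<in> E then \<alpha> p else (\<lambda>x vs. 0))"

lemma restrict_dform_in_dforms:
  assumes \<alpha>: "\<alpha> \<in> dforms D k" and E: "E \<subseteq> D"
    and reparam: "\<And>p n V F. p \<in> E \<Longrightarrow> openin (Euclidean_space n) V \<Longrightarrow> smooth_map n V (pdim p) F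
      \<Longrightarrow> F ` V \<subseteq> pdom p \<Longrightarrow> reparam p n V F \<in> E"
  shows "restrict_dform E \<alpha> \<in> dforms E k"
proof (rule dformsI)
  fix p assume p: "p \<in> E"
  then have pD: "p \<in> D" using E by blast
  show "is_form (pdim p) (pdom p) k (restrict_dform E \<alpha> p)"
    using dforms_is_form[OF \<alpha> pD] p by (simp add: restrict_dform_def)
  fix n V F assume F: "openin (Euclidean_space n) V" "smooth_map n V (pdim p) F" "F ` V \<subseteq> pdom p"
  show "restrict_dform E \<alpha> (reparam p n V F) = form_pullback n V F (restrict_dform E \<alpha> p)"
    using dforms_reparam[OF \<alpha> pD F] reparam[OF p F] p by (simp add: restrict_dform_def)
qed (simp add: restrict_dform_def)

lemma class_of_eq:
  assumes "partition_on X \<F>" "L \<in> \<F>" "x \<in> L"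
  shows "class_of \<F> x = L"
  unfolding class_of_def using assms by (intro the_equality) (auto simp: partition_on_def disjoint_def)

lemma class_of_in:
  assumes "partition_on X \<F>" "x \<in> X"
  shows "class_of \<F> x \<in> \<F>" "x \<in> class_of \<F> x"
proof -
  obtain L where "L \<in> \<F>" "x \<in> L" using assms by (auto simp: partition_on_def)
  then show "class_of \<F> x \<in> \<F>" "x \<in> class_of \<F> x" using class_of_eq[OF assms(1)] by auto
qed

locale partitioned_diffeology = diffeology +
  fixes \<F> :: "'a set set"
  assumes partition: "partition_on X \<F>"
begin

abbreviation "Q \<equiv> quotient_diffeology \<F> D"
abbreviation "\<pi> \<equiv> class_of \<F>"

definition lift :: "'a set param \<Rightarrow> rvec \<Rightarrow> 'a param \<Rightarrow> bool" where
  "lift p u q \<longleftrightarrow> q \<in> D \<and> pdim q = pdim p \<and> u \<in> pdom q \<and> pdom q \<subseteq> pdom p \<and>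
     (\<forall>v\<in>pdom q. pmap p v = \<pi> (pmap q v))"

lemma quotient_lift: "p \<in> Q \<Longrightarrow> u \<in> pdom p \<Longrightarrow> \<exists>q. lift p u q"
  by (auto simp: quotient_diffeology_def lift_def)

lemma quotient_is_param: "p \<in> Q \<Longrightarrow> is_param \<F> p"
  by (simp add: quotient_diffeology_def)

lemma quotientI: "is_param \<F> p \<Longrightarrow> (\<And>u. u \<in> pdom p \<Longrightarrow> \<exists>q. lift p u q) \<Longrightarrow> p \<in> Q"
  unfolding quotient_diffeology_def lift_def by blast

lemma lift_at: "lift p u q \<Longrightarrow> v \<in> pdom q \<Longrightarrow> lift p v q"
  by (simp add: lift_def)

lemma is_param_project: "p \<in> D \<Longrightarrow> is_param \<F> (param_compose \<pi> p)"
  using plots_param[of p] class_of_in(1)[OF partition, OF PiE_mem[of "pmap p" "pdom p" "\<lambda>_. X"]]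
  by (auto simp: is_param_def param_compose_def)

lemma lift_project: "p \<in> D \<Longrightarrow> u \<in> pdom p \<Longrightarrow> lift (param_compose \<pi> p) u p"
  by (auto simp: lift_def pmap_param_compose)

lemma project_plot: "p \<in> D \<Longrightarrow> param_compose \<pi> p \<in> Q"
  by (rule quotientI[OF is_param_project]) (auto intro: lift_project)

lemma quotient_reparam:
  assumes p: "p \<in> Q" and V: "openin (Euclidean_space n) V" and F: "smooth_map n V (pdim p) F" "F ` V \<subseteq> pdom p"
  shows "reparam p n V F \<in> Q"
    and "\<And>u q. u \<in> V \<Longrightarrow> lift p (F u) q \<Longrightarrow>
      lift (reparam p n V F) u (reparam q n {x\<in>V. F x \<in> pdom q} F) \<and>
      openin (Euclidean_space n) {x\<in>V. F x \<in> pdom q} \<and> smooth_map n {x\<in>V. F x \<in> pdom q} (pdim q) F"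
proof -
  show L: "lift (reparam p n V F) u (reparam q n {x\<in>V. F x \<in> pdom q} F) \<and>
      openin (Euclidean_space n) {x\<in>V. F x \<in> pdom q} \<and> smooth_map n {x\<in>V. F x \<in> pdom q} (pdim q) F"
    if u: "u \<in> V" and q: "lift p (F u) q" for u q
  proof -
    let ?V = "{x\<in>V. F x \<in> pdom q}"
    have qD: "q \<in> D" and dim: "pdim q = pdim p" using q by (auto simp: lift_def)
    have o: "openin (Euclidean_space n) ?V"
      using openin_preimage[OF V smooth_map_continuous[OF V F(1)] smooth_map_image[OF F(1)]]
        plots_openin[OF qD] dim by simp
    have s: "smooth_map n ?V (pdim q) F"
      using smooth_map_subset[OF V o _ F(1)] dim by auto
    have "reparam q n ?V F \<in> D"
      by (rule plots_reparam[OF qD o s]) auto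
    then show ?thesis
      using q u o s by (auto simp: lift_def pmap_reparam)
  qed
  have "is_param \<F> (reparam p n V F)"
    using quotient_is_param[OF p] V F(2) PiE_mem[of "pmap p" "pdom p" "\<lambda>_. \<F>"]
    by (auto simp: is_param_def reparam_def image_subset_iff)
  then show "reparam p n V F \<in> Q"
    using L quotient_lift[OF p] F(2) by (intro quotientI) (auto, blast)
qed

lemma pullback_in_dforms:
  assumes \<alpha>: "\<alpha> \<in> dforms Q k"
  shows "dform_pullback D \<pi> \<alpha> \<in> dforms D k"
proof (rule dformsI)
  fix p assume p: "p \<in> D"
  show "is_form (pdim p) (pdom p) k (dform_pullback D \<pi> \<alpha> p)"
    using dforms_is_form[OF \<alpha> project_plot[OF p]] p by (simp add: dform_pullback_def)
  fix n V F assume F: "openin (Euclidean_space n) V" "smooth_map n V (pdim p) F" "F ` V \<subseteq> pdom p"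
  show "dform_pullback D \<pi> \<alpha> (reparam p n V F) = form_pullback n V F (dform_pullback D \<pi> \<alpha> p)"
    using dforms_reparam[OF \<alpha> project_plot[OF p], of n V F] plots_reparam[OF p F] p F
    by (simp add: dform_pullback_def param_compose_reparam)
qed (simp add: dform_pullback_def)

text \<open>
  On the domain of a local lift \<open>q\<close>, the plot \<open>p\<close> is the projection of \<open>q\<close>, so its form is read off
  from the pullback.
\<close>

lemma dform_at_lift:
  assumes \<alpha>: "\<alpha> \<in> dforms Q k" and p: "p \<in> Q" and q: "lift p u q"
  shows "\<alpha> p u vs = dform_pullback D \<pi> \<alpha> q u vs"
proof -
  have q': "q \<in> D" "pdim q = pdim p" "u \<in> pdom q" "pdom q \<subseteq> pdom p"
      "\<And>v. v \<in> pdom q \<Longrightarrow> pmap p v = \<pi> (pmap q v)"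
    using q by (auto simp: lift_def)
  have "subparam p (pdom q) = param_compose \<pi> q"
    using q' by (auto simp: reparam_def param_compose_def restrict_def fun_eq_iff)
  moreover have "\<alpha> (subparam p (pdom q)) u vs = \<alpha> p u vs"
    using q' plots_openin[OF q'(1)] by (intro dforms_subparam[OF \<alpha> p]) auto
  ultimately show ?thesis using q'(1) by (simp add: dform_pullback_def)
qed

lemma inj_on_pullback: "inj_on (dform_pullback D \<pi>) (dforms Q k)"
proof (rule inj_onI)
  fix \<alpha> \<beta> assume \<alpha>: "\<alpha> \<in> dforms Q k" and \<beta>: "\<beta> \<in> dforms Q k"
    and eq: "dform_pullback D \<pi> \<alpha> = dform_pullback D \<pi> \<beta>"
  have "\<alpha> p u vs = \<beta> p u vs" for p u vs
  proof (cases "p \<in> Q \<and> u \<in> pdom p")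
    case True
    then obtain q where "lift p u q" using quotient_lift by blast
    then show ?thesis using dform_at_lift[OF \<alpha>] dform_at_lift[OF \<beta>] True eq by simp
  next
    case False
    then show ?thesis
      using dforms_outside[OF \<alpha>] dforms_outside[OF \<beta>]
        is_form_eq_0[OF dforms_is_form[OF \<alpha>]] is_form_eq_0[OF dforms_is_form[OF \<beta>]] by metis
  qed
  then show "\<alpha> = \<beta>" by (intro ext)
qed

text \<open>
  Two lifts have the same projection on the intersection of their domains.
\<close>

lemma lifts_agree:
  assumes \<alpha>: "\<alpha> \<in> dforms D k"
    and compat: "\<And>P P'. P \<in> D \<Longrightarrow> P' \<in> D \<Longrightarrow> param_compose \<pi> P = param_compose \<pi> P' \<Longrightarrow> \<alpha> P = \<alpha> P'"
    and q: "lift p u q" "lift p u q'"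
  shows "\<alpha> q u vs = \<alpha> q' u vs"
proof -
  have D: "q \<in> D" "q' \<in> D" and dim: "pdim q = pdim q'" and u: "u \<in> pdom q \<inter> pdom q'"
    using q by (auto simp: lift_def)
  let ?V = "pdom q \<inter> pdom q'"
  have V: "openin (Euclidean_space (pdim q)) ?V" "openin (Euclidean_space (pdim q')) ?V"
    using plots_openin D dim by (metis openin_Int)+
  have "param_compose \<pi> (subparam q ?V) = param_compose \<pi> (subparam q' ?V)"
    using q dim by (auto simp: lift_def param_compose_def reparam_def restrict_def fun_eq_iff)
  moreover have "subparam q ?V \<in> D" "subparam q' ?V \<in> D"
    using D V by (auto intro: subparam_plot)
  ultimately have "\<alpha> (subparam q ?V) = \<alpha> (subparam q' ?V)"
    using compat by blast
  moreover have "\<alpha> (subparam q ?V) u vs = \<alpha> q u vs"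
    by (rule dforms_subparam[OF \<alpha> D(1) V(1)]) (use u in auto)
  moreover have "\<alpha> (subparam q' ?V) u vs = \<alpha> q' u vs"
    by (rule dforms_subparam[OF \<alpha> D(2) V(2)]) (use u in auto)
  ultimately show ?thesis by simp
qed

text \<open>
  The form of a plot of the quotient is defined at each point by a local lift. By hypothesis the choice of the
  lift is immaterial, so that near each point the same lift can be used, which gives smoothness and
  naturality.
\<close>

lemma dform_descends:
  assumes \<alpha>: "\<alpha> \<in> dforms D k"
    and compat: "\<And>P P'. P \<in> D \<Longrightarrow> P' \<in> D \<Longrightarrow> param_compose \<pi> P = param_compose \<pi> P' \<Longrightarrow> \<alpha> P = \<alpha> P'"
  shows "\<exists>\<beta>\<in>dforms Q k. dform_pullback D \<pi> \<beta> = \<alpha>"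
proof
  define \<beta> :: "'a set dform" where
    "\<beta> = (\<lambda>p u vs. if p \<in> Q \<and> u \<in> pdom p then \<alpha> (SOME q. lift p u q) u vs else 0)"
  have \<beta>: "\<beta> p u = \<alpha> q u" if "p \<in> Q" "lift p u q" for p u q
  proof
    fix vs
    have "u \<in> pdom p" using that(2) by (auto simp: lift_def)
    moreover have some: "lift p u (SOME q. lift p u q)" using that(2) by (rule someI)
    have "\<alpha> (SOME q. lift p u q) u vs = \<alpha> q u vs"
      by (rule lifts_agree[OF \<alpha> _ some that(2)]) (rule compat)
    ultimately show "\<beta> p u vs = \<alpha> q u vs"
      unfolding \<beta>_def using that(1) by simp
  qed
  show "\<beta> \<in> dforms Q k"
  proof (rule dformsI)
    fix p assume p: "p \<in> Q"
    have op: "openin (Euclidean_space (pdim p)) (pdom p)"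
      using quotient_is_param[OF p] by (simp add: is_param_def)
    show "is_form (pdim p) (pdom p) k (\<beta> p)"
    proof (rule is_form_local[OF op])
      fix u assume "u \<in> pdom p"
      then obtain q where q: "lift p u q" using quotient_lift[OF p] by blast
      then have "q \<in> D" "pdim q = pdim p" "u \<in> pdom q" "pdom q \<subseteq> pdom p" by (auto simp: lift_def)
      then show "\<exists>V \<eta>. openin (Euclidean_space (pdim p)) V \<and> u \<in> V \<and> V \<subseteq> pdom p \<and>
          is_form (pdim p) V k \<eta> \<and> (\<forall>y\<in>V. \<beta> p y = \<eta> y)"
        using plots_openin[of q] dforms_is_form[OF \<alpha>, of q] \<beta>[OF p lift_at[OF q]]
        by (intro exI[of _ "pdom q"] exI[of _ "\<alpha> q"]) auto
    qed (simp add: \<beta>_def)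
    fix n V F assume F: "openin (Euclidean_space n) V" "smooth_map n V (pdim p) F" "F ` V \<subseteq> pdom p"
    note rp = quotient_reparam[OF p F]
    show "\<beta> (reparam p n V F) = form_pullback n V F (\<beta> p)"
    proof (intro ext)
      fix x vs
      show "\<beta> (reparam p n V F) x vs = form_pullback n V F (\<beta> p) x vs"
      proof (cases "x \<in> V")
        case True
        then have "F x \<in> pdom p" using F(3) by blast
        then obtain q where q: "lift p (F x) q" using quotient_lift[OF p] by blast
        let ?V = "{x\<in>V. F x \<in> pdom q}"
        have qD: "q \<in> D" and x: "x \<in> ?V" using q True by (auto simp: lift_def)
        have "\<beta> (reparam p n V F) x vs = \<alpha> (reparam q n ?V F) x vs"
          using \<beta>[OF rp(1) rp(2)[OF True q, THEN conjunct1]] by simp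
        also have "\<dots> = form_pullback n ?V F (\<alpha> q) x vs"
          using rp(2)[OF True q] by (subst dforms_reparam[OF \<alpha> qD]) auto
        also have "\<dots> = form_pullback n V F (\<beta> p) x vs"
          using x \<beta>[OF p q] by (simp add: form_pullback_def)
        finally show ?thesis .
      qed (simp add: \<beta>_def form_pullback_def)
    qed
  qed (simp add: \<beta>_def)
  show "dform_pullback D \<pi> \<beta> = \<alpha>"
  proof (intro ext)
    fix p u vs
    show "dform_pullback D \<pi> \<beta> p u vs = \<alpha> p u vs"
    proof (cases "p \<in> D")
      case p: True
      show ?thesis
      proof (cases "u \<in> pdom p")
        case True
        then show ?thesis
          using \<beta>[OF project_plot[OF p] lift_project[OF p True]] p by (simp add: dform_pullback_def)
      next
        case False
        then show ?thesis
          using is_form_eq_0[OF dforms_is_form[OF \<alpha> p]] by (simp add: dform_pullback_def \<beta>_def)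
      qed
    qed (use dforms_outside[OF \<alpha>] in \<open>simp add: dform_pullback_def\<close>)
  qed
qed

text \<open>
  The pullback commutes with the algebraic operations by their definition plot by plot, and it is
  injective, so that only its image has to be determined.
\<close>

lemma dga_isomorphismI:
  assumes "\<And>k. dform_pullback D \<pi> ` dforms Q k = B k"
  shows "dga_isomorphism Q (dforms Q) D B (dform_pullback D \<pi>)"
  unfolding dga_isomorphism_def bij_betw_def
  using inj_on_pullback assms project_plot
  by (auto simp: dform_pullback_def dform_add_def dform_scale_def dform_d_def dform_wedge_def
      form_wedge_def fun_eq_iff)

end


section \<open>Manifolds\<close>

lemma mform_pullback_apply:
  "u \<in> pdom p \<Longrightarrow> set vs \<subseteq> Rn (pdim p) \<Longrightarrow>
    mform_pullback M p \<alpha> u vs = \<alpha> (pmap p u) (map (velocity M p u) vs)"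
  by (simp add: mform_pullback_def)

lemma inverse_param_sel [simp]:
  "pdim (inverse_param n c) = n" "pdom (inverse_param n c) = snd c ` fst c"
  and pmap_inverse_param: "u \<in> snd c ` fst c \<Longrightarrow> pmap (inverse_param n c) u = inv_into (fst c) (snd c) u"
  by (simp_all add: inverse_param_def)

definition coord_field :: "'a chart \<Rightarrow> ('a \<Rightarrow> 'a tvec) \<Rightarrow> rvec \<Rightarrow> rvec" where
  "coord_field c X w = X (inv_into (fst c) (snd c) w) c"

lemma velocity_zero [simp]: "velocity M p u (\<lambda>i. 0) = (\<lambda>c i. 0)"
  by (auto simp: velocity_def)

locale smooth_manifold =
  fixes M :: "'a manifold"
  assumes manifold: "is_manifold M"
begin

abbreviation "m \<equiv> mdim M"
abbreviation "D \<equiv> manifold_diffeology M"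
abbreviation "chart_inv \<equiv> inverse_param (mdim M)"

lemma
  assumes c: "c \<in> atlas M"
  shows chart_openin: "openin (mtop M) (fst c)"
    and chart_image_openin: "openin (Euclidean_space m) (snd c ` fst c)"
    and chart_homeomorphic: "homeomorphic_map (subtopology (mtop M) (fst c))
          (subtopology (Euclidean_space m) (snd c ` fst c)) (snd c)"
  using manifold c by (auto simp: is_manifold_def)

lemma chart_subset: "c \<in> atlas M \<Longrightarrow> fst c \<subseteq> points M"
  using chart_openin openin_subset by blast

lemma chart_inj: "c \<in> atlas M \<Longrightarrow> inj_on (snd c) (fst c)"
  using homeomorphic_imp_injective_map[OF chart_homeomorphic] chart_subset
  by (simp add: Int_absorb1)

lemma chart_inv_left: "c \<in> atlas M \<Longrightarrow> x \<in> fst c \<Longrightarrow> inv_into (fst c) (snd c) (snd c x) = x"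
  using chart_inj by (rule inv_into_f_f)

lemma chart_transition:
  assumes "c \<in> atlas M" "c' \<in> atlas M"
  shows "smooth_map m (snd c ` (fst c \<inter> fst c')) m (\<lambda>u. snd c' (inv_into (fst c) (snd c) u))"
  using manifold assms by (simp add: is_manifold_def comp_def case_prod_beta)

lemma chart_at: "x \<in> points M \<Longrightarrow> \<exists>c\<in>atlas M. x \<in> fst c"
  using manifold by (force simp: is_manifold_def)

lemma chart_image_Int_openin:
  assumes c: "c \<in> atlas M" and N: "openin (mtop M) N"
  shows "openin (Euclidean_space m) (snd c ` (fst c \<inter> N))"
proof -
  have "openin (subtopology (mtop M) (fst c)) (fst c \<inter> N)"
    using N by (simp add: openin_subtopology_Int2)
  then have "openin (subtopology (Euclidean_space m) (snd c ` fst c)) (snd c ` (fst c \<inter> N))"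
    using homeomorphic_map_openness_eq[OF chart_homeomorphic[OF c]] by blast
  then show ?thesis
    using chart_image_openin[OF c] openin_trans_full by blast
qed

lemma plotD:
  assumes "p \<in> D"
  shows "is_param (points M) p"
    and "continuous_map (subtopology (Euclidean_space (pdim p)) (pdom p)) (mtop M) (pmap p)"
    and "\<And>c. c \<in> atlas M \<Longrightarrow>
      smooth_map (pdim p) {u \<in> pdom p. pmap p u \<in> fst c} m (\<lambda>u. snd c (pmap p u))"
  using assms by (simp_all add: manifold_diffeology_def comp_def case_prod_beta)

lemma plotI:
  assumes "is_param (points M) p"
    and "continuous_map (subtopology (Euclidean_space (pdim p)) (pdom p)) (mtop M) (pmap p)"
    and "\<And>c. c \<in> atlas M \<Longrightarrow>
      smooth_map (pdim p) {u \<in> pdom p. pmap p u \<in> fst c} m (\<lambda>u. snd c (pmap p u))"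
  shows "p \<in> D"
  using assms by (simp_all add: manifold_diffeology_def comp_def case_prod_beta)

lemma plot_dom_openin: "p \<in> D \<Longrightarrow> openin (Euclidean_space (pdim p)) (pdom p)"
  using plotD(1) by (simp add: is_param_def)

lemma plot_in_points: "p \<in> D \<Longrightarrow> u \<in> pdom p \<Longrightarrow> pmap p u \<in> points M"
  using plotD(1) by (auto simp: is_param_def PiE_iff)

lemma plot_preimage_openin:
  assumes p: "p \<in> D" and N: "openin (mtop M) N"
  shows "openin (Euclidean_space (pdim p)) {u \<in> pdom p. pmap p u \<in> N}"
proof -
  have "topspace (subtopology (Euclidean_space (pdim p)) (pdom p)) = pdom p"
    using openin_subset[OF plot_dom_openin[OF p]] by auto
  then have "openin (subtopology (Euclidean_space (pdim p)) (pdom p)) {u \<in> pdom p. pmap p u \<in> N}"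
    using openin_continuous_map_preimage[OF plotD(2)[OF p] N] by simp
  then show ?thesis
    using plot_dom_openin[OF p] openin_trans_full by blast
qed

lemma plot_reparam:
  assumes p: "p \<in> D" and V: "openin (Euclidean_space n) V"
    and F: "smooth_map n V (pdim p) F" "F ` V \<subseteq> pdom p"
  shows "reparam p n V F \<in> D"
proof (rule plotI)
  have c: "continuous_map (subtopology (Euclidean_space n) V) (subtopology (Euclidean_space (pdim p)) (pdom p)) F"
    using smooth_map_continuous[OF V F(1)] F(2) openin_subset_Rn[OF V] openin_subset_Rn[OF plot_dom_openin[OF p]]
    by (simp add: subtopology_Euclidean_space image_subset_iff_funcset)
  have "continuous_map (subtopology (Euclidean_space n) V) (mtop M) (pmap p \<circ> F)"
    by (rule continuous_map_compose[OF c plotD(2)[OF p]])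
  then show "continuous_map (subtopology (Euclidean_space (pdim (reparam p n V F))) (pdom (reparam p n V F)))
      (mtop M) (pmap (reparam p n V F))"
    by (simp add: continuous_map_eq reparam_def)
  show "is_param (points M) (reparam p n V F)"
    using V F(2) plot_in_points[OF p] by (auto simp: is_param_def reparam_def image_subset_iff)
  fix c assume c: "c \<in> atlas M"
  let ?U = "{u \<in> pdom p. pmap p u \<in> fst c}"
  let ?V = "{x \<in> V. F x \<in> ?U}"
  have U: "openin (Euclidean_space (pdim p)) ?U"
    by (rule plot_preimage_openin[OF p chart_openin[OF c]])
  have V': "openin (Euclidean_space n) ?V"
    by (rule openin_preimage[OF V smooth_map_continuous[OF V F(1)] smooth_map_image[OF F(1)] U])
  have "smooth_map n ?V m (\<lambda>x. snd c (pmap p (F x)))"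
    by (rule smooth_map_compose[OF V' U smooth_map_subset[OF V V' _ F(1)] _ plotD(3)[OF p c]]) auto
  then have "smooth_map n ?V m (\<lambda>x. snd c (pmap (reparam p n V F) x))"
    by (rule smooth_map_cong[OF V', rotated]) (simp add: pmap_reparam)
  moreover have "{u \<in> V. pmap (reparam p n V F) u \<in> fst c} = ?V"
    using F(2) by (auto simp: pmap_reparam)
  ultimately show "smooth_map (pdim (reparam p n V F)) {u \<in> pdom (reparam p n V F). pmap (reparam p n V F) u \<in> fst c}
      m (\<lambda>u. snd c (pmap (reparam p n V F) u))"
    by simp
qed

sublocale diffeology "points M" D
  using plotD(1) plot_reparam by unfold_locales

lemma chart_inv_plot:
  assumes c: "c \<in> atlas M"
  shows "chart_inv c \<in> D"
proof (rule plotI)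
  show "is_param (points M) (chart_inv c)"
    using chart_image_openin[OF c] chart_subset[OF c]
    by (auto simp: is_param_def inverse_param_def inv_into_into subset_iff)
  obtain g where g: "homeomorphic_maps (subtopology (mtop M) (fst c))
      (subtopology (Euclidean_space m) (snd c ` fst c)) (snd c) g"
    using chart_homeomorphic[OF c] by (auto simp: homeomorphic_map_maps)
  then have "continuous_map (subtopology (Euclidean_space m) (snd c ` fst c)) (mtop M) g"
    unfolding homeomorphic_maps_def by (auto dest: continuous_map_into_fulltopology)
  moreover have "g u = pmap (chart_inv c) u"
    if "u \<in> topspace (subtopology (Euclidean_space m) (snd c ` fst c))" for u
  proof -
    from that obtain x where x: "x \<in> fst c" "u = snd c x" by auto
    moreover have "g (snd c x) = x"
      using g x(1) chart_subset[OF c] unfolding homeomorphic_maps_def by auto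
    ultimately show ?thesis using chart_inv_left[OF c] by (simp add: pmap_inverse_param)
  qed
  ultimately have "continuous_map (subtopology (Euclidean_space m) (snd c ` fst c)) (mtop M) (pmap (chart_inv c))"
    by (rule continuous_map_eq)
  then show "continuous_map (subtopology (Euclidean_space (pdim (chart_inv c))) (pdom (chart_inv c)))
      (mtop M) (pmap (chart_inv c))"
    by simp
  fix c' assume c': "c' \<in> atlas M"
  have eq: "{u \<in> snd c ` fst c. pmap (chart_inv c) u \<in> fst c'} = snd c ` (fst c \<inter> fst c')"
    using chart_inv_left[OF c] by (auto simp: pmap_inverse_param)
  have "smooth_map m (snd c ` (fst c \<inter> fst c')) m (\<lambda>u. snd c' (pmap (chart_inv c) u))"
    by (rule smooth_map_cong[OF chart_image_Int_openin[OF c chart_openin[OF c']] _ chart_transition[OF c c']])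
       (auto simp: pmap_inverse_param)
  then show "smooth_map (pdim (chart_inv c)) {u \<in> pdom (chart_inv c). pmap (chart_inv c) u \<in> fst c'} m
      (\<lambda>u. snd c' (pmap (chart_inv c) u))"
    by (simp add: eq)
qed

lemma pmap_chart_inv: "c \<in> atlas M \<Longrightarrow> x \<in> fst c \<Longrightarrow> pmap (chart_inv c) (snd c x) = x"
  by (simp add: pmap_inverse_param chart_inv_left)


subsection \<open>Velocities and tangent vectors\<close>

lemma velocity_at:
  "c \<in> atlas M \<Longrightarrow> pmap p u \<in> fst c \<Longrightarrow> velocity M p u v c = differential (\<lambda>w. snd c (pmap p w)) u v"
  by (simp add: velocity_def comp_def)

lemma velocity_outside: "\<not> (c \<in> atlas M \<and> pmap p u \<in> fst c) \<Longrightarrow> velocity M p u v c = (\<lambda>i. 0)"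
  by (auto simp: velocity_def)

lemma velocity_reparam:
  assumes p: "p \<in> D" and V: "openin (Euclidean_space n) V"
    and F: "smooth_map n V (pdim p) F" "F ` V \<subseteq> pdom p" and x: "x \<in> V" and v: "v \<in> Rn n"
  shows "velocity M (reparam p n V F) x v = velocity M p (F x) (differential F x v)"
proof
  fix c
  show "velocity M (reparam p n V F) x v c = velocity M p (F x) (differential F x v) c"
  proof (cases "c \<in> atlas M \<and> pmap p (F x) \<in> fst c")
    case True
    then have c: "c \<in> atlas M" and xc: "pmap p (F x) \<in> fst c" by auto
    let ?U = "{u \<in> pdom p. pmap p u \<in> fst c}"
    let ?V = "{x \<in> V. F x \<in> ?U}"
    have U: "openin (Euclidean_space (pdim p)) ?U"
      by (rule plot_preimage_openin[OF p chart_openin[OF c]])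
    have V': "openin (Euclidean_space n) ?V"
      by (rule openin_preimage[OF V smooth_map_continuous[OF V F(1)] smooth_map_image[OF F(1)] U])
    have x': "x \<in> ?V" using x xc F(2) by auto
    have "velocity M (reparam p n V F) x v c = differential (\<lambda>w. snd c (pmap (reparam p n V F) w)) x v"
      using c xc x by (intro velocity_at) (simp_all add: pmap_reparam)
    also have "\<dots> = differential (\<lambda>w. snd c (pmap p (F w))) x v"
      by (rule differential_cong[OF V' _ x' v]) (simp add: pmap_reparam)
    also have "\<dots> = differential (\<lambda>w. snd c (pmap p w)) (F x) (differential F x v)"
      by (rule differential_compose[OF V' U smooth_map_subset[OF V V' _ F(1)] _ plotD(3)[OF p c] x' v]) auto
    also have "\<dots> = velocity M p (F x) (differential F x v) c"
      using c xc by (simp add: velocity_at)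
    finally show ?thesis .
  next
    case False
    then show ?thesis using x by (simp add: velocity_outside pmap_reparam)
  qed
qed

lemma velocity_subparam:
  assumes "p \<in> D" "openin (Euclidean_space (pdim p)) V" "V \<subseteq> pdom p" "x \<in> V" "v \<in> Rn (pdim p)"
  shows "velocity M (subparam p V) x v = velocity M p x v"
  using velocity_reparam[OF assms(1,2) smooth_map_id[OF assms(2)] _ assms(4,5)] assms(3) by simp

text \<open>
  By this factorization, what is known of the inverses of charts is transported to all plots.
\<close>

lemma plot_factors_through_chart:
  assumes p: "p \<in> D" and c: "c \<in> atlas M"
  defines "V \<equiv> {u \<in> pdom p. pmap p u \<in> fst c}"
  shows "openin (Euclidean_space (pdim p)) V"
    and "smooth_map (pdim p) V m (\<lambda>u. snd c (pmap p u))"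
    and "(\<lambda>u. snd c (pmap p u)) ` V \<subseteq> pdom (chart_inv c)"
    and "subparam p V = reparam (chart_inv c) (pdim p) V (\<lambda>u. snd c (pmap p u))"
proof -
  show "openin (Euclidean_space (pdim p)) V"
    unfolding V_def by (rule plot_preimage_openin[OF p chart_openin[OF c]])
  show "smooth_map (pdim p) V m (\<lambda>u. snd c (pmap p u))"
    unfolding V_def by (rule plotD(3)[OF p c])
  show "(\<lambda>u. snd c (pmap p u)) ` V \<subseteq> pdom (chart_inv c)"
    by (auto simp: V_def)
  show "subparam p V = reparam (chart_inv c) (pdim p) V (\<lambda>u. snd c (pmap p u))"
    using pmap_chart_inv[OF c] by (auto simp: V_def reparam_def restrict_def fun_eq_iff)
qed

lemma velocity_coord_in_Rn:
  assumes p: "p \<in> D" and c: "c \<in> atlas M" "pmap p u \<in> fst c" and u: "u \<in> pdom p" and v: "v \<in> Rn (pdim p)"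
  shows "velocity M p u v c \<in> Rn m"
  using differential_in_Rn[OF plot_factors_through_chart(1)[OF p c(1)]
      smooth_map_image[OF plot_factors_through_chart(2)[OF p c(1)]] _ v, of u] c u
  by (simp add: velocity_at)

text \<open>
  Velocities of arbitrary plots are velocities of inverse charts. In particular they transform by the
  differentials of the transition maps, as tangent vectors do.
\<close>

lemma velocity_through_chart:
  assumes p: "p \<in> D" and c: "c \<in> atlas M" "pmap p u \<in> fst c" and u: "u \<in> pdom p" and v: "v \<in> Rn (pdim p)"
  shows "velocity M (chart_inv c) (snd c (pmap p u)) (velocity M p u v c) = velocity M p u v"
proof -
  note f = plot_factors_through_chart[OF p c(1)]
  have u': "u \<in> {u \<in> pdom p. pmap p u \<in> fst c}" using u c(2) by simp
  have "velocity M p u v = velocity M (subparam p {u \<in> pdom p. pmap p u \<in> fst c}) u v"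
    by (rule velocity_subparam[OF p f(1) _ u' v, symmetric]) auto
  also have "\<dots> = velocity M (reparam (chart_inv c) (pdim p) {u \<in> pdom p. pmap p u \<in> fst c}
      (\<lambda>u. snd c (pmap p u))) u v"
    using f(4) by simp
  also have "\<dots> = velocity M (chart_inv c) (snd c (pmap p u)) (differential (\<lambda>u. snd c (pmap p u)) u v)"
    using velocity_reparam[OF chart_inv_plot[OF c(1)] f(1) _ f(3) u' v] f(2) by simp
  also have "\<dots> = velocity M (chart_inv c) (snd c (pmap p u)) (velocity M p u v c)"
    by (simp only: velocity_at[OF c])
  finally show ?thesis by (rule sym)
qed

lemma velocity_chart_inv:
  assumes c: "c \<in> atlas M" "x \<in> fst c" and c': "c' \<in> atlas M" "x \<in> fst c'" and v: "v \<in> Rn m"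
  shows "velocity M (chart_inv c) (snd c x) v c' = differential (snd c' \<circ> inv_into (fst c) (snd c)) (snd c x) v"
proof -
  have "velocity M (chart_inv c) (snd c x) v c' = differential (\<lambda>w. snd c' (pmap (chart_inv c) w)) (snd c x) v"
    using c c' by (intro velocity_at) (simp_all add: pmap_chart_inv)
  also have "\<dots> = differential (snd c' \<circ> inv_into (fst c) (snd c)) (snd c x) v"
    by (rule differential_cong[OF chart_image_openin[OF c(1)] _ _ v])
       (use c in \<open>auto simp: pmap_inverse_param\<close>)
  finally show ?thesis .
qed

lemma tangent_space_iff:
  "t \<in> tangent_space M x \<longleftrightarrow> (\<forall>c. \<not> (c \<in> atlas M \<and> x \<in> fst c) \<longrightarrow> t c = (\<lambda>i. 0)) \<and>
     (\<forall>c\<in>atlas M. x \<in> fst c \<longrightarrow> t c \<in> Rn m) \<and>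
     (\<forall>c\<in>atlas M. \<forall>c'\<in>atlas M. x \<in> fst c \<inter> fst c' \<longrightarrow>
        t c' = differential (snd c' \<circ> inv_into (fst c) (snd c)) (snd c x) (t c))"
  by (simp add: tangent_space_def case_prod_beta)

lemma tangent_spaceD:
  assumes t: "t \<in> tangent_space M x"
  shows "\<not> (c \<in> atlas M \<and> x \<in> fst c) \<Longrightarrow> t c = (\<lambda>i. 0)"
    and "c \<in> atlas M \<Longrightarrow> x \<in> fst c \<Longrightarrow> t c \<in> Rn m"
    and "c \<in> atlas M \<Longrightarrow> x \<in> fst c \<Longrightarrow> c' \<in> atlas M \<Longrightarrow> x \<in> fst c' \<Longrightarrow>
      t c' = differential (snd c' \<circ> inv_into (fst c) (snd c)) (snd c x) (t c)"
  using t unfolding tangent_space_iff by blast+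

lemma tangent_spaceI:
  assumes "\<And>c. \<not> (c \<in> atlas M \<and> x \<in> fst c) \<Longrightarrow> t c = (\<lambda>i. 0)"
    and "\<And>c. c \<in> atlas M \<Longrightarrow> x \<in> fst c \<Longrightarrow> t c \<in> Rn m"
    and "\<And>c c'. c \<in> atlas M \<Longrightarrow> x \<in> fst c \<Longrightarrow> c' \<in> atlas M \<Longrightarrow> x \<in> fst c' \<Longrightarrow>
      t c' = differential (snd c' \<circ> inv_into (fst c) (snd c)) (snd c x) (t c)"
  shows "t \<in> tangent_space M x"
  using assms unfolding tangent_space_iff by blast

lemma velocity_in_tangent_space:
  assumes p: "p \<in> D" and u: "u \<in> pdom p" and v: "v \<in> Rn (pdim p)"
  shows "velocity M p u v \<in> tangent_space M (pmap p u)"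
proof (rule tangent_spaceI)
  fix c c' assume c: "c \<in> atlas M" "pmap p u \<in> fst c" and c': "c' \<in> atlas M" "pmap p u \<in> fst c'"
  show "velocity M p u v c' =
      differential (snd c' \<circ> inv_into (fst c) (snd c)) (snd c (pmap p u)) (velocity M p u v c)"
    using velocity_chart_inv[OF c c' velocity_coord_in_Rn[OF p c u v]]
      velocity_through_chart[OF p c u v] by simp
qed (rule velocity_outside velocity_coord_in_Rn[OF p _ _ u v]; assumption)+

lemma tangent_through_chart:
  assumes t: "t \<in> tangent_space M x" and c: "c \<in> atlas M" "x \<in> fst c"
  shows "velocity M (chart_inv c) (snd c x) (t c) = t"
proof
  fix c'
  show "velocity M (chart_inv c) (snd c x) (t c) c' = t c'"
  proof (cases "c' \<in> atlas M \<and> x \<in> fst c'")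
    case True
    then show ?thesis
      using velocity_chart_inv[OF c, of c' "t c"] tangent_spaceD(3)[OF t c, of c']
        tangent_spaceD(2)[OF t c] by simp
  next
    case False
    then show ?thesis
      using tangent_spaceD(1)[OF t False] velocity_outside[of c'] c by (auto simp: pmap_chart_inv)
  qed
qed

lemma velocity_linear:
  assumes p: "p \<in> D" and u: "u \<in> pdom p" and v: "v \<in> Rn (pdim p)" "w \<in> Rn (pdim p)"
  shows "velocity M p u (vec_lc v a w) = tvec_lc (velocity M p u v) a (velocity M p u w)"
proof
  fix c
  show "velocity M p u (vec_lc v a w) c = tvec_lc (velocity M p u v) a (velocity M p u w) c"
  proof (cases "c \<in> atlas M \<and> pmap p u \<in> fst c")
    case True
    then have c: "c \<in> atlas M" "pmap p u \<in> fst c" by auto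
    show ?thesis
      using differential_linear[OF plot_factors_through_chart(1,2)[OF p c(1)] _ v, of u a] c u
      by (simp add: velocity_at tvec_lc_def vec_lc_def)
  qed (simp add: velocity_outside tvec_lc_def)
qed

text \<open>
  A tangent vector is the velocity of its coordinate vector under an inverse chart, and velocities depend
  linearly on the vector.
\<close>

lemma tangent_lc_in_tangent_space:
  assumes x: "x \<in> points M" and t: "t \<in> tangent_space M x" "s \<in> tangent_space M x"
  shows "tvec_lc t a s \<in> tangent_space M x"
proof -
  obtain c where c: "c \<in> atlas M" "x \<in> fst c" using chart_at[OF x] by blast
  have tc: "t c \<in> Rn m" "s c \<in> Rn m" using tangent_spaceD(2)[OF _ c] t by auto
  have "velocity M (chart_inv c) (snd c x) (vec_lc (t c) a (s c)) = tvec_lc t a s"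
    using velocity_linear[OF chart_inv_plot[OF c(1)], of "snd c x" "t c" "s c" a] tc c
      tangent_through_chart[OF t(1) c] tangent_through_chart[OF t(2) c] by simp
  then show ?thesis
    using velocity_in_tangent_space[OF chart_inv_plot[OF c(1)], of "snd c x" "vec_lc (t c) a (s c)"]
      vec_lc_in_Rn[OF tc] c by (simp add: pmap_chart_inv)
qed


subsection \<open>Ordinary and diffeological forms\<close>

lemma mform_pullback_reparam:
  assumes p: "p \<in> D" and V: "openin (Euclidean_space n) V"
    and F: "smooth_map n V (pdim p) F" "F ` V \<subseteq> pdom p"
  shows "mform_pullback M (reparam p n V F) \<alpha> = form_pullback n V F (mform_pullback M p \<alpha>)"
proof (intro ext)
  fix x vs
  show "mform_pullback M (reparam p n V F) \<alpha> x vs = form_pullback n V F (mform_pullback M p \<alpha>) x vs"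
  proof (cases "x \<in> V \<and> set vs \<subseteq> Rn n")
    case True
    then have x: "x \<in> V" and vs: "set vs \<subseteq> Rn n" by auto
    have "map (velocity M (reparam p n V F) x) vs = map (velocity M p (F x)) (map (differential F x) vs)"
      using velocity_reparam[OF p V F x] vs by auto
    moreover have "set (map (differential F x) vs) \<subseteq> Rn (pdim p)"
      using differential_in_Rn[OF V smooth_map_image[OF F(1)] x] vs by auto
    moreover have "F x \<in> pdom p" using F(2) x by blast
    ultimately show ?thesis
      using x vs by (simp add: mform_pullback_apply form_pullback_apply pmap_reparam del: map_map map_eq_conv)
  qed (auto simp: mform_pullback_def form_pullback_def)
qed

text \<open>
  Smoothness of an ordinary form is a condition in charts. It passes to the pullback by a plot because the
  plot factors locally through an inverse chart.
\<close>

lemma mform_to_dform_in_dforms: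
  assumes \<alpha>: "\<alpha> \<in> mforms M k"
  shows "mform_to_dform M \<alpha> \<in> dforms D k"
proof (rule dformsI)
  fix p assume p: "p \<in> D"
  show "is_form (pdim p) (pdom p) k (mform_to_dform M \<alpha> p)"
  proof (rule is_form_local[OF plot_dom_openin[OF p]])
    fix u assume u: "u \<in> pdom p"
    obtain c where c: "c \<in> atlas M" "pmap p u \<in> fst c"
      using chart_at[OF plot_in_points[OF p u]] by blast
    let ?V = "{u \<in> pdom p. pmap p u \<in> fst c}"
    note f = plot_factors_through_chart[OF p c(1)]
    have "is_form m (snd c ` fst c) k (mform_pullback M (chart_inv c) \<alpha>)"
      using \<alpha> c(1) by (simp add: mforms_def mform_in_chart_def)
    then have form: "is_form (pdim p) ?V k (mform_pullback M (subparam p ?V) \<alpha>)"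
      unfolding f(4) using f(2,3)
      by (subst mform_pullback_reparam[OF chart_inv_plot[OF c(1)] f(1)])
         (auto intro!: is_form_pullback[OF f(1) chart_image_openin[OF c(1)]])
    have "mform_pullback M (subparam p ?V) \<alpha> = form_pullback (pdim p) ?V (\<lambda>x. x) (mform_pullback M p \<alpha>)"
      by (rule mform_pullback_reparam[OF p f(1) smooth_map_id[OF f(1)]]) auto
    then have "mform_pullback M p \<alpha> y = mform_pullback M (subparam p ?V) \<alpha> y" if "y \<in> ?V" for y
      using that by (auto simp: form_pullback_def mform_pullback_def fun_eq_iff map_idI)
    then show "\<exists>V \<eta>. openin (Euclidean_space (pdim p)) V \<and> u \<in> V \<and> V \<subseteq> pdom p \<and>
        is_form (pdim p) V k \<eta> \<and> (\<forall>y\<in>V. mform_to_dform M \<alpha> p y = \<eta> y)"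
      using f(1) form u c(2) p
      by (intro exI[of _ ?V] exI[of _ "mform_pullback M (subparam p ?V) \<alpha>"]) (auto simp: mform_to_dform_def)
  qed (use p in \<open>simp add: mform_to_dform_def mform_pullback_def\<close>)
  fix n V F assume F: "openin (Euclidean_space n) V" "smooth_map n V (pdim p) F" "F ` V \<subseteq> pdom p"
  show "mform_to_dform M \<alpha> (reparam p n V F) = form_pullback n V F (mform_to_dform M \<alpha> p)"
    using mform_pullback_reparam[OF p F] plot_reparam[OF p F] p by (simp add: mform_to_dform_def)
qed (simp add: mform_to_dform_def)

lemma dform_in_chart:
  assumes \<alpha>: "\<alpha> \<in> dforms D k" and p: "p \<in> D" and u: "u \<in> pdom p"
    and c: "c \<in> atlas M" "pmap p u \<in> fst c" and vs: "set vs \<subseteq> Rn (pdim p)"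
  shows "\<alpha> p u vs = \<alpha> (chart_inv c) (snd c (pmap p u)) (map (\<lambda>v. velocity M p u v c) vs)"
proof -
  let ?V = "{u \<in> pdom p. pmap p u \<in> fst c}"
  note f = plot_factors_through_chart[OF p c(1)]
  have u': "u \<in> ?V" using u c by simp
  have "\<alpha> p u vs = \<alpha> (subparam p ?V) u vs"
    by (rule dforms_subparam[OF \<alpha> p f(1) _ u', symmetric]) auto
  also have "\<dots> = form_pullback (pdim p) ?V (\<lambda>u. snd c (pmap p u)) (\<alpha> (chart_inv c)) u vs"
    using dforms_reparam[OF \<alpha> chart_inv_plot[OF c(1)] f(1) _ f(3)] f(2) by (simp add: f(4))
  also have "\<dots> = \<alpha> (chart_inv c) (snd c (pmap p u)) (map (differential (\<lambda>u. snd c (pmap p u)) u) vs)"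
    by (rule form_pullback_apply[OF u' vs])
  finally show ?thesis using c by (simp add: velocity_at)
qed

text \<open>
  The ordinary form that induces a given diffeological form: its value at \<open>x\<close> is computed from the plot that
  inverts some chart at \<open>x\<close>.
\<close>

definition mform_of :: "nat \<Rightarrow> 'a dform \<Rightarrow> 'a mform" where
  "mform_of k \<alpha> = (\<lambda>x ts. if x \<in> points M \<and> length ts = k \<and> set ts \<subseteq> tangent_space M x
     then let c = SOME c. c \<in> atlas M \<and> x \<in> fst c in \<alpha> (chart_inv c) (snd c x) (map (\<lambda>t. t c) ts)
     else 0)"

text \<open>
  Independence of the chart: the inverses of two charts differ by a transition map, under which
  diffeological forms are natural and tangent vectors transform.
\<close>

lemma mform_of_chart:
  assumes \<alpha>: "\<alpha> \<in> dforms D k" and c: "c \<in> atlas M" "x \<in> fst c"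
    and ts: "length ts = k" "set ts \<subseteq> tangent_space M x"
  shows "mform_of k \<alpha> x ts = \<alpha> (chart_inv c) (snd c x) (map (\<lambda>t. t c) ts)"
proof -
  define c' where "c' = (SOME c. c \<in> atlas M \<and> x \<in> fst c)"
  have c': "c' \<in> atlas M" "x \<in> fst c'"
    using someI[of "\<lambda>c. c \<in> atlas M \<and> x \<in> fst c" c] c by (auto simp: c'_def)
  have "mform_of k \<alpha> x ts = \<alpha> (chart_inv c') (snd c' x) (map (\<lambda>t. t c') ts)"
    using chart_subset[OF c(1)] c(2) ts by (auto simp: mform_of_def c'_def Let_def)
  also have "\<dots> = \<alpha> (chart_inv c) (snd c x)
      (map (\<lambda>v. velocity M (chart_inv c') (snd c' x) v c) (map (\<lambda>t. t c') ts))"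
    using dform_in_chart[OF \<alpha> chart_inv_plot[OF c'(1)], of "snd c' x" c "map (\<lambda>t. t c') ts"] c c' ts
      tangent_spaceD(2)[OF _ c'] by (auto simp: pmap_chart_inv)
  also have "map (\<lambda>v. velocity M (chart_inv c') (snd c' x) v c) (map (\<lambda>t. t c') ts) = map (\<lambda>t. t c) ts"
    using tangent_through_chart[OF _ c'] ts(2) by auto
  finally show ?thesis .
qed

lemma mform_pullback_mform_of:
  assumes \<alpha>: "\<alpha> \<in> dforms D k" and p: "p \<in> D"
  shows "mform_pullback M p (mform_of k \<alpha>) = \<alpha> p"
proof (intro ext)
  fix u vs
  show "mform_pullback M p (mform_of k \<alpha>) u vs = \<alpha> p u vs"
  proof (cases "u \<in> pdom p \<and> length vs = k \<and> set vs \<subseteq> Rn (pdim p)")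
    case True
    then have u: "u \<in> pdom p" and vs: "length vs = k" "set vs \<subseteq> Rn (pdim p)" by auto
    obtain c where c: "c \<in> atlas M" "pmap p u \<in> fst c"
      using chart_at[OF plot_in_points[OF p u]] by blast
    have "set (map (velocity M p u) vs) \<subseteq> tangent_space M (pmap p u)"
      using velocity_in_tangent_space[OF p u] vs by auto
    then show ?thesis
      using mform_of_chart[OF \<alpha> c, of "map (velocity M p u) vs"] dform_in_chart[OF \<alpha> p u c vs(2)] u vs
      by (simp add: mform_pullback_apply comp_def)
  next
    case False
    then show ?thesis
      using is_form_eq_0[OF dforms_is_form[OF \<alpha> p] False] by (auto simp: mform_pullback_def mform_of_def)
  qed
qed

lemma mform_of_in_mforms:
  assumes \<alpha>: "\<alpha> \<in> dforms D k"
  shows "mform_of k \<alpha> \<in> mforms M k"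
  unfolding mforms_def
proof (intro CollectI conjI allI impI ballI)
  fix x ts assume "mform_of k \<alpha> x ts \<noteq> 0"
  then show "x \<in> points M" "length ts = k" "set ts \<subseteq> tangent_space M x"
    by (auto simp: mform_of_def split: if_splits)
next
  fix c assume c: "c \<in> atlas M"
  show "is_form m (snd c ` fst c) k (mform_in_chart M c (mform_of k \<alpha>))"
    using mform_pullback_mform_of[OF \<alpha> chart_inv_plot[OF c]] dforms_is_form[OF \<alpha> chart_inv_plot[OF c]]
    by (simp add: mform_in_chart_def)
next
  fix x assume x: "x \<in> points M"
  obtain c where c: "c \<in> atlas M" "x \<in> fst c" using chart_at[OF x] by blast
  have "alternating_multilinear vec_lc (Rn m) k (\<alpha> (chart_inv c) (snd c x))"
    using is_form_multilinear[OF dforms_is_form[OF \<alpha> chart_inv_plot[OF c(1)]], of "snd c x"] c by simp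
  then show "alternating_multilinear tvec_lc (tangent_space M x) k (mform_of k \<alpha> x)"
  proof (rule alternating_multilinear_map)
    show "t c \<in> Rn m" if "t \<in> tangent_space M x" for t by (rule tangent_spaceD(2)[OF that c])
    show "tvec_lc t a s \<in> tangent_space M x \<and> tvec_lc t a s c = vec_lc (t c) a (s c)"
      if "t \<in> tangent_space M x" "s \<in> tangent_space M x" for t a s
      using tangent_lc_in_tangent_space[OF x that] by (simp add: tvec_lc_def vec_lc_def)
    show "mform_of k \<alpha> x ts = \<alpha> (chart_inv c) (snd c x) (map (\<lambda>t. t c) ts)"
      if "set ts \<subseteq> tangent_space M x" "length ts = k" for ts
      by (rule mform_of_chart[OF \<alpha> c that(2,1)])
  qed
qed

lemma mform_to_dform_mform_of:
  assumes \<alpha>: "\<alpha> \<in> dforms D k"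
  shows "mform_to_dform M (mform_of k \<alpha>) = \<alpha>"
  using mform_pullback_mform_of[OF \<alpha>] dforms_outside[OF \<alpha>] by (auto simp: mform_to_dform_def fun_eq_iff)


subsection \<open>Basic forms in coordinates\<close>

text \<open>
  The conditions for a basic form, for one vector field, at a point given in coordinates. They refer to the
  diffeological form alone, through its values on inverse charts.
\<close>

definition basic_at :: "'a dform \<Rightarrow> ('a \<Rightarrow> 'a tvec) \<Rightarrow> 'a chart \<Rightarrow> rvec \<Rightarrow> bool" where
  "basic_at \<alpha> X c u \<longleftrightarrow> (\<forall>vs. set vs \<subseteq> Rn m \<longrightarrow>
     \<alpha> (chart_inv c) u (coord_field c X u # vs) = 0 \<and>
     form_lie (coord_field c X) (\<alpha> (chart_inv c)) u vs = 0)"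

lemma local_sectionD:
  assumes "local_section M \<Delta> N X"
  shows "openin (mtop M) N" "\<And>y. y \<in> N \<Longrightarrow> X y \<in> tangent_space M y" "\<And>y. y \<in> N \<Longrightarrow> X y \<in> \<Delta> y"
    "\<And>c. c \<in> atlas M \<Longrightarrow> smooth_map m (snd c ` (fst c \<inter> N)) m (coord_field c X)"
  using assms by (simp_all add: local_section_def local_vector_field_def coord_field_def[abs_def] case_prod_beta)

lemma local_sectionI:
  assumes "openin (mtop M) N" "\<And>y. y \<in> N \<Longrightarrow> X y \<in> tangent_space M y" "\<And>y. y \<in> N \<Longrightarrow> X y \<in> \<Delta> y"
    "\<And>c. c \<in> atlas M \<Longrightarrow> smooth_map m (snd c ` (fst c \<inter> N)) m (coord_field c X)"
  shows "local_section M \<Delta> N X"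
  using assms by (simp_all add: local_section_def local_vector_field_def coord_field_def[abs_def] case_prod_beta)

text \<open>
  A vector of the field is the velocity of its coordinate vector under an inverse chart, so contraction with
  the field can be computed in any chart.
\<close>

lemma basic_forms_eq:
  "basic_forms M \<F> k = {\<alpha> \<in> dforms D k. \<forall>N X. local_section M (foliation_distribution M \<F>) N X \<longrightarrow>
     (\<forall>c\<in>atlas M. \<forall>u\<in>snd c ` (fst c \<inter> N). basic_at \<alpha> X c u)}"
    (is "_ = ?B")
proof (intro equalityI subsetI)
  fix \<alpha> assume "\<alpha> \<in> basic_forms M \<F> k"
  then obtain a where a: "a \<in> basic_mforms M \<F> k" and \<alpha>: "\<alpha> = mform_to_dform M a"
    by (auto simp: basic_forms_def)
  have af: "a \<in> mforms M k" using a by (simp add: basic_mforms_def)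
  have "basic_at \<alpha> X c (snd c x)"
    if X: "local_section M (foliation_distribution M \<F>) N X" and c: "c \<in> atlas M" and x: "x \<in> fst c" "x \<in> N"
    for N X c x
    unfolding basic_at_def
  proof (intro allI impI conjI)
    fix vs assume vs: "set vs \<subseteq> Rn m"
    have \<alpha>c: "\<alpha> (chart_inv c) = mform_in_chart M c a"
      using chart_inv_plot[OF c] by (simp add: \<alpha> mform_to_dform_def mform_in_chart_def)
    have Xc: "coord_field c X (snd c x) = X x c"
      using chart_inv_left[OF c x(1)] by (simp add: coord_field_def)
    have t: "X x \<in> tangent_space M x" using local_sectionD(2)[OF X x(2)] .
    have "a x (X x # map (velocity M (chart_inv c) (snd c x)) vs) = 0"
      using a X x(2) by (auto simp: basic_mforms_def interior_product_def)
    then show "\<alpha> (chart_inv c) (snd c x) (coord_field c X (snd c x) # vs) = 0"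
      using c x vs tangent_spaceD(2)[OF t c x(1)] tangent_through_chart[OF t c x(1)]
      by (simp add: \<alpha>c Xc mform_in_chart_def mform_pullback_apply pmap_chart_inv)
    have "lie_derivative_vanishes M N X a"
      using a X by (auto simp: basic_mforms_def)
    then show "form_lie (coord_field c X) (\<alpha> (chart_inv c)) (snd c x) vs = 0"
      using c x vs unfolding lie_derivative_vanishes_def \<alpha>c coord_field_def
      by (cases c) fastforce
  qed
  then show "\<alpha> \<in> ?B"
    using mform_to_dform_in_dforms[OF af] \<alpha> by auto
next
  fix \<alpha> assume "\<alpha> \<in> ?B"
  then have \<alpha>: "\<alpha> \<in> dforms D k" and
    basic: "\<And>N X c x. local_section M (foliation_distribution M \<F>) N X \<Longrightarrow> c \<in> atlas M \<Longrightarrow> x \<in> fst c \<Longrightarrow>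
      x \<in> N \<Longrightarrow> basic_at \<alpha> X c (snd c x)"
    by auto
  let ?a = "mform_of k \<alpha>"
  have a: "?a \<in> mforms M k" by (rule mform_of_in_mforms[OF \<alpha>])
  have "?a x (X x # ts) = 0"
    if X: "local_section M (foliation_distribution M \<F>) N X" and x: "x \<in> N" for N X x ts
  proof (cases "length (X x # ts) = k \<and> set (X x # ts) \<subseteq> tangent_space M x \<and> x \<in> points M")
    case True
    then obtain c where c: "c \<in> atlas M" "x \<in> fst c" using chart_at by blast
    have "coord_field c X (snd c x) = X x c"
      using chart_inv_left[OF c] by (simp add: coord_field_def)
    moreover have "set (map (\<lambda>t. t c) ts) \<subseteq> Rn m"
      using True tangent_spaceD(2)[OF _ c] by auto
    ultimately have "\<alpha> (chart_inv c) (snd c x) (X x c # map (\<lambda>t. t c) ts) = 0"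
      using basic[OF X c x] unfolding basic_at_def by metis
    then show ?thesis
      using mform_of_chart[OF \<alpha> c, of "X x # ts"] True by simp
  qed (auto simp: mform_of_def)
  moreover have "lie_derivative_vanishes M N X ?a"
    if X: "local_section M (foliation_distribution M \<F>) N X" for N X
    unfolding lie_derivative_vanishes_def
  proof (clarify)
    fix U \<phi> x vs assume c: "(U, \<phi>) \<in> atlas M" and x: "x \<in> U" "x \<in> N" and vs: "set vs \<subseteq> Rn m"
    have "mform_in_chart M (U, \<phi>) ?a = \<alpha> (chart_inv (U, \<phi>))"
      using mform_pullback_mform_of[OF \<alpha> chart_inv_plot[OF c]] by (simp add: mform_in_chart_def)
    then show "form_lie (\<lambda>w. X (inv_into U \<phi> w) (U, \<phi>)) (mform_in_chart M (U, \<phi>) ?a) (\<phi> x) vs = 0"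
      using basic[OF X c, of x] x vs unfolding basic_at_def coord_field_def by simp
  qed
  ultimately have "?a \<in> basic_mforms M \<F> k"
    using a by (simp add: basic_mforms_def interior_product_def)
  then show "\<alpha> \<in> basic_forms M \<F> k"
    using mform_to_dform_mform_of[OF \<alpha>] unfolding basic_forms_def by (metis imageI)
qed

end


section \<open>Lie derivatives in coordinates\<close>

lemma form_lie_cong:
  assumes U: "openin (Euclidean_space n) U" and eq: "\<And>y. y \<in> U \<Longrightarrow> \<omega> y = \<eta> y" "\<And>y. y \<in> U \<Longrightarrow> X y = Y y"
    and x: "x \<in> U" and X: "X x \<in> Rn n" and vs: "set vs \<subseteq> Rn n"
  shows "form_lie X \<omega> x vs = form_lie Y \<eta> x vs"
proof -
  have "dir_deriv (\<lambda>y. \<omega> y vs) x (X x) = dir_deriv (\<lambda>y. \<eta> y vs) x (Y x)"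
    using dir_deriv_cong[OF U _ x X, of "\<lambda>y. \<omega> y vs" "\<lambda>y. \<eta> y vs"] eq x by simp
  moreover have "differential X x (vs ! i) = differential Y x (vs ! i)" if "i < length vs" for i
    using vs that by (intro differential_cong[OF U eq(2) x]) auto
  ultimately show ?thesis
    unfolding form_lie_def using eq(1)[OF x] by simp
qed

text \<open>
  The Lie derivative involves the first derivatives of the field, so the field has to vanish near \<open>x\<close>.
\<close>

lemma form_lie_zero_field:
  assumes U: "openin (Euclidean_space n) U" and \<omega>: "alternating_multilinear vec_lc (Rn n) (length vs) (\<omega> x)"
    and X: "\<And>y. y \<in> U \<Longrightarrow> X y = (\<lambda>i. 0)" and x: "x \<in> U" and vs: "set vs \<subseteq> Rn n"
  shows "form_lie X \<omega> x vs = 0"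
proof -
  have "\<omega> x (vs[i := differential X x (vs ! i)]) = 0" if i: "i < length vs" for i
  proof -
    have "vs ! i \<in> Rn n" using i vs by auto
    then have "differential X x (vs ! i) = differential (\<lambda>y i. 0) x (vs ! i)"
      by (intro differential_cong[OF U X x])
    also have "\<dots> = (\<lambda>i. 0)" by (simp add: differential_def dir_deriv_def)
    finally have "vs[i := differential X x (vs ! i)] = take i vs @ (\<lambda>i. 0) # drop (Suc i) vs"
      using i by (simp add: upd_conv_take_nth_drop)
    then show ?thesis
      using alternating_multilinear_zero[OF \<omega>, of "take i vs" "drop (Suc i) vs"] i vs
        set_take_subset[of i vs] set_drop_subset[of "Suc i" vs]
      by auto
  qed
  then show ?thesis using X[OF x] by (simp add: form_lie_def)
qed

text \<open>
  By the chain rule the directional derivative is a sum of products of smooth functions; in the other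
  summands a smooth form is evaluated on smooth vector fields.
\<close>

lemma smooth_fun_form_lie:
  assumes U: "openin (Euclidean_space n) U" and V: "openin (Euclidean_space n) V" "U \<subseteq> V"
    and \<omega>: "is_form n V k \<omega>" and X: "smooth_map n U n X" and vs: "length vs = k" "set vs \<subseteq> Rn n"
  shows "smooth_fun n U (\<lambda>x. form_lie X \<omega> x vs)"
proof -
  have id: "smooth_map n U n (\<lambda>x. x)" "(\<lambda>x. x) ` U \<subseteq> V"
    using smooth_map_id[OF U] V(2) by auto
  have const: "smooth_map n U n (\<lambda>x. v)" if "v \<in> Rn n" for v
    using that smooth_fun_const[OF U] by (auto simp: smooth_map_def)
  have \<omega>U: "smooth_fun n U (\<lambda>x. \<omega> x vs)"
    by (rule smooth_fun_subset[OF V(1) U V(2) is_form_smooth[OF V(1) \<omega>]])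
  have "smooth_fun n U (\<lambda>x. \<Sum>i<n. pd i (\<lambda>x. \<omega> x vs) x * X x i)"
    by (intro smooth_fun_sum[OF U] smooth_fun_mult[OF U] smooth_map_component[OF U X] smooth_fun_pd[OF U \<omega>U]) auto
  then have 1: "smooth_fun n U (\<lambda>x. dir_deriv (\<lambda>y. \<omega> y vs) x (X x))"
  proof (rule smooth_fun_cong[OF U, rotated])
    fix x assume x: "x \<in> U"
    then have "X x \<in> Rn n" using smooth_map_image[OF X] by blast
    then show "(\<Sum>i<n. pd i (\<lambda>x. \<omega> x vs) x * X x i) = dir_deriv (\<lambda>y. \<omega> y vs) x (X x)"
      using dir_deriv_eq_sum[OF U \<omega>U x] by simp
  qed
  have 2: "smooth_fun n U (\<lambda>x. \<omega> x (vs[i := differential X x (vs ! i)]))" if i: "i < k" for i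
  proof -
    define ws where "ws = (map (\<lambda>v x. v) vs)[i := \<lambda>x. differential X x (vs ! i)]"
    have "smooth_map n U n w" if "w \<in> set ws" for w
    proof -
      have "w \<in> insert (\<lambda>x. differential X x (vs ! i)) (set (map (\<lambda>v x. v) vs))"
        using that set_update_subset_insert unfolding ws_def by fast
      moreover have "vs ! i \<in> Rn n" using i vs by auto
      ultimately show ?thesis
        using const smooth_map_differential[OF U X] vs(2) by auto
    qed
    then have "smooth_fun n U (\<lambda>x. \<omega> x (map (\<lambda>w. w x) ws @ []))"
      using vs(1) by (intro smooth_fun_form_eval[OF U V(1) \<omega> id]) (auto simp: ws_def)
    moreover have "map (\<lambda>w. w x) ws = vs[i := differential X x (vs ! i)]" for x
      by (simp add: ws_def map_update comp_def)
    ultimately show ?thesis by simp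
  qed
  have 3: "smooth_fun n U (\<lambda>x. \<Sum>i<k. \<omega> x (vs[i := differential X x (vs ! i)]))"
    using 2 by (intro smooth_fun_sum[OF U]) auto
  show ?thesis
    unfolding form_lie_def vs(1) by (rule smooth_fun_add[OF U 1 3])
qed


section \<open>Leaves\<close>

lemma submanifold_chartD:
  assumes "submanifold_chart M S n c"
  shows "openin (D_topology S (subset_diffeology S (manifold_diffeology M))) (fst c)"
    and "openin (Euclidean_space n) (snd c ` fst c)"
    and "D_diffeo (fst c) (subset_diffeology (fst c) (subset_diffeology S (manifold_diffeology M)))
       (snd c ` fst c) (euclidean_diffeology n (snd c ` fst c)) (snd c)"
  using assms by (auto simp: submanifold_chart_def Let_def case_prod_beta)

lemma submanifold_chart_subset: "submanifold_chart M S n c \<Longrightarrow> fst c \<subseteq> S"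
  using submanifold_chartD(1)[of M S n c] by (simp add: openin_D_topology D_open_def)

lemma submanifold_chart_inj: "submanifold_chart M S n c \<Longrightarrow> inj_on (snd c) (fst c)"
  using submanifold_chartD(3)[of M S n c] by (auto simp: D_diffeo_def bij_betw_def)

lemma pmap_submanifold_chart:
  "submanifold_chart M S n c \<Longrightarrow> x \<in> fst c \<Longrightarrow> pmap (inverse_param n c) (snd c x) = x"
  using inv_into_f_f[OF submanifold_chart_inj] by (simp add: pmap_inverse_param)

text \<open>
  The identity of the image of a chart is a plot, and the inverse of the chart is diffeologically smooth.
\<close>

lemma submanifold_chart_plot:
  assumes c: "submanifold_chart M S n c"
  shows "inverse_param n c \<in> manifold_diffeology M"
proof -
  let ?V = "snd c ` fst c"
  have V: "openin (Euclidean_space n) ?V" by (rule submanifold_chartD(2)[OF c])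
  let ?q = "Param n ?V (restrict (\<lambda>x. x) ?V)"
  have "smooth_map n ?V n (restrict (\<lambda>x. x) ?V)"
    by (rule smooth_map_cong[OF V _ smooth_map_id[OF V]]) simp
  then have "?q \<in> euclidean_diffeology n ?V"
    using V by (auto simp: euclidean_diffeology_def is_param_def)
  then have "param_compose (inv_into (fst c) (snd c)) ?q \<in> manifold_diffeology M"
    using submanifold_chartD(3)[OF c] by (auto simp: D_diffeo_def D_smooth_def subset_diffeology_def)
  moreover have "param_compose (inv_into (fst c) (snd c)) ?q = inverse_param n c"
    by (auto simp: param_compose_def inverse_param_def restrict_def fun_eq_iff)
  ultimately show ?thesis by simp
qed

lemma Rn_0: "Rn 0 = {\<lambda>i. 0}"
  by (auto simp: Rn_iff fun_eq_iff)

text \<open>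
  The charts of a zero-dimensional leaf are single points, so its D-topology is discrete. Being
  connected, the leaf is a point.
\<close>

lemma zero_dimensional_leaf:
  assumes L: "connected_leaf M L" "weakly_embedded M 0 L" and x: "x \<in> L"
  shows "L = {x}"
proof -
  let ?T = "D_topology L (subset_diffeology L (manifold_diffeology M))"
  have op: "openin ?T {y}" if y: "y \<in> L" for y
  proof -
    obtain c where c: "submanifold_chart M L 0 c" "y \<in> fst c"
      using L(2) y by (auto simp: weakly_embedded_def diffeological_submanifold_def)
    have im: "snd c ` fst c \<subseteq> {\<lambda>i. 0}"
      using openin_subset_Rn[OF submanifold_chartD(2)[OF c(1)]] unfolding Rn_0 .
    have "z = y" if z: "z \<in> fst c" for z
    proof (rule inj_onD[OF submanifold_chart_inj[OF c(1)] _ z c(2)])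
      have "snd c z \<in> {\<lambda>i. 0}" "snd c y \<in> {\<lambda>i. 0}" using im z c(2) by blast+
      then show "snd c z = snd c y" by simp
    qed
    then have "fst c = {y}" using c(2) by blast
    then show ?thesis using submanifold_chartD(1)[OF c(1)] by simp
  qed
  have "openin ?T (\<Union>y\<in>A. {y})" if "A \<subseteq> L" for A
    using that by (intro openin_Union) (use op in blast)
  then have disc: "openin ?T A" if "A \<subseteq> L" for A using that by simp
  have "topspace ?T = L"
  proof
    show "topspace ?T \<subseteq> L"
      using openin_topspace[of ?T] unfolding openin_D_topology D_open_def by simp
    show "L \<subseteq> topspace ?T" by (rule openin_subset[OF disc]) simp
  qed
  then have "closedin ?T {x}" "openin ?T {x}"
    using x disc[of "L - {x}"] disc[of "{x}"] by (auto simp: closedin_def)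
  then have "{x} = {} \<or> {x} = topspace ?T"
    using L(1) unfolding connected_leaf_def connected_space_clopen_in by blast
  with \<open>topspace ?T = L\<close> show ?thesis by simp
qed

lemma openin_singleton_Euclidean:
  assumes "openin (Euclidean_space n) {a}"
  shows "n = 0"
proof (rule ccontr)
  assume "n \<noteq> 0"
  then have n: "0 < n" by simp
  obtain e where e: "e > 0" "\<And>y. y \<in> Rn n \<Longrightarrow> (\<And>i. i < n \<Longrightarrow> \<bar>y i - a i\<bar> < e) \<Longrightarrow> y \<in> {a}"
    by (rule openin_Euclidean_box[OF assms, of a]) auto
  have "a(0 := a 0 + e / 2) \<in> {a}"
  proof (rule e(2))
    show "a(0 := a 0 + e / 2) \<in> Rn n"
      using openin_subset_Rn[OF assms] n by (intro upd_in_Rn) auto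
  qed (use e(1) in auto)
  then have "(a(0 := a 0 + e / 2)) 0 = a 0" by simp
  then show False using e(1) by simp
qed

text \<open>
  A chart of a point has an open image with one element, so its dimension is zero.
\<close>

lemma submanifold_tangent_point:
  "submanifold_tangent M {y} x \<subseteq> {\<lambda>c i. 0}"
proof
  fix t assume "t \<in> submanifold_tangent M {y} x"
  then obtain n c v where c: "submanifold_chart M {y} n c" "x \<in> fst c" and v: "v \<in> Rn n"
    and t: "t = velocity M (inverse_param n c) (snd c x) v"
    by (auto simp: submanifold_tangent_def)
  have "fst c = {x}" using submanifold_chart_subset[OF c(1)] c(2) by auto
  then have "n = 0"
    using submanifold_chartD(2)[OF c(1)] by (auto intro: openin_singleton_Euclidean)
  then have "v = (\<lambda>i. 0)" using v Rn_0 by blast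
  then show "t \<in> {\<lambda>c i. 0}" by (simp add: t)
qed

lemma positive_leaf_tangent:
  assumes L: "weakly_embedded M n L" "0 < n" and x: "x \<in> L"
  shows "\<exists>t\<in>submanifold_tangent M L x. t \<noteq> (\<lambda>c i. 0)"
proof -
  obtain c where c: "submanifold_chart M L n c" "x \<in> fst c"
    using L(1) x by (auto simp: weakly_embedded_def diffeological_submanifold_def)
  let ?v = "velocity M (inverse_param n c) (snd c x)"
  have "inj_on ?v (Rn n)" using L(1) c unfolding weakly_embedded_def by blast
  moreover have "unit_vec 0 \<noteq> (\<lambda>i. 0)" by (metis unit_vec_def zero_neq_one)
  ultimately have "?v (unit_vec 0) \<noteq> ?v (\<lambda>i. 0)"
    using unit_vec_in_Rn[OF L(2)] zero_in_Rn unfolding inj_on_def by blast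
  then have "?v (unit_vec 0) \<noteq> (\<lambda>c i. 0)" by simp
  moreover have "?v (unit_vec 0) \<in> submanifold_tangent M L x"
    unfolding submanifold_tangent_def using c unit_vec_in_Rn[OF L(2)] by blast
  ultimately show ?thesis by blast
qed

lemma (in smooth_manifold) submanifold_tangent_subset: "submanifold_tangent M S x \<subseteq> tangent_space M x"
proof
  fix t assume "t \<in> submanifold_tangent M S x"
  then obtain n c v where c: "submanifold_chart M S n c" "x \<in> fst c" and v: "v \<in> Rn n"
    and t: "t = velocity M (inverse_param n c) (snd c x) v"
    by (auto simp: submanifold_tangent_def)
  show "t \<in> tangent_space M x"
    using velocity_in_tangent_space[OF submanifold_chart_plot[OF c(1)], of "snd c x" v] c v
    by (simp add: t pmap_submanifold_chart)
qed


section \<open>The part with leaves of positive dimension\<close>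

locale foliated_manifold = smooth_manifold +
  fixes \<F> :: "'a set set"
  assumes foliation: "singular_foliation M \<F>"
begin

abbreviation "\<Delta> \<equiv> foliation_distribution M \<F>"
abbreviation "\<F>pos \<equiv> positive_leaves M \<F>"
definition "W = \<Union>\<F>pos"
abbreviation "Mpos \<equiv> positive_part M \<F>"
abbreviation "\<Delta>pos \<equiv> foliation_distribution Mpos \<F>pos"
abbreviation "Dpos \<equiv> manifold_diffeology Mpos"

lemma partition: "partition_on (points M) \<F>"
  using foliation by (simp add: singular_foliation_def)

lemma positive_leaves_subset: "\<F>pos \<subseteq> \<F>"
  by (auto simp: positive_leaves_def)

lemma W_subset: "W \<subseteq> points M"
  using partition positive_leaves_subset by (auto simp: W_def partition_on_def)

lemma positive_partition: "partition_on W \<F>pos"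
proof (rule partition_onI)
  show "disjnt L L'" if "L \<in> \<F>pos" "L' \<in> \<F>pos" "L \<noteq> L'" for L L'
    using that positive_leaves_subset partition_onD2[OF partition] by (auto simp: disjoint_def disjnt_def)
  show "{} \<notin> \<F>pos"
    using positive_leaves_subset partition_onD3[OF partition] by auto
qed (simp add: W_def)

lemma class_of_positive:
  assumes "x \<in> W"
  shows "class_of \<F>pos x = class_of \<F> x"
proof -
  obtain L where "L \<in> \<F>pos" "x \<in> L" using assms by (auto simp: W_def)
  then show ?thesis
    using class_of_eq[OF partition, of L x] class_of_eq[OF positive_partition, of L x]
      positive_leaves_subset by auto
qed

lemma class_of_positive_iff: "x \<in> points M \<Longrightarrow> class_of \<F> x \<in> \<F>pos \<longleftrightarrow> x \<in> W"
  using class_of_in(2)[OF partition, of x] class_of_in(1)[OF positive_partition, of x] class_of_positive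
  by (auto simp: W_def)

lemma leaf_outside_W:
  assumes x: "x \<in> points M" "x \<notin> W"
  shows "class_of \<F> x = {x}"
proof -
  let ?L = "class_of \<F> x"
  have L: "?L \<in> \<F>" "x \<in> ?L" using class_of_in[OF partition x(1)] by auto
  then obtain n where n: "connected_leaf M ?L" "weakly_embedded M n ?L"
    using foliation by (auto simp: singular_foliation_def)
  have "n = 0"
    using n(2) L x(2) by (auto simp: W_def positive_leaves_def)
  with n(2) have "weakly_embedded M 0 ?L" by simp
  from zero_dimensional_leaf[OF n(1) this L(2)] show ?thesis .
qed

lemma distribution_outside_W: "x \<in> points M \<Longrightarrow> x \<notin> W \<Longrightarrow> t \<in> \<Delta> x \<Longrightarrow> t = (\<lambda>c i. 0)"
  using submanifold_tangent_point[of M x x] leaf_outside_W[of x] by (auto simp: foliation_distribution_def)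

text \<open>
  A section of the distribution which does not vanish at a point does not vanish near it. Hence leaves of
  positive dimension fill up an open set.
\<close>

lemma W_openin: "openin (mtop M) W"
proof (subst openin_subopen, intro ballI)
  fix x assume x: "x \<in> W"
  then have xM: "x \<in> points M" using W_subset by blast
  have "class_of \<F> x \<in> \<F>pos" using class_of_positive_iff[OF xM] x by blast
  then obtain n where n: "0 < n" "weakly_embedded M n (class_of \<F> x)"
    by (auto simp: positive_leaves_def)
  obtain t where t: "t \<in> \<Delta> x" "t \<noteq> (\<lambda>c i. 0)"
    using positive_leaf_tangent[OF n(2,1) class_of_in(2)[OF partition xM]]
    by (auto simp: foliation_distribution_def)
  then obtain N X where X: "local_section M \<Delta> N X" "x \<in> N" "X x = t"
    using foliation xM unfolding singular_foliation_def smooth_singular_distribution_def by blast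
  obtain c j where cj: "t c j \<noteq> 0" using t(2) by (auto simp: fun_eq_iff)
  have tT: "t \<in> tangent_space M x" using local_sectionD(2)[OF X(1,2)] X(3) by simp
  have "t c \<noteq> (\<lambda>i. 0)" using cj by (intro notI) simp
  then have c: "c \<in> atlas M" "x \<in> fst c" using tangent_spaceD(1)[OF tT, of c] by blast+
  define A where "A = snd c ` (fst c \<inter> N)"
  have A: "openin (Euclidean_space m) A"
    unfolding A_def by (rule chart_image_Int_openin[OF c(1) local_sectionD(1)[OF X(1)]])
  have "continuous_on A (\<lambda>w. coord_field c X w j)"
    using smooth_fun_continuous[OF A smooth_map_component[OF A]] local_sectionD(4)[OF X(1) c(1)]
    by (simp add: A_def)
  then have V: "openin (Euclidean_space m) {w\<in>A. coord_field c X w j \<noteq> 0}"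
    by (rule openin_Collect_neq_0[OF A])
  let ?O = "{y \<in> fst c. snd c y \<in> {w\<in>A. coord_field c X w j \<noteq> 0}}"
  have "continuous_map (subtopology (mtop M) (fst c)) (Euclidean_space m) (snd c)"
    using homeomorphic_imp_continuous_map[OF chart_homeomorphic[OF c(1)]]
    by (rule continuous_map_into_fulltopology)
  from openin_continuous_map_preimage[OF this V]
  have "openin (subtopology (mtop M) (fst c)) ?O"
    using chart_subset[OF c(1)] by (simp add: Int_absorb1)
  then have "openin (mtop M) ?O"
    using chart_openin[OF c(1)] openin_trans_full by blast
  moreover have "x \<in> ?O"
    using c X(2,3) cj by (auto simp: A_def coord_field_def chart_inv_left)
  moreover have "?O \<subseteq> W"
  proof
    fix y assume y: "y \<in> ?O"
    then obtain z where z: "z \<in> fst c" "z \<in> N" "snd c y = snd c z" and yc: "y \<in> fst c"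
      by (auto simp: A_def)
    then have yN: "y \<in> N" using inj_onD[OF chart_inj[OF c(1)] z(3) yc z(1)] by simp
    have "X y c j \<noteq> 0" using y chart_inv_left[OF c(1) yc] by (simp add: coord_field_def)
    then have "X y \<noteq> (\<lambda>c i. 0)" by (intro notI) simp
    then show "y \<in> W"
      using distribution_outside_W[OF _ _ local_sectionD(3)[OF X(1) yN]] chart_subset[OF c(1)] yc by blast
  qed
  ultimately show "\<exists>T. openin (mtop M) T \<and> x \<in> T \<and> T \<subseteq> W" by blast
qed


subsection \<open>Charts, plots and vector fields on the open part\<close>

abbreviation subchart :: "'a chart \<Rightarrow> 'a chart" where
  "subchart c \<equiv> (fst c \<inter> W, snd c)"

lemma Mpos_sel: "mtop Mpos = subtopology (mtop M) W" "mdim Mpos = m" "atlas Mpos = subchart ` atlas M"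
  by (simp_all add: positive_part_def open_submanifold_def case_prod_beta W_def)

lemma points_Mpos: "points Mpos = W"
  using W_subset by (auto simp: Mpos_sel)

lemma atlas_MposE:
  assumes "c' \<in> atlas Mpos" obtains c where "c \<in> atlas M" "c' = subchart c"
  using assms by (auto simp: Mpos_sel)

lemma subchart_inv:
  assumes c: "c \<in> atlas M" and u: "u \<in> snd c ` (fst c \<inter> W)"
  shows "inv_into (fst c \<inter> W) (snd c) u = inv_into (fst c) (snd c) u"
proof -
  obtain x where x: "x \<in> fst c \<inter> W" "u = snd c x" using u by blast
  have "inv_into (fst c \<inter> W) (snd c) (snd c x) = x"
    using inj_on_subset[OF chart_inj[OF c]] x(1) by (intro inv_into_f_f) auto
  then show ?thesis using x chart_inv_left[OF c] by simp
qed

lemma subchart_image_openin: "c \<in> atlas M \<Longrightarrow> openin (Euclidean_space m) (snd c ` (fst c \<inter> W))"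
  by (rule chart_image_Int_openin[OF _ W_openin])

lemma is_manifold_Mpos: "is_manifold Mpos"
  unfolding is_manifold_def case_prod_beta
proof (intro conjI ballI)
  show "Hausdorff_space (mtop Mpos)" "second_countable (mtop Mpos)"
    using manifold by (auto simp: is_manifold_def Mpos_sel Hausdorff_space_subtopology second_countable_subtopology)
  show "(\<Union>c\<in>atlas Mpos. fst c) = points Mpos"
    using chart_at chart_subset W_subset by (fastforce simp: points_Mpos Mpos_sel)
next
  fix c' assume "c' \<in> atlas Mpos"
  then obtain c where c: "c \<in> atlas M" "c' = subchart c" by (rule atlas_MposE)
  show "openin (mtop Mpos) (fst c')"
    using chart_openin[OF c(1)] by (auto simp: Mpos_sel c(2) openin_subtopology)
  show "openin (Euclidean_space (mdim Mpos)) (snd c' ` fst c')"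
    using subchart_image_openin[OF c(1)] by (simp add: Mpos_sel c(2))
  have "homeomorphic_map (subtopology (subtopology (mtop M) (fst c)) (fst c \<inter> W))
      (subtopology (subtopology (Euclidean_space m) (snd c ` fst c)) (snd c ` (fst c \<inter> W))) (snd c)"
    using chart_subset[OF c(1)] openin_subset[OF subchart_image_openin[OF c(1)]]
    by (intro homeomorphic_map_subtopologies[OF chart_homeomorphic[OF c(1)]]) auto
  moreover have "fst c \<inter> (fst c \<inter> W) = W \<inter> (fst c \<inter> W)"
    "snd c ` fst c \<inter> snd c ` (fst c \<inter> W) = snd c ` (fst c \<inter> W)"
    by auto
  ultimately show "homeomorphic_map (subtopology (mtop Mpos) (fst c'))
      (subtopology (Euclidean_space (mdim Mpos)) (snd c' ` fst c')) (snd c')"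
    by (simp add: Mpos_sel c(2) subtopology_subtopology)
next
  fix c1' c2' assume "c1' \<in> atlas Mpos" "c2' \<in> atlas Mpos"
  then obtain c1 c2 where c1: "c1 \<in> atlas M" "c1' = subchart c1" and c2: "c2 \<in> atlas M" "c2' = subchart c2"
    by (metis atlas_MposE)
  let ?V = "snd c1 ` (fst c1 \<inter> (fst c2 \<inter> W))"
  have V: "openin (Euclidean_space m) ?V"
    using openin_Int[OF chart_openin[OF c2(1)] W_openin] by (rule chart_image_Int_openin[OF c1(1)])
  have "smooth_map m ?V m (\<lambda>u. snd c2 (inv_into (fst c1) (snd c1) u))"
    by (rule smooth_map_subset[OF chart_image_Int_openin[OF c1(1) chart_openin[OF c2(1)]] V _
          chart_transition[OF c1(1) c2(1)]]) auto
  then have "smooth_map m ?V m (snd c2 \<circ> inv_into (fst c1 \<inter> W) (snd c1))"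
  proof (rule smooth_map_cong[OF V, rotated])
    fix u assume "u \<in> ?V"
    then have "u \<in> snd c1 ` (fst c1 \<inter> W)" by auto
    then show "snd c2 (inv_into (fst c1) (snd c1) u) = (snd c2 \<circ> inv_into (fst c1 \<inter> W) (snd c1)) u"
      by (simp add: subchart_inv[OF c1(1)])
  qed
  moreover have "fst c1' \<inter> fst c2' = fst c1 \<inter> (fst c2 \<inter> W)" using c1 c2 by auto
  ultimately show "smooth_map (mdim Mpos) (snd c1' ` (fst c1' \<inter> fst c2')) (mdim Mpos)
      (snd c2' \<circ> inv_into (fst c1') (snd c1'))"
    using c1 c2 by (simp add: Mpos_sel)
qed

sublocale pos: smooth_manifold Mpos
  by unfold_locales (rule is_manifold_Mpos)

lemma Dpos_eq: "Dpos = {p \<in> D. pmap p ` pdom p \<subseteq> W}"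
proof (intro set_eqI iffI)
  fix p assume p: "p \<in> Dpos"
  have im: "pmap p ` pdom p \<subseteq> W" using pos.plot_in_points[OF p] by (auto simp: points_Mpos)
  have "p \<in> D"
  proof (rule plotI)
    show "is_param (points M) p"
      using pos.plotD(1)[OF p] W_subset unfolding is_param_def points_Mpos
      by (auto simp: PiE_iff)
    show "continuous_map (subtopology (Euclidean_space (pdim p)) (pdom p)) (mtop M) (pmap p)"
      using pos.plotD(2)[OF p] by (simp add: Mpos_sel continuous_map_in_subtopology)
    fix c assume c: "c \<in> atlas M"
    have "{u \<in> pdom p. pmap p u \<in> fst (subchart c)} = {u \<in> pdom p. pmap p u \<in> fst c}" using im by auto
    then show "smooth_map (pdim p) {u \<in> pdom p. pmap p u \<in> fst c} m (\<lambda>u. snd c (pmap p u))"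
      using pos.plotD(3)[OF p, of "subchart c"] c by (simp add: Mpos_sel)
  qed
  with im show "p \<in> {p \<in> D. pmap p ` pdom p \<subseteq> W}" by simp
next
  fix p assume "p \<in> {p \<in> D. pmap p ` pdom p \<subseteq> W}"
  then have p: "p \<in> D" and im: "pmap p ` pdom p \<subseteq> W" by auto
  show "p \<in> Dpos"
  proof (rule pos.plotI)
    show "is_param (points Mpos) p"
      using plotD(1)[OF p] im unfolding is_param_def points_Mpos by (auto simp: PiE_iff)
    show "continuous_map (subtopology (Euclidean_space (pdim p)) (pdom p)) (mtop Mpos) (pmap p)"
      using plotD(2)[OF p] im by (auto simp: Mpos_sel continuous_map_in_subtopology)
    fix c' assume "c' \<in> atlas Mpos"
    then obtain c where c: "c \<in> atlas M" "c' = subchart c" by (rule atlas_MposE)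
    have "{u \<in> pdom p. pmap p u \<in> fst c'} = {u \<in> pdom p. pmap p u \<in> fst c}" using im c(2) by auto
    then show "smooth_map (pdim p) {u \<in> pdom p. pmap p u \<in> fst c'} (mdim Mpos) (\<lambda>u. snd c' (pmap p u))"
      using plotD(3)[OF p c(1)] c(2) by (simp add: Mpos_sel)
  qed
qed

lemma subchart_inverse_param:
  assumes c: "c \<in> atlas M"
  shows "inverse_param m (subchart c) = subparam (chart_inv c) (snd c ` (fst c \<inter> W))"
  using subchart_inv[OF c]
  by (auto simp: inverse_param_def reparam_def restrict_def fun_eq_iff)

lemma velocity_subchart:
  "c \<in> atlas M \<Longrightarrow> pmap p u \<in> W \<Longrightarrow> velocity Mpos p u v (subchart c) = velocity M p u v c"
  by (simp add: velocity_def Mpos_sel)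

lemma subset_diffeology_Mpos: "L \<subseteq> W \<Longrightarrow> subset_diffeology L Dpos = subset_diffeology L D"
  by (auto simp: subset_diffeology_def Dpos_eq)

lemma submanifold_chart_Mpos: "L \<subseteq> W \<Longrightarrow> submanifold_chart Mpos L n c = submanifold_chart M L n c"
  by (simp add: submanifold_chart_def subset_diffeology_Mpos)


text \<open>
  Tangent vectors of \<open>M\<close> and of its open part are families indexed by different atlases. Vectors tangent
  to the leaves are compared as velocities of the same plots. Charts of \<open>M\<close> with the same restriction
  give a single chart of the open part; such velocities have the same coordinates in all of them, so that the
  choice in the restriction is immaterial.
\<close>

definition restrict_field :: "('a \<Rightarrow> 'a tvec) \<Rightarrow> 'a \<Rightarrow> 'a tvec" where
  "restrict_field X x = (\<lambda>c'. if c' \<in> atlas Mpos \<and> x \<in> fst c'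
     then X x (SOME c. c \<in> atlas M \<and> subchart c = c') else (\<lambda>i. 0))"

definition extend_field :: "('a \<Rightarrow> 'a tvec) \<Rightarrow> 'a \<Rightarrow> 'a tvec" where
  "extend_field X x = (\<lambda>c. if c \<in> atlas M \<and> x \<in> fst c then X x (subchart c) else (\<lambda>i. 0))"

lemma class_subset_W: "x \<in> W \<Longrightarrow> class_of \<F> x \<subseteq> W"
  using class_of_in(1)[OF positive_partition, of x] class_of_positive[of x] by (auto simp: W_def)

lemma restrict_field_distribution:
  assumes x: "x \<in> W" and t: "X x \<in> \<Delta> x"
  shows "restrict_field X x \<in> \<Delta>pos x"
    and "c \<in> atlas M \<Longrightarrow> x \<in> fst c \<Longrightarrow> restrict_field X x (subchart c) = X x c"
proof -
  let ?L = "class_of \<F> x"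
  obtain n c0 v where c0: "submanifold_chart M ?L n c0" "x \<in> fst c0" and v: "v \<in> Rn n"
    and Xx: "X x = velocity M (inverse_param n c0) (snd c0 x) v"
    using t by (auto simp: foliation_distribution_def submanifold_tangent_def)
  let ?p = "inverse_param n c0"
  have px: "pmap ?p (snd c0 x) = x" by (rule pmap_submanifold_chart[OF c0])
  have eq: "restrict_field X x = velocity Mpos ?p (snd c0 x) v"
  proof
    fix c'
    show "restrict_field X x c' = velocity Mpos ?p (snd c0 x) v c'"
    proof (cases "c' \<in> atlas Mpos \<and> x \<in> fst c'")
      case True
      define c where "c = (SOME c. c \<in> atlas M \<and> subchart c = c')"
      have c: "c \<in> atlas M \<and> subchart c = c'"
        unfolding c_def by (rule someI_ex) (use True in \<open>auto simp: Mpos_sel\<close>)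
      have "restrict_field X x c' = velocity M ?p (snd c0 x) v c"
        using True by (simp add: restrict_field_def c_def Xx)
      also have "\<dots> = velocity Mpos ?p (snd c0 x) v (subchart c)"
        by (rule velocity_subchart[symmetric]) (use c px x in auto)
      finally show ?thesis using c by simp
    next
      case False
      then show ?thesis using px by (auto simp: restrict_field_def velocity_def)
    qed
  qed
  have "submanifold_chart Mpos (class_of \<F>pos x) n c0"
    using c0(1) submanifold_chart_Mpos[OF class_subset_W[OF x]] class_of_positive[OF x] by simp
  then show "restrict_field X x \<in> \<Delta>pos x"
    unfolding eq foliation_distribution_def submanifold_tangent_def using c0(2) v by blast
  show "restrict_field X x (subchart c) = X x c" if "c \<in> atlas M" "x \<in> fst c" for c
    using velocity_subchart[OF that(1), of ?p "snd c0 x" v] px x by (simp add: eq Xx)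
qed

lemma extend_field_distribution:
  assumes x: "x \<in> W" and t: "X x \<in> \<Delta>pos x"
  shows "extend_field X x \<in> \<Delta> x"
proof -
  let ?L = "class_of \<F> x"
  obtain n c0 v where c0': "submanifold_chart Mpos ?L n c0" "x \<in> fst c0" and v: "v \<in> Rn n"
    and Xx: "X x = velocity Mpos (inverse_param n c0) (snd c0 x) v"
    using t class_of_positive[OF x] by (auto simp: foliation_distribution_def submanifold_tangent_def)
  have c0: "submanifold_chart M ?L n c0"
    using c0'(1) submanifold_chart_Mpos[OF class_subset_W[OF x]] by simp
  let ?p = "inverse_param n c0"
  have px: "pmap ?p (snd c0 x) = x" by (rule pmap_submanifold_chart[OF c0 c0'(2)])
  have "extend_field X x = velocity M ?p (snd c0 x) v"
  proof
    fix c
    show "extend_field X x c = velocity M ?p (snd c0 x) v c"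
    proof (cases "c \<in> atlas M \<and> x \<in> fst c")
      case True
      then show ?thesis
        using velocity_subchart[of c ?p "snd c0 x" v] px x by (simp add: extend_field_def Xx)
    next
      case False
      then show ?thesis using px by (auto simp: extend_field_def velocity_def)
    qed
  qed
  then show ?thesis
    unfolding foliation_distribution_def submanifold_tangent_def using c0 c0'(2) v by blast
qed

lemma local_section_restrict:
  assumes X: "local_section M \<Delta> N X"
  shows "local_section Mpos \<Delta>pos (N \<inter> W) (restrict_field X)"
    and "c \<in> atlas M \<Longrightarrow> u \<in> snd c ` (fst c \<inter> N \<inter> W) \<Longrightarrow>
      coord_field (subchart c) (restrict_field X) u = coord_field c X u"
proof -
  show cf: "coord_field (subchart c) (restrict_field X) u = coord_field c X u"
    if c: "c \<in> atlas M" and u: "u \<in> snd c ` (fst c \<inter> N \<inter> W)" for c u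
  proof -
    obtain x where x: "x \<in> fst c" "x \<in> N" "x \<in> W" "u = snd c x" using u by blast
    have "inv_into (fst c \<inter> W) (snd c) u = x" "inv_into (fst c) (snd c) u = x"
      using subchart_inv[OF c, of u] chart_inv_left[OF c x(1)] x by auto
    then show ?thesis
      using restrict_field_distribution(2)[of x X, OF x(3) local_sectionD(3)[OF X x(2)] c x(1)]
      by (simp add: coord_field_def)
  qed
  show "local_section Mpos \<Delta>pos (N \<inter> W) (restrict_field X)"
  proof (rule pos.local_sectionI)
    show "openin (mtop Mpos) (N \<inter> W)"
      using local_sectionD(1)[OF X] by (auto simp: Mpos_sel openin_subtopology)
    show d: "restrict_field X y \<in> \<Delta>pos y" if "y \<in> N \<inter> W" for y
      using that restrict_field_distribution(1)[of y X] local_sectionD(3)[OF X] by blast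
    show "restrict_field X y \<in> tangent_space Mpos y" if "y \<in> N \<inter> W" for y
      using pos.submanifold_tangent_subset d[OF that] by (auto simp: foliation_distribution_def)
    fix c' assume "c' \<in> atlas Mpos"
    then obtain c where c: "c \<in> atlas M" "c' = subchart c" by (rule atlas_MposE)
    have eq: "snd c' ` (fst c' \<inter> (N \<inter> W)) = snd c ` (fst c \<inter> (N \<inter> W))" using c(2) by auto
    have o: "openin (Euclidean_space m) (snd c ` (fst c \<inter> (N \<inter> W)))" "openin (Euclidean_space m) (snd c ` (fst c \<inter> N))"
      using chart_image_Int_openin[OF c(1)] local_sectionD(1)[OF X] W_openin by (auto intro: openin_Int)
    have "smooth_map m (snd c ` (fst c \<inter> (N \<inter> W))) m (coord_field c X)"
      by (rule smooth_map_subset[OF o(2,1) _ local_sectionD(4)[OF X c(1)]]) auto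
    then have "smooth_map m (snd c ` (fst c \<inter> (N \<inter> W))) m (coord_field c' (restrict_field X))"
      by (rule smooth_map_cong[OF o(1), rotated]) (use cf[OF c(1)] c(2) in \<open>auto simp: Int_assoc\<close>)
    then show "smooth_map (mdim Mpos) (snd c' ` (fst c' \<inter> (N \<inter> W))) (mdim Mpos) (coord_field c' (restrict_field X))"
      unfolding eq by (simp add: Mpos_sel)
  qed
qed

lemma local_section_extend:
  assumes X: "local_section Mpos \<Delta>pos N X"
  shows "local_section M \<Delta> N (extend_field X)"
    and "N \<subseteq> W"
    and "c \<in> atlas M \<Longrightarrow> u \<in> snd c ` (fst c \<inter> N) \<Longrightarrow>
      coord_field c (extend_field X) u = coord_field (subchart c) X u"
proof -
  show NW: "N \<subseteq> W" using openin_subset[OF pos.local_sectionD(1)[OF X]] by (simp add: points_Mpos)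
  show cf: "coord_field c (extend_field X) u = coord_field (subchart c) X u"
    if c: "c \<in> atlas M" and u: "u \<in> snd c ` (fst c \<inter> N)" for c u
  proof -
    obtain x where x: "x \<in> fst c" "x \<in> N" "u = snd c x" using u by blast
    have "inv_into (fst c \<inter> W) (snd c) u = x" "inv_into (fst c) (snd c) u = x"
      using subchart_inv[OF c, of u] chart_inv_left[OF c x(1)] x NW by auto
    then show ?thesis using c x by (simp add: coord_field_def extend_field_def)
  qed
  show "local_section M \<Delta> N (extend_field X)"
  proof (rule local_sectionI)
    show N: "openin (mtop M) N"
      using pos.local_sectionD(1)[OF X] W_openin by (simp add: Mpos_sel openin_open_subtopology)
    show d: "extend_field X y \<in> \<Delta> y" if "y \<in> N" for y
      using that NW extend_field_distribution[of y X] pos.local_sectionD(3)[OF X] by blast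
    show "extend_field X y \<in> tangent_space M y" if "y \<in> N" for y
      using submanifold_tangent_subset d[OF that] by (auto simp: foliation_distribution_def)
    fix c assume c: "c \<in> atlas M"
    have "snd (subchart c) ` (fst (subchart c) \<inter> N) = snd c ` (fst c \<inter> N)" using NW by auto
    then have "smooth_map m (snd c ` (fst c \<inter> N)) m (coord_field (subchart c) X)"
      using pos.local_sectionD(4)[OF X, of "subchart c"] c by (simp add: Mpos_sel)
    then show "smooth_map m (snd c ` (fst c \<inter> N)) m (coord_field c (extend_field X))"
      by (rule smooth_map_cong[OF chart_image_Int_openin[OF c N], rotated]) (simp add: cf[OF c])
  qed
qed


sublocale whole: partitioned_diffeology "points M" D \<F>
  by unfold_locales (rule partition)

sublocale open_part: partitioned_diffeology "points Mpos" Dpos \<F>pos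
  by unfold_locales (simp add: points_Mpos positive_partition)

lemma Dpos_subset: "Dpos \<subseteq> D"
  by (auto simp: Dpos_eq)

lemma leaf_space_positive: "open_part.Q \<subseteq> whole.Q"
proof
  fix p assume p: "p \<in> open_part.Q"
  show "p \<in> whole.Q"
  proof (rule whole.quotientI)
    show "is_param \<F> p"
      using open_part.quotient_is_param[OF p] positive_leaves_subset by (auto simp: is_param_def PiE_iff)
    fix u assume "u \<in> pdom p"
    then obtain q where q: "open_part.lift p u q" using open_part.quotient_lift[OF p] by blast
    then have "q \<in> Dpos" by (simp add: open_part.lift_def)
    then have qD: "q \<in> D" and im: "\<And>v. v \<in> pdom q \<Longrightarrow> pmap q v \<in> W"
      by (auto simp: Dpos_eq)
    have "whole.lift p u q"
      using q qD class_of_positive[OF im] by (simp add: open_part.lift_def whole.lift_def)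
    then show "\<exists>q. whole.lift p u q" by blast
  qed
qed

lemma project_positive: "p \<in> Dpos \<Longrightarrow> param_compose (class_of \<F>pos) p = param_compose (class_of \<F>) p"
  using class_of_positive by (intro param_compose_cong) (auto simp: Dpos_eq)

lemma pullback_restrict:
  "dform_pullback Dpos (class_of \<F>pos) (restrict_dform open_part.Q \<beta>) =
     restrict_dform Dpos (dform_pullback D (class_of \<F>) \<beta>)"
  using Dpos_subset open_part.project_plot
  by (auto simp: dform_pullback_def restrict_dform_def project_positive fun_eq_iff)

lemma restrict_dform_Dpos: "\<alpha> \<in> dforms D k \<Longrightarrow> restrict_dform Dpos \<alpha> \<in> dforms Dpos k"
  by (rule restrict_dform_in_dforms[OF _ Dpos_subset pos.plot_reparam])

lemma restrict_dform_Qpos: "\<beta> \<in> dforms whole.Q k \<Longrightarrow> restrict_dform open_part.Q \<beta> \<in> dforms open_part.Q k"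
  by (rule restrict_dform_in_dforms[OF _ leaf_space_positive open_part.quotient_reparam(1)])


subsection \<open>Basic forms on the open part\<close>

lemma restrict_dform_in_subchart:
  assumes \<alpha>: "\<alpha> \<in> dforms D k" and c: "c \<in> atlas M" and u: "u \<in> snd c ` (fst c \<inter> W)"
  shows "restrict_dform Dpos \<alpha> (inverse_param (mdim Mpos) (subchart c)) u = \<alpha> (chart_inv c) u"
proof
  fix vs
  have "inverse_param (mdim Mpos) (subchart c) \<in> Dpos"
    using c by (intro pos.chart_inv_plot) (simp add: Mpos_sel)
  then have "restrict_dform Dpos \<alpha> (inverse_param (mdim Mpos) (subchart c)) =
      \<alpha> (subparam (chart_inv c) (snd c ` (fst c \<inter> W)))"
    by (simp add: restrict_dform_def Mpos_sel subchart_inverse_param[OF c])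
  moreover have "\<alpha> (subparam (chart_inv c) (snd c ` (fst c \<inter> W))) u vs = \<alpha> (chart_inv c) u vs"
    by (rule dforms_subparam[OF \<alpha> chart_inv_plot[OF c]]) (use subchart_image_openin[OF c] u in auto)
  ultimately show "restrict_dform Dpos \<alpha> (inverse_param (mdim Mpos) (subchart c)) u vs = \<alpha> (chart_inv c) u vs"
    by simp
qed

text \<open>
  Both conditions depend only on the germs of the coefficients of the form and of the field in the chart.
\<close>

lemma basic_at_subchart:
  assumes \<alpha>: "\<alpha> \<in> dforms D k" and c: "c \<in> atlas M" and N: "openin (mtop M) N" "N \<subseteq> W"
    and u: "u \<in> snd c ` (fst c \<inter> N)"
    and X: "\<And>w. w \<in> snd c ` (fst c \<inter> N) \<Longrightarrow> coord_field (subchart c) Y w = coord_field c X w"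
    and XR: "coord_field c X u \<in> Rn m"
  shows "pos.basic_at (restrict_dform Dpos \<alpha>) Y (subchart c) u \<longleftrightarrow> basic_at \<alpha> X c u"
proof -
  let ?A = "snd c ` (fst c \<inter> N)"
  let ?\<omega> = "restrict_dform Dpos \<alpha> (inverse_param (mdim Mpos) (subchart c))"
  have A: "openin (Euclidean_space m) ?A" by (rule chart_image_Int_openin[OF c N(1)])
  have \<omega>: "\<alpha> (chart_inv c) w = ?\<omega> w" if "w \<in> ?A" for w
    using restrict_dform_in_subchart[OF \<alpha> c, of w] that N(2) by auto
  have "form_lie (coord_field c X) (\<alpha> (chart_inv c)) u vs = form_lie (coord_field (subchart c) Y) ?\<omega> u vs"
    if "set vs \<subseteq> Rn m" for vs
    by (rule form_lie_cong[of m ?A "\<alpha> (chart_inv c)" ?\<omega> "coord_field c X" "coord_field (subchart c) Y" u vs,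
          OF A \<omega> _ u XR that]) (simp_all add: X)
  then show ?thesis
    unfolding basic_at_def pos.basic_at_def using \<omega>[OF u] X[OF u] by (simp add: Mpos_sel)
qed

lemma section_coord_in_Rn:
  assumes X: "local_section M \<Delta> N X" and c: "c \<in> atlas M" and u: "u \<in> snd c ` (fst c \<inter> N)"
  shows "coord_field c X u \<in> Rn m"
  using smooth_map_image[OF local_sectionD(4)[OF X c]] u by blast

lemma restrict_basic_form:
  assumes \<alpha>: "\<alpha> \<in> basic_forms M \<F> k"
  shows "restrict_dform Dpos \<alpha> \<in> basic_forms Mpos \<F>pos k"
  unfolding pos.basic_forms_eq
proof (intro CollectI conjI allI impI ballI)
  have \<alpha>D: "\<alpha> \<in> dforms D k" using \<alpha> by (simp add: basic_forms_eq)
  show "restrict_dform Dpos \<alpha> \<in> dforms Dpos k" by (rule restrict_dform_Dpos[OF \<alpha>D])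
  fix N Y c' u
  assume Y: "local_section Mpos \<Delta>pos N Y" and "c' \<in> atlas Mpos" and u': "u \<in> snd c' ` (fst c' \<inter> N)"
  then obtain c where c: "c \<in> atlas M" "c' = subchart c" by (auto elim: atlas_MposE)
  note E = local_section_extend[OF Y]
  have u: "u \<in> snd c ` (fst c \<inter> N)" using u' c(2) by auto
  have "basic_at \<alpha> (extend_field Y) c u"
    using \<alpha> E(1) c(1) u unfolding basic_forms_eq by blast
  moreover have "pos.basic_at (restrict_dform Dpos \<alpha>) Y (subchart c) u \<longleftrightarrow> basic_at \<alpha> (extend_field Y) c u"
  proof (rule basic_at_subchart[OF \<alpha>D c(1) local_sectionD(1)[OF E(1)] E(2) u])
    show "coord_field (subchart c) Y w = coord_field c (extend_field Y) w" if "w \<in> snd c ` (fst c \<inter> N)" for w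
      using E(3)[OF c(1) that] by simp
    show "coord_field c (extend_field Y) u \<in> Rn m" by (rule section_coord_in_Rn[OF E(1) c(1) u])
  qed
  ultimately show "pos.basic_at (restrict_dform Dpos \<alpha>) Y c' u" by (simp add: c(2))
qed

lemma basic_at_in_W:
  assumes \<alpha>: "\<alpha> \<in> dforms D k" and basic: "restrict_dform Dpos \<alpha> \<in> basic_forms Mpos \<F>pos k"
    and X: "local_section M \<Delta> N X" and c: "c \<in> atlas M" and u: "u \<in> snd c ` (fst c \<inter> (N \<inter> W))"
  shows "basic_at \<alpha> X c u"
proof -
  note R = local_section_restrict[OF X]
  have N: "openin (mtop M) (N \<inter> W)" using local_sectionD(1)[OF X] W_openin by (rule openin_Int)
  have "u \<in> snd (subchart c) ` (fst (subchart c) \<inter> (N \<inter> W))" using u by auto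
  moreover have "subchart c \<in> atlas Mpos" using c by (simp add: Mpos_sel)
  ultimately have "pos.basic_at (restrict_dform Dpos \<alpha>) (restrict_field X) (subchart c) u"
    using basic R(1) unfolding pos.basic_forms_eq by blast
  moreover have "pos.basic_at (restrict_dform Dpos \<alpha>) (restrict_field X) (subchart c) u \<longleftrightarrow> basic_at \<alpha> X c u"
  proof (rule basic_at_subchart[OF \<alpha> c N _ u])
    show "coord_field (subchart c) (restrict_field X) w = coord_field c X w"
      if "w \<in> snd c ` (fst c \<inter> (N \<inter> W))" for w
      using R(2)[OF c, of w] that by (simp add: Int_assoc)
    show "coord_field c X u \<in> Rn m" using section_coord_in_Rn[OF X c, of u] u by auto
  qed auto
  ultimately show ?thesis by blast
qed

text \<open>
  Off \<^term>\<open>W\<close> every section of the distribution vanishes. So an interior product vanishes there at once, and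
  if a Lie derivative were nonzero somewhere, then it would be nonzero on an open set, which avoids
  \<^term>\<open>W\<close>. But on that open set the section vanishes together with its derivatives.
\<close>

lemma basic_if_basic_on_open_part:
  assumes \<alpha>: "\<alpha> \<in> dforms D k" and basic: "restrict_dform Dpos \<alpha> \<in> basic_forms Mpos \<F>pos k"
  shows "\<alpha> \<in> basic_forms M \<F> k"
  unfolding basic_forms_eq
proof (intro CollectI conjI allI impI ballI \<alpha>)
  fix N X c u
  assume X: "local_section M \<Delta> N X" and c: "c \<in> atlas M" and u: "u \<in> snd c ` (fst c \<inter> N)"
  let ?\<omega> = "\<alpha> (chart_inv c)" and ?X = "coord_field c X"
  define A where "A = snd c ` (fst c \<inter> N)"
  define B where "B = snd c ` (fst c \<inter> (N \<inter> W))"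
  have A: "openin (Euclidean_space m) A"
    unfolding A_def by (rule chart_image_Int_openin[OF c local_sectionD(1)[OF X]])
  have uA: "u \<in> A" using u by (simp add: A_def)
  have AV: "A \<subseteq> snd c ` fst c" by (auto simp: A_def)
  note V = chart_image_openin[OF c]
  have \<omega>: "is_form m (snd c ` fst c) k ?\<omega>"
    using dforms_is_form[OF \<alpha> chart_inv_plot[OF c]] by simp
  have on_W: "basic_at \<alpha> X c w" if "w \<in> B" for w
    using basic_at_in_W[OF \<alpha> basic X c] that by (simp add: B_def)
  have off_W: "?X w = (\<lambda>i. 0)" if w: "w \<in> A" "w \<notin> B" for w
  proof -
    obtain x where x: "x \<in> fst c" "x \<in> N" "w = snd c x" using w(1) by (auto simp: A_def)
    then have "x \<notin> W" using w(2) by (auto simp: B_def)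
    then have "X x = (\<lambda>c i. 0)"
      using distribution_outside_W[OF _ _ local_sectionD(3)[OF X x(2)]] chart_subset[OF c] x(1) by blast
    then show ?thesis using x chart_inv_left[OF c x(1)] by (simp add: coord_field_def)
  qed
  show "basic_at \<alpha> X c u"
    unfolding basic_at_def
  proof (intro allI impI conjI)
    fix vs assume vs: "set vs \<subseteq> Rn m"
    show "?\<omega> u (?X u # vs) = 0"
    proof (cases "u \<in> B")
      case True
      then show ?thesis using on_W vs by (simp add: basic_at_def)
    next
      case False
      have "?\<omega> u ([] @ (\<lambda>i. 0) # vs) = 0"
      proof (cases "Suc (length vs) = k")
        case True
        then show ?thesis
          using is_form_multilinear[OF \<omega>, of u] AV uA vs by (intro alternating_multilinear_zero) auto
      next
        case False
        then show ?thesis using is_form_eq_0[OF \<omega>] by simp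
      qed
      then show ?thesis using off_W[OF uA False] by simp
    qed
    show "form_lie ?X ?\<omega> u vs = 0"
    proof (cases "length vs = k")
      case False
      then have "?\<omega> w vs = 0" "?\<omega> w (vs[i := v]) = 0" for w i v
        using is_form_eq_0[OF \<omega>] by simp_all
      then show ?thesis by (simp add: form_lie_def dir_deriv_def)
    next
      case k: True
      let ?f = "\<lambda>w. form_lie ?X ?\<omega> w vs"
      let ?S = "{w\<in>A. ?f w \<noteq> 0}"
      have "smooth_map m A m ?X" using local_sectionD(4)[OF X c] by (simp add: A_def)
      then have "continuous_on A ?f"
        by (intro smooth_fun_continuous[OF A] smooth_fun_form_lie[OF A V AV \<omega> _ k vs])
      then have S: "openin (Euclidean_space m) ?S" by (rule openin_Collect_neq_0[OF A])
      have "?S \<inter> B = {}" using on_W vs by (auto simp: basic_at_def)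
      then have zero: "?X w = (\<lambda>i. 0)" if "w \<in> ?S" for w
        using that off_W by blast
      have "?f w = 0" if w: "w \<in> ?S" for w
      proof (rule form_lie_zero_field[OF S _ zero w vs])
        show "alternating_multilinear vec_lc (Rn m) (length vs) (?\<omega> w)"
          using is_form_multilinear[OF \<omega>, of w] w AV k by auto
      qed
      then show ?thesis using uA by blast
    qed
  qed
qed

text \<open>
  Two plots with the same projection to the leaf space meet \<^term>\<open>W\<close> over the same open set, and agree off it,
  where leaves are points. So if the pullbacks of a form by them agree over \<^term>\<open>W\<close>, then the set where they
  differ is an open set on which the plots coincide, hence empty.
\<close>

lemma pullbacks_agree_if_agree_on_open_part:
  assumes \<alpha>: "\<alpha> \<in> dforms D k"
    and agree: "\<And>P P'. P \<in> Dpos \<Longrightarrow> P' \<in> Dpos \<Longrightarrow>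
      param_compose (class_of \<F>pos) P = param_compose (class_of \<F>pos) P' \<Longrightarrow> \<alpha> P = \<alpha> P'"
    and P: "P \<in> D" and P': "P' \<in> D" and eq: "param_compose (class_of \<F>) P = param_compose (class_of \<F>) P'"
  shows "\<alpha> P = \<alpha> P'"
proof (intro ext)
  fix u vs
  have dim: "pdim P' = pdim P" and dom: "pdom P' = pdom P"
    using arg_cong[OF eq, of pdim] arg_cong[OF eq, of pdom] by simp_all
  have cls: "class_of \<F> (pmap P w) = class_of \<F> (pmap P' w)" if "w \<in> pdom P" for w
    using arg_cong[OF eq, of "\<lambda>p. pmap p w"] that dom by (simp add: pmap_param_compose)
  note form = dforms_is_form[OF \<alpha> P] dforms_is_form[OF \<alpha> P', unfolded dim dom]
  note dom_open = plot_dom_openin[OF P]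
  define B where "B = {w \<in> pdom P. pmap P w \<in> W}"
  have B': "pmap P' w \<in> W \<longleftrightarrow> pmap P w \<in> W" if "w \<in> pdom P" for w
    using cls[OF that] class_of_positive_iff[OF plot_in_points[OF P that]]
      class_of_positive_iff[OF plot_in_points[OF P', of w]] that dom by simp
  have B: "openin (Euclidean_space (pdim P)) B" "B \<subseteq> pdom P"
    unfolding B_def using plot_preimage_openin[OF P W_openin] by auto
  have on_W: "\<alpha> P w vs = \<alpha> P' w vs" if w: "w \<in> B" for w
  proof -
    have "subparam P B \<in> Dpos" "subparam P' B \<in> Dpos"
      using subparam_plot[OF P B] subparam_plot[OF P', of B] B B' dim dom
      by (auto simp: Dpos_eq pmap_reparam B_def)
    moreover have "param_compose (class_of \<F>) (subparam P B) = param_compose (class_of \<F>) (subparam P' B)"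
      using cls B(2) dim by (auto simp: param_compose_def reparam_def restrict_def fun_eq_iff)
    ultimately have "\<alpha> (subparam P B) = \<alpha> (subparam P' B)"
      by (intro agree) (simp_all add: project_positive)
    moreover have "\<alpha> (subparam P B) w vs = \<alpha> P w vs"
      by (rule dforms_subparam[OF \<alpha> P B w])
    moreover have "\<alpha> (subparam P' B) w vs = \<alpha> P' w vs"
      by (rule dforms_subparam[OF \<alpha> P' _ _ w]) (use B dim dom in auto)
    ultimately show ?thesis by simp
  qed
  have off_W: "pmap P w = pmap P' w" if w: "w \<in> pdom P" "w \<notin> B" for w
  proof -
    have "pmap P w \<notin> W" using w by (simp add: B_def)
    then have sing: "class_of \<F> (pmap P w) = {pmap P w}" "class_of \<F> (pmap P' w) = {pmap P' w}"
      using leaf_outside_W plot_in_points[OF P w(1)] plot_in_points[OF P', of w] w(1) dom B' by auto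
    show ?thesis using cls[OF w(1)] unfolding sing by (rule singleton_inject)
  qed
  let ?S = "{w \<in> pdom P. \<alpha> P w vs - \<alpha> P' w vs \<noteq> 0}"
  have "continuous_on (pdom P) (\<lambda>w. \<alpha> P w vs - \<alpha> P' w vs)"
    using form[THEN is_form_smooth[OF dom_open], THEN smooth_fun_continuous[OF dom_open]]
    by (rule continuous_on_diff)
  then have S: "openin (Euclidean_space (pdim P)) ?S" by (rule openin_Collect_neq_0[OF dom_open])
  have "pmap P w = pmap P' w" if "w \<in> ?S" for w
    using that on_W off_W by auto
  then have same: "subparam P ?S = subparam P' ?S"
    using dim by (auto simp: reparam_def restrict_def fun_eq_iff)
  have "\<alpha> P w vs = \<alpha> P' w vs" if w: "w \<in> ?S" for w
  proof -
    have "\<alpha> (subparam P ?S) w vs = \<alpha> P w vs"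
      by (rule dforms_subparam[OF \<alpha> P S _ w]) auto
    moreover have "\<alpha> (subparam P' ?S) w vs = \<alpha> P' w vs"
      by (rule dforms_subparam[OF \<alpha> P' _ _ w]) (use S dim dom in auto)
    ultimately show ?thesis using same by simp
  qed
  then have "?S = {}" by auto
  then show "\<alpha> P u vs = \<alpha> P' u vs"
    using is_form_eq_0[OF form(1), of u vs] is_form_eq_0[OF form(2), of u vs] by (cases "u \<in> pdom P") auto
qed

lemma quotient_pullback_iso_extends:
  assumes "quotient_pullback_iso Mpos \<F>pos"
  shows "quotient_pullback_iso M \<F>"
proof -
  have image: "dform_pullback Dpos (class_of \<F>pos) ` dforms open_part.Q k = basic_forms Mpos \<F>pos k" for k
    using assms unfolding quotient_pullback_iso_def dga_isomorphism_def bij_betw_def leaf_space_def by blast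
  have "dform_pullback D (class_of \<F>) ` dforms whole.Q k = basic_forms M \<F> k" for k
  proof (intro equalityI subsetI)
    fix \<alpha> assume "\<alpha> \<in> dform_pullback D (class_of \<F>) ` dforms whole.Q k"
    then obtain \<beta> where \<beta>: "\<beta> \<in> dforms whole.Q k" "\<alpha> = dform_pullback D (class_of \<F>) \<beta>" by blast
    show "\<alpha> \<in> basic_forms M \<F> k"
    proof (rule basic_if_basic_on_open_part)
      show "\<alpha> \<in> dforms D k" unfolding \<beta>(2) by (rule whole.pullback_in_dforms[OF \<beta>(1)])
      show "restrict_dform Dpos \<alpha> \<in> basic_forms Mpos \<F>pos k"
        unfolding \<beta>(2) pullback_restrict[symmetric] image[symmetric]
        by (rule imageI[OF restrict_dform_Qpos[OF \<beta>(1)]])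
    qed
  next
    fix \<alpha> assume \<alpha>: "\<alpha> \<in> basic_forms M \<F> k"
    then have \<alpha>D: "\<alpha> \<in> dforms D k" by (simp add: basic_forms_eq)
    obtain \<beta> where \<beta>: "restrict_dform Dpos \<alpha> = dform_pullback Dpos (class_of \<F>pos) \<beta>"
      using restrict_basic_form[OF \<alpha>] image[of k] by blast
    have "\<alpha> P = \<alpha> P'" if "P \<in> Dpos" "P' \<in> Dpos"
      "param_compose (class_of \<F>pos) P = param_compose (class_of \<F>pos) P'" for P P'
    proof -
      have "restrict_dform Dpos \<alpha> P = restrict_dform Dpos \<alpha> P'"
        using that by (simp add: \<beta> dform_pullback_def)
      then show ?thesis using that by (simp add: restrict_dform_def)
    qed
    then have "\<alpha> P = \<alpha> P'" if "P \<in> D" "P' \<in> D"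
      "param_compose (class_of \<F>) P = param_compose (class_of \<F>) P'" for P P'
      using pullbacks_agree_if_agree_on_open_part[OF \<alpha>D _ that] by blast
    from whole.dform_descends[OF \<alpha>D this]
    show "\<alpha> \<in> dform_pullback D (class_of \<F>) ` dforms whole.Q k" by blast
  qed
  then show ?thesis
    unfolding quotient_pullback_iso_def leaf_space_def by (rule whole.dga_isomorphismI)
qed

end


theorem theorem5p17:
  fixes M :: "'a manifold" and \<F> :: "'a set set"
  assumes "is_manifold M"
    and "singular_foliation M \<F>"
    and "quotient_pullback_iso (positive_part M \<F>) (positive_leaves M \<F>)"
  shows "quotient_pullback_iso M \<F>"
proof -
  interpret foliated_manifold M \<F>
    using assms(1,2) by unfold_locales
  from assms(3) show ?thesis by (rule quotient_pullback_iso_extends)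
qed

end
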